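(* Let $g(t)=\exp(-\pi t^2)$ for $t\in\mathbb{R}$ and let $\Lambda$ be a regularly distributed set. If the Gabor system $\mathcal{G}_{g,\Lambda}=\{\rho_{x,y}g : (x,y)\in\Lambda\}$ is a complete and minimal system in $L^2(\mathbb{R})$, then \[ \frac{2}{\pi}\le \Delta_\Lambda\le 1 . \]
   Context: For $g\in L^2(\mathbb{R})$ and real numbers $x,y$, the time-frequency shift of $g$ with respect to the point $(x,y)$ is $\rho_{x,y}g(t)=e^{2\pi i y t}g(t-x)$. A system of vectors in $L^2(\mathbb{R})$ is complete if its linear span is dense in $L^2(\mathbb{R})$, and minimal if no vector of the system belongs to the closed linear span of the remaining vectors. $\Lambda$ denotes a sequence (set) of distinct points in $\mathbb{R}^2$, also viewed as a subset of $\mathbb{C}$ via the map $(\xi,\eta)\mapsto \xi+i\eta$. For $r>0$ and $0\le\theta<\vartheta\le 2\pi$ put \[ n_\Lambda(r,\theta,\vartheta)=\#\{\lambda\in\Lambda : |\lambda|<r,\ \theta<\arg\lambda\le\vartheta\}. \] The set $\Lambda$ has angular density if the limit \[ \Delta_\Lambda(\theta,\vartheta)=\lim_{r\to\infty}\frac{n_\Lambda(r,\theta,\vartheta)}{\pi r^2} \] exists for all $\theta$ and $\vartheta$ with $0\le\theta<\vartheta\le2\pi$, except possibly for a countable set of such pairs of numbers. In that case the limit $\Delta_\Lambda(0,2\pi)$ exists; one sets $\Delta_\Lambda=\Delta_\Lambda(0,2\pi)$ and calls it the density of $\Lambda$. The set $\Lambda$ is called regularly distributed if it has angular density and, in addition,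 the limit \[ \lim_{r\to\infty}\sum_{\lambda\in\Lambda,\ 0<|\lambda|<r}\lambda^{-2} \] exists (as a finite complex number). *)

theory Defs
  imports "HOL-Analysis.Analysis" "HOL-Library.Function_Algebras"
begin

section \<open>Systems of vectors in the complex space \<open>L\<^sup>2(\<real>)\<close>\<close>

text \<open>
  Elements of \<open>L\<^sup>2(\<real>)\<close> are represented by functions, without passing to classes modulo
  equality almost everywhere. Completeness and minimality below depend on functions only through
  the seminorm \<open>L2_seminorm\<close> of differences, so they do not depend on the choice of representatives.
\<close>

definition L2_space :: "(real \<Rightarrow> complex) set" where
  "L2_space = {f \<in> borel_measurable lborel. integrable lborel (\<lambda>t. (cmod (f t))\<^sup>2)}"

definition L2_seminorm :: "(real \<Rightarrow> complex) \<Rightarrow> real" where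
  "L2_seminorm f = sqrt (integral\<^sup>L lborel (\<lambda>t. (cmod (f t))\<^sup>2))"

text \<open>
  The scalar field is \<open>\<complex>\<close>, so the type class constant \<^const>\<open>span\<close> (real scalars) is not the right one.
\<close>

global_interpretation cfun: vector_space "\<lambda>(c::complex) (f::real \<Rightarrow> complex) t. c * f t"
  by unfold_locales (auto simp: fun_eq_iff algebra_simps)

definition L2_closed_span :: "(real \<Rightarrow> complex) set \<Rightarrow> (real \<Rightarrow> complex) set" where
  "L2_closed_span S = {f \<in> L2_space. \<forall>e>0. \<exists>h \<in> cfun.span S. L2_seminorm (\<lambda>t. f t - h t) < e}"

definition L2_complete :: "('i \<Rightarrow> real \<Rightarrow> complex) \<Rightarrow> 'i set \<Rightarrow> bool" where
  "L2_complete \<phi> I \<longleftrightarrow> L2_closed_span (\<phi> ` I) = L2_space"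

definition L2_minimal :: "('i \<Rightarrow> real \<Rightarrow> complex) \<Rightarrow> 'i set \<Rightarrow> bool" where
  "L2_minimal \<phi> I \<longleftrightarrow> (\<forall>i\<in>I. \<phi> i \<notin> L2_closed_span (\<phi> ` (I - {i})))"


section \<open>Gabor systems\<close>

definition tf_shift :: "real \<Rightarrow> real \<Rightarrow> (real \<Rightarrow> complex) \<Rightarrow> real \<Rightarrow> complex" where
  "tf_shift x y g = (\<lambda>t. exp (2 * of_real pi * \<i> * of_real y * of_real t) * g (t - x))"

definition gabor :: "(real \<Rightarrow> complex) \<Rightarrow> real \<times> real \<Rightarrow> real \<Rightarrow> complex" where
  "gabor g = (\<lambda>(x, y). tf_shift x y g)"


section \<open>Regularly distributed sets\<close>

definition to_complex :: "real \<times> real \<Rightarrow> complex" where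
  "to_complex = (\<lambda>(\<xi>, \<eta>). Complex \<xi> \<eta>)"

text \<open>
  The angular range is \<open>(0, 2\<pi>]\<close>: points on the positive real axis have argument \<open>2\<pi>\<close>, so
  they are counted by \<open>sector_count \<Lambda> r 0 (2 * pi)\<close>. This is why \<^const>\<open>Arg2pi\<close>, with
  values in \<open>[0, 2\<pi>)\<close>, is not used. The origin lies in every sector by this definition, which
  changes the count by at most one.
\<close>

definition sector_count :: "complex set \<Rightarrow> real \<Rightarrow> real \<Rightarrow> real \<Rightarrow> nat" where
  "sector_count \<Lambda> r \<theta> \<theta>' =
     card {z \<in> \<Lambda>. cmod z < r \<and> (\<exists>t. \<theta> < t \<and> t \<le> \<theta>' \<and> is_Arg z t)}"

text \<open>
  Finiteness of \<open>\<Lambda>\<close> in every disc is implicit in the existence of finite limits of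
  counting functions; it has to be stated because \<^const>\<open>card\<close> is zero on infinite sets.
\<close>

definition has_angular_density :: "complex set \<Rightarrow> bool" where
  "has_angular_density \<Lambda> \<longleftrightarrow>
     (\<forall>r. finite {z \<in> \<Lambda>. cmod z < r}) \<and>
     countable {(\<theta>, \<theta>'). 0 \<le> \<theta> \<and> \<theta> < \<theta>' \<and> \<theta>' \<le> 2 * pi \<and>
       \<not> (\<exists>d::real. ((\<lambda>r. real (sector_count \<Lambda> r \<theta> \<theta>') / (pi * r\<^sup>2)) \<longlongrightarrow> d) at_top)}"

definition angular_density :: "complex set \<Rightarrow> real \<Rightarrow> real \<Rightarrow> real" where
  "angular_density \<Lambda> \<theta> \<theta>' = Lim at_top (\<lambda>r. real (sector_count \<Lambda> r \<theta> \<theta>') / (pi * r\<^sup>2))"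

definition density_of :: "complex set \<Rightarrow> real" where
  "density_of \<Lambda> = angular_density \<Lambda> 0 (2 * pi)"

definition regularly_distributed :: "complex set \<Rightarrow> bool" where
  "regularly_distributed \<Lambda> \<longleftrightarrow>
     has_angular_density \<Lambda> \<and>
     (\<exists>L::complex. ((\<lambda>r::real. \<Sum>z\<in>{z \<in> \<Lambda>. 0 < cmod z \<and> cmod z < r}. 1 / z\<^sup>2) \<longlongrightarrow> L) at_top)"

end

theory Submission
  imports Defs "HOL-Probability.Characteristic_Functions" "HOL-Probability.Sinc_Integral"
    "HOL-Complex_Analysis.Complex_Analysis" "HOL-Real_Asymp.Real_Asymp"
begin

text \<open>
  The vectors \<open>gabor g (x, y)\<close> are multiples of the Gaussian kernels \<open>gauss_kernel w\<close> with
  \<open>w = x + i y\<close>, and pairing with these kernels turns \<open>L\<^sup>2(\<real>)\<close> into the Fock space. Hence completeness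
  says that an entire function vanishing on \<open>\<Lambda>\<close> and slightly smaller than \<open>exp (\<pi>|z|\<^sup>2/2)\<close> is zero, and
  minimality yields an entire \<open>f\<close> of growth \<open>exp (\<pi>|z|\<^sup>2/2)\<close> with simple zeros exactly at the
  points of \<open>\<Lambda>\<close> but one. After division by Blaschke products, \<open>log f\<close> is
  analytic in discs, and regular distribution makes its rescaled Taylor coefficients converge. This
  majorizes \<open>log |f|\<close> by \<open>h(\<theta>) r\<^sup>2\<close> up to small errors, where \<open>h\<close> has mean \<open>\<pi>\<Delta>/2\<close>;
  \<open>\<Delta> \<le> 1\<close> is Jensen's formula.

  For the lower bound, call a direction subextremal if \<open>f\<close> decays relative to \<open>exp (\<pi>r\<^sup>2/2)\<close> near it.
  An angular interval longer than \<open>\<pi>/2\<close> cannot be subextremal: the Fock transform of a half-Gaussian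
  is a multiplier that is small outside the interval, and its product with \<open>f\<close> would contradict
  completeness. Around every other direction \<open>\<theta>\<close> Phragmen--Lindelof gives
  \<open>h(\<theta> + u) \<ge> (\<pi>/2) cos 2u\<close> for \<open>|u| \<le> \<pi>/4\<close>. Consecutive such directions are at most
  \<open>\<pi>/2\<close> apart, so the mean of \<open>h\<close> is at least the mean of \<open>(\<pi>/2) cos 2u\<close> over \<open>|u| \<le> \<pi>/4\<close>,
  which is \<open>1\<close>.
\<close>

section \<open>Growth in sectors\<close>

text \<open>The second half of regular distribution enters in a single coefficient. When the radius
  is multiplied by \<open>s\<close>, the rescaled Taylor coefficient of index \<open>k\<close> is
  multiplied by \<open>s powr (k - 2)\<close> up to controlled terms. For
  \<open>k \<noteq> 2\<close> this expansion or contraction forces convergence from the angular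
  densities; for \<open>k = 2\<close> the factor is 1, and the limit of the sums of
  \<open>1 / z^2\<close> has to supply the convergence.

  The limits of the coefficients are only known to be bounded, so the comparison is uniform on
  circles of radius \<open>q R\<close> with \<open>q < 1\<close>, not up to \<open>q = 1\<close>.
  The exponent therefore carries a factor \<open>1 / q^2\<close>, and the lower bound is argued for
  fixed \<open>q\<close> before \<open>q\<close> approaches 1.

  The opening \<open>pi/2\<close> has one source in both halves of the lower bound:
  \<open>exp (pi * w^2 / 2)\<close> is large where \<open>Re (w^2) > 0\<close>, and around the
  positive axis this is the sector \<open>|arg w| < pi/4\<close>. The half-Gaussian multiplier is
  large only there, and the bump \<open>cos (2 * u)\<close> lives on the same range.\<close>

lemma Re_rcis_power: "Re (c * (rcis r t)^n) = r^n * (Re c * cos (n*t) - Im c * sin (n*t))"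
proof -
  have "(rcis r t)^n = rcis (r^n) (n * t)" by (rule DeMoivre2)
  thus ?thesis by (simp add: algebra_simps)
qed

text \<open>The factor \<open>exp (- c z\<^sup>2)\<close> removes the prescribed growth on the two rays, and
  \<open>exp (- \<eta> z\<^sup>3)\<close> makes the function small far out in a sector of opening less than \<open>\<pi>/3\<close>.\<close>

lemma sector_bound_aux:
  fixes f :: "complex \<Rightarrow> complex"
  assumes f: "f holomorphic_on UNIV" and B: "\<And>z. norm (f z) \<le> C * exp (B * (norm z)\<^sup>2)"
    and tau: "0 < \<tau>" "\<tau> < pi/6"
    and rays: "\<And>r. r \<ge> 0 \<Longrightarrow> norm (f (rcis r \<tau>)) \<le> C * exp (Re (c * (rcis r \<tau>)^2))"
        "\<And>r. r \<ge> 0 \<Longrightarrow> norm (f (rcis r (-\<tau>))) \<le> C * exp (Re (c * (rcis r (-\<tau>))^2))"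
    and t: "\<bar>t\<bar> \<le> \<tau>" "r \<ge> 0"
  shows "norm (f (rcis r t)) \<le> C * exp (Re (c * (rcis r t)^2))"
proof -
  \<comment> \<open>With this slope the sector becomes
    \<open>\<bar>Im z\<bar> \<le> k * Re z\<close>, so that its truncation is a triangle given by
    linear inequalities.\<close>
  define k where "k = tan \<tau>"
  have k: "k > 0" unfolding k_def using tau by (intro tan_gt_zero) auto
  have ct: "cos \<tau> > 0" using tau by (intro cos_gt_zero) auto
  have C: "C \<ge> 0" using B[of 0] norm_ge_zero[of "f 0"] by (simp del: norm_ge_zero)
  define \<kappa> where "\<kappa> = cos (3 * \<tau>)"
  have kap: "\<kappa> > 0" unfolding \<kappa>_def using tau by (intro cos_gt_zero) auto
  have sectorE: "\<exists>r t. z = rcis r t \<and> \<bar>t\<bar> \<le> \<tau> \<and> r \<ge> 0" if z: "\<bar>Im z\<bar> \<le> k * Re z" for z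
  proof (cases "z = 0")
    case True then show ?thesis using tau by (intro exI[of _ 0]) auto
  next
    case False
    have "Re z \<ge> 0" using z k by (smt (verit) zero_le_mult_iff)
    moreover have "Re z \<noteq> 0" using False z by (auto simp: complex_eq_iff)
    ultimately have re: "Re z > 0" by simp
    have "\<bar>Arg z\<bar> \<le> \<tau>"
    proof -
      have "Arg z = arctan (Im z / Re z)" using re by (simp add: arg_conv_arctan)
      moreover have "Im z / Re z \<le> k" "- k \<le> Im z / Re z" using z re by (auto simp: field_simps abs_le_iff)
      moreover have "arctan k = \<tau>" unfolding k_def using tau by (intro arctan_tan) auto
      ultimately show ?thesis by (smt (verit) arctan_le_iff arctan_minus)
    qed
    then show ?thesis using rcis_cmod_Arg[of z] norm_ge_zero[of z] by metis
  qed
  have inS: "\<bar>Im (rcis r t)\<bar> \<le> k * Re (rcis r t)" if "\<bar>t\<bar> \<le> \<tau>" "r \<ge> 0" for r t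
  proof -
    have ctt: "cos t > 0" using that tau by (intro cos_gt_zero_pi) auto
    have "tan t \<le> k" "- k \<le> tan t" unfolding k_def using that tau
      by (auto simp flip: tan_minus simp: tan_mono_le_eq)
    hence "sin t \<le> k * cos t" "- (k * cos t) \<le> sin t" using ctt by (auto simp: tan_def field_simps)
    hence "\<bar>sin t\<bar> \<le> k * cos t" by auto
    hence "r * \<bar>sin t\<bar> \<le> r * (k * cos t)" using that by (intro mult_left_mono) auto
    thus ?thesis using that by (simp add: abs_mult mult_ac)
  qed
  define z0 where "z0 = rcis r t"
  have main: "norm (f z0 * exp (- c * z0^2 - of_real \<eta> * z0^3)) \<le> C" if eta: "\<eta> > 0" for \<eta>
  proof -
    define F where "F = (\<lambda>z. f z * exp (- c * z^2 - of_real \<eta> * z^3))"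
    \<comment> \<open>Beyond this abscissa \<open>\<eta> * \<kappa> * r^3\<close> outweighs both
      quadratic exponents, which bounds \<open>F\<close> on the vertical side of the triangle; the
      maximum with \<open>Re z0\<close> keeps \<open>z0\<close> inside.\<close>
    define \<rho> where "\<rho> = max (Re z0) ((\<bar>B\<bar> + norm c) / (\<eta> * \<kappa>))"
    define S where "S = {z. \<bar>Im z\<bar> \<le> k * Re z \<and> Re z \<le> \<rho>}"
    define S' where "S' = {z. \<bar>Im z\<bar> < k * Re z \<and> Re z < \<rho>}"
    have opS: "open S'" unfolding S'_def by (intro open_Collect_conj open_Collect_less continuous_intros)
    have clS: "closed S" unfolding S_def by (intro closed_Collect_conj closed_Collect_le continuous_intros)
    have sub: "S' \<subseteq> interior S" by (intro interior_maximal opS) (auto simp: S_def S'_def)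
    have bnd: "bounded S"
    proof -
      have "norm z \<le> \<rho> + k * \<rho>" if "z \<in> S" for z
      proof -
        have "Re z \<ge> 0" using that k unfolding S_def by (smt (verit) zero_le_mult_iff mem_Collect_eq)
        moreover have "k * Re z \<le> k * \<rho>" using that k unfolding S_def by auto
        ultimately show ?thesis using cmod_le[of z] that unfolding S_def by auto
      qed
      thus ?thesis by (auto simp: bounded_iff)
    qed
    have F: "F holomorphic_on UNIV" unfolding F_def using f by (intro holomorphic_intros) auto
    have normF: "norm (F z) = norm (f z) * exp (- Re (c * z^2) - \<eta> * Re (z^3))" for z
      unfolding F_def by (simp add: norm_mult norm_exp_eq_Re)
    have re3: "Re ((rcis r t)^3) \<ge> \<kappa> * r^3" if "\<bar>t\<bar> \<le> \<tau>" "r \<ge> 0" for r t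
    proof -
      have "cos (3*t) \<ge> \<kappa>"
      proof -
        have "cos (3 * \<bar>t\<bar>) \<ge> cos (3 * \<tau>)" using that tau by (intro cos_monotone_0_pi_le) auto
        thus ?thesis unfolding \<kappa>_def by (cases "t \<ge> 0") auto
      qed
      hence "r^3 * cos (3*t) \<ge> r^3 * \<kappa>" using that by (intro mult_left_mono) auto
      thus ?thesis using Re_rcis_power[of 1 r t 3] by (simp add: mult_ac)
    qed
    have "norm (F z0) \<le> C"
    proof (rule maximum_modulus_frontier[of F S])
      show "F holomorphic_on interior S" using F by (rule holomorphic_on_subset) auto
      show "continuous_on (closure S) F" using F holomorphic_on_imp_continuous_on continuous_on_subset by blast
      show "bounded S" by fact
      show "z0 \<in> S" unfolding S_def z0_def using inS[OF t] by (auto simp: \<rho>_def z0_def)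
      fix z assume "z \<in> frontier S"
      hence z: "z \<in> S" "z \<notin> S'" using clS sub by (auto simp: frontier_def)
      obtain r t where rt: "z = rcis r t" "\<bar>t\<bar> \<le> \<tau>" "r \<ge> 0" using sectorE[of z] z(1) unfolding S_def by blast
      note re3' = re3[OF rt(2,3)]
      have re3nn: "\<eta> * Re (z^3) \<ge> 0" using re3' eta kap rt by (smt (verit) mult_nonneg_nonneg zero_le_power)
      consider "\<bar>t\<bar> = \<tau>" | "\<bar>t\<bar> < \<tau>" using rt(2) by linarith
      thus "norm (F z) \<le> C"
      proof cases
        case 1
        have "norm (f z) \<le> C * exp (Re (c * z^2))" using 1 rays[OF rt(3)] rt(1) by (cases "t \<ge> 0") auto
        hence "norm (F z) \<le> C * exp (Re (c * z^2)) * exp (- Re (c * z^2) - \<eta> * Re (z^3))"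
          unfolding normF by (intro mult_right_mono) auto
        also have "\<dots> = C * exp (- (\<eta> * Re (z^3)))" by (simp add: mult_exp_exp mult.assoc)
        also have "\<dots> \<le> C * 1" using re3nn C by (intro mult_left_mono) auto
        finally show ?thesis by simp
      next
        case 2
        show ?thesis
        proof (cases "r = 0")
          case True
          hence "z = 0" using rt by simp
          thus ?thesis using B[of 0] normF[of 0] by simp
        next
          case False
          hence r: "r > 0" using rt by simp
          have "\<bar>Im z\<bar> < k * Re z"
          proof -
            have ctt: "cos t > 0" using 2 tau by (intro cos_gt_zero_pi) auto
            have "tan t < k" "- k < tan t" unfolding k_def using 2 tau
              by (auto simp flip: tan_minus intro!: tan_monotone)
            hence "sin t < k * cos t" "- (k * cos t) < sin t" using ctt by (auto simp: tan_def field_simps)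
            hence "\<bar>sin t\<bar> < k * cos t" by auto
            hence "r * \<bar>sin t\<bar> < r * (k * cos t)" using r by (intro mult_strict_left_mono) auto
            thus ?thesis using rt r by (simp add: abs_mult mult_ac)
          qed
          hence "Re z = \<rho>" using z unfolding S_def S'_def by auto
          moreover have "Re z \<le> r" using complex_Re_le_cmod[of z] rt by simp
          ultimately have "(\<bar>B\<bar> + norm c) / (\<eta> * \<kappa>) \<le> r" unfolding \<rho>_def by linarith
          hence rr: "\<bar>B\<bar> + norm c \<le> \<eta> * \<kappa> * r" using eta kap by (simp add: field_simps)
          have nz: "norm z = r" using rt by simp
          have "\<bar>Re (c * z^2)\<bar> \<le> norm c * r^2" using abs_Re_le_cmod[of "c*z^2"] nz by (simp add: norm_mult norm_power)
          hence "B * r^2 - Re (c * z^2) - \<eta> * Re (z^3) \<le> \<bar>B\<bar> * r^2 + norm c * r^2 - \<eta> * (\<kappa> * r^3)"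
            using re3' eta rt(1) by (smt (verit) mult_left_mono mult_right_mono zero_le_power2)
          also have "\<dots> = r^2 * (\<bar>B\<bar> + norm c - \<eta> * \<kappa> * r)" by (simp add: algebra_simps power2_eq_square power3_eq_cube)
          also have "\<dots> \<le> 0" using rr by (intro mult_nonneg_nonpos) auto
          finally have e: "B * r^2 - Re (c * z^2) - \<eta> * Re (z^3) \<le> 0" .
          have "norm (F z) \<le> C * exp (B * r^2) * exp (- Re (c * z^2) - \<eta> * Re (z^3))"
            unfolding normF using B[of z] nz by (intro mult_right_mono) auto
          also have "\<dots> = C * exp (B * r^2 - Re (c * z^2) - \<eta> * Re (z^3))" by (simp add: mult_exp_exp mult.assoc)
          also have "\<dots> \<le> C * 1" using e C by (intro mult_left_mono) auto
          finally show ?thesis by simp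
        qed
      qed
    qed
    thus ?thesis by (simp add: F_def)
  qed
  have "((\<lambda>\<eta>. norm (f z0 * exp (- c * z0^2 - of_real \<eta> * z0^3))) \<longlongrightarrow>
          norm (f z0 * exp (- c * z0^2 - of_real 0 * z0^3))) (at_right 0)"
    by (intro tendsto_intros)
  moreover have "eventually (\<lambda>\<eta>. norm (f z0 * exp (- c * z0^2 - of_real \<eta> * z0^3)) \<le> C) (at_right (0::real))"
    using main by (auto simp: eventually_at_filter)
  ultimately have "norm (f z0 * exp (- c * z0^2 - of_real 0 * z0^3)) \<le> C"
    by (intro tendsto_upperbound[of _ _ "at_right (0::real)"]) auto
  hence "norm (f z0) * exp (- Re (c * z0^2)) \<le> C" by (simp add: norm_mult norm_exp_eq_Re del: times_complex.sel)
  hence "norm (f z0) \<le> C * exp (Re (c * z0^2))"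
    by (simp add: exp_minus field_simps del: times_complex.sel)
  thus ?thesis unfolding z0_def .
qed

text \<open>The combination of \<open>cos (2 * \<theta>)\<close> and
  \<open>sin (2 * \<theta>)\<close> with the values \<open>a\<close> at \<open>\<alpha>\<close> and
  \<open>b\<close> at \<open>\<beta>\<close>: the classical majorant for the indicator of a function
  of order 2.\<close>

definition sinusoid :: "real \<Rightarrow> real \<Rightarrow> real \<Rightarrow> real \<Rightarrow> real \<Rightarrow> real" where
  "sinusoid \<alpha> a \<beta> b \<theta> = (a * sin (2 * (\<beta> - \<theta>)) + b * sin (2 * (\<theta> - \<alpha>))) / sin (2 * (\<beta> - \<alpha>))"

text \<open>Phragmen--Lindelof for order 2, reduced to the symmetric case by turning the bisector
  onto the positive axis. The opening is limited by \<open>pi/3\<close> instead of the classical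
  \<open>pi/2\<close> because the auxiliary cubic factor works where
  \<open>cos (3 * \<tau>) > 0\<close>.\<close>

lemma sector_bound:
  fixes f :: "complex \<Rightarrow> complex"
  assumes f: "f holomorphic_on UNIV" and B: "\<And>z. norm (f z) \<le> C * exp (B * (norm z)\<^sup>2)"
    and ab: "\<alpha> < \<beta>" "\<beta> < \<alpha> + pi/3"
    and rays: "\<And>r. r \<ge> 0 \<Longrightarrow> norm (f (rcis r \<alpha>)) \<le> C * exp (a * r\<^sup>2)"
        "\<And>r. r \<ge> 0 \<Longrightarrow> norm (f (rcis r \<beta>)) \<le> C * exp (b * r\<^sup>2)"
    and t: "\<alpha> \<le> \<theta>" "\<theta> \<le> \<beta>" "r \<ge> 0"
  shows "norm (f (rcis r \<theta>)) \<le> C * exp (sinusoid \<alpha> a \<beta> b \<theta> * r\<^sup>2)"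
proof -
  define \<tau> where "\<tau> = (\<beta> - \<alpha>) / 2"
  define \<mu> where "\<mu> = (\<beta> + \<alpha>) / 2"
  have s0: "sin (2 * (\<beta> - \<alpha>)) > 0" using ab by (intro sin_gt_zero) auto
  have al: "\<alpha> = \<mu> + - \<tau>" and be: "\<beta> = \<mu> + \<tau>" by (auto simp: \<mu>_def \<tau>_def field_simps)
  \<comment> \<open>The real and imaginary parts are read off from the sinusoid, expanded about the
    bisector by the addition theorems.\<close>
  define c where "c = Complex ((a + b) * sin (2*\<tau>) / sin (2 * (\<beta> - \<alpha>))) ((a-b) * cos (2*\<tau>) / sin (2 * (\<beta> - \<alpha>)))"
  have re: "Re (c * (rcis r t)^2) = sinusoid \<alpha> a \<beta> b (\<mu> + t) * r^2" for r t
  proof -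
    have "sinusoid \<alpha> a \<beta> b (\<mu> + t) = (a * sin (2*\<tau> - 2*t) + b * sin (2*\<tau> + 2*t)) / sin (2 * (\<beta> - \<alpha>))"
      unfolding sinusoid_def by (simp add: al be algebra_simps)
    also have "\<dots> = Re c * cos (2*t) - Im c * sin (2*t)"
      by (simp add: c_def sin_diff sin_add add_divide_distrib diff_divide_distrib algebra_simps)
    finally show ?thesis using Re_rcis_power[of c r t 2] by (simp add: mult_ac)
  qed
  have mult: "cis \<mu> * rcis r t = rcis r (\<mu> + t)" for r t
    by (simp add: rcis_def cis_mult mult_ac)
  have endp: "sinusoid \<alpha> a \<beta> b \<alpha> = a" "sinusoid \<alpha> a \<beta> b \<beta> = b" using s0 by (auto simp: sinusoid_def)
  have "norm (f (cis \<mu> * rcis r (\<theta> - \<mu>))) \<le> C * exp (Re (c * (rcis r (\<theta> - \<mu>))^2))"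
  proof (rule sector_bound_aux[where f="\<lambda>z. f (cis \<mu> * z)" and B=B and \<tau>=\<tau>])
    show "(\<lambda>z. f (cis \<mu> * z)) holomorphic_on UNIV"
      using holomorphic_on_compose_gen[OF _ f, of "\<lambda>z. cis \<mu> * z" UNIV] by (auto simp: o_def intro!: holomorphic_intros)
    show "norm (f (cis \<mu> * z)) \<le> C * exp (B * (norm z)\<^sup>2)" for z using B[of "cis \<mu> * z"] by (simp add: norm_mult)
    show "0 < \<tau>" "\<tau> < pi/6" using ab by (auto simp: \<tau>_def)
    show "norm (f (cis \<mu> * rcis r \<tau>)) \<le> C * exp (Re (c * (rcis r \<tau>)^2))" if "r \<ge> 0" for r
      using rays(2)[OF that] endp(2) unfolding re mult by (simp only: be[symmetric])
    show "norm (f (cis \<mu> * rcis r (-\<tau>))) \<le> C * exp (Re (c * (rcis r (-\<tau>))^2))" if "r \<ge> 0" for r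
      using rays(1)[OF that] endp(1) unfolding re mult by (simp only: al[symmetric])
    show "\<bar>\<theta> - \<mu>\<bar> \<le> \<tau>" using t al be by auto
  qed fact
  thus ?thesis unfolding re mult by simp
qed

section \<open>Majorants in discs\<close>

lemma entire_divide_zero:
  assumes f: "f holomorphic_on UNIV" and a: "f a = 0"
  obtains h where "h holomorphic_on UNIV" "\<And>z. f z = (z - a) * h z" "h a = deriv f a"
proof -
  define h where "h = (\<lambda>z. if z = a then deriv f a else (f z - f a) / (z - a))"
  have "h holomorphic_on UNIV" unfolding h_def using f by (intro pole_lemma) auto
  thus ?thesis by (rule that) (auto simp: h_def a)
qed

lemma deriv_linear_factor:
  assumes "k holomorphic_on UNIV"
  shows "deriv (\<lambda>z. (z - a) * k z) a = k a"
proof (rule DERIV_imp_deriv)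
  have "(k has_field_derivative deriv k a) (at a)" using assms by (intro holomorphic_derivI[of _ UNIV]) auto
  thus "((\<lambda>z. (z - a) * k z) has_field_derivative k a) (at a)"
    by (auto intro!: derivative_eq_intros)
qed

text \<open>The last clause is what simplicity of the zeros buys: the quotient keeps no zero at a
  removed point, so the modified function in \<open>disc_log_majorant\<close> has none in the whole
  disc.\<close>

lemma entire_divide_simple_zeros:
  assumes "finite T" and f: "f holomorphic_on UNIV" and T: "\<And>a. a \<in> T \<Longrightarrow> f a = 0 \<and> deriv f a \<noteq> 0"
  shows "\<exists>Q. Q holomorphic_on UNIV \<and> (\<forall>z. f z = Q z * (\<Prod>a\<in>T. z - a)) \<and> (\<forall>a\<in>T. Q a \<noteq> 0)"
  using assms(1) T
proof (induction T rule: finite_induct)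
  case empty
  thus ?case using f by auto
next
  case (insert a T)
  then obtain Q where Q: "Q holomorphic_on UNIV" "\<And>z. f z = Q z * (\<Prod>a\<in>T. z - a)" "\<And>a. a \<in> T \<Longrightarrow> Q a \<noteq> 0"
    by auto
  have P: "(\<Prod>b\<in>T. a - b) \<noteq> 0" using insert by auto
  have "Q a = 0" using Q(2)[of a] P insert.prems by auto
  then obtain h where h: "h holomorphic_on UNIV" "\<And>z. Q z = (z - a) * h z" using entire_divide_zero[OF Q(1)] by metis
  have f': "f = (\<lambda>z. (z - a) * (h z * (\<Prod>b\<in>T. z - b)))" by (auto simp: Q(2) h(2))
  have "(\<lambda>z. h z * (\<Prod>b\<in>T. z - b)) holomorphic_on UNIV" using h(1) by (intro holomorphic_intros)
  hence "deriv f a = h a * (\<Prod>b\<in>T. a - b)" unfolding f' by (rule deriv_linear_factor)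
  hence "h a \<noteq> 0" using insert.prems by auto
  moreover have "h b \<noteq> 0" if "b \<in> T" for b using Q(3)[OF that] h(2)[of b] by auto
  ultimately show ?case using h insert by (intro exI[of _ h]) (auto simp: Q(2) mult_ac)
qed

text \<open>At \<open>n = 0\<close> the division by zero yields the coefficient 0, which is the
  right one because \<open>ln 1 = 0\<close>.\<close>

lemma has_fps_expansion_ln_linear: "(\<lambda>z. ln (1 - a * z)) has_fps_expansion Abs_fps (\<lambda>n. - (a^n) / of_nat n :: complex)"
proof (rule has_fps_expansionI)
  have "eventually (\<lambda>z. cmod (a * z) < 1) (nhds 0)"
  proof -
    have "open {z. cmod (a * z) < 1}" by (intro open_Collect_less continuous_intros)
    thus ?thesis using eventually_nhds_in_open[of "{z. cmod (a * z) < 1}" 0] by simp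
  qed
  thus "eventually (\<lambda>z. (\<lambda>n. fps_nth (Abs_fps (\<lambda>n. - (a^n) / of_nat n)) n * z^n) sums ln (1 - a * z)) (nhds 0)"
  proof eventually_elim
    case (elim z)
    have "(\<lambda>n. (-1)^Suc n / of_nat n * (- (a * z))^n) sums ln (1 + (- (a * z)))"
      using elim by (intro Ln_series) auto
    moreover have "(-1)^Suc n / of_nat n * (- (a * z))^n = - (a^n) / of_nat n * z^n" for n
      by (simp add: power_minus[of "a * z"] power_mult_distrib flip: power_add)
    ultimately have "(\<lambda>n. - (a^n) / of_nat n * z^n) sums ln (1 + (- (a * z)))" by (simp only:)
    thus ?case by simp
  qed
qed

lemma circle_reflection:
  assumes "cmod z = R" shows "cmod (of_real (R\<^sup>2) - cnj a * z) = R * cmod (z - a)"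
proof -
  have "of_real (R\<^sup>2) - cnj a * z = z * cnj (z - a)"
    using complex_norm_square[of z] assms by (simp add: algebra_simps)
  thus ?thesis using assms by (simp only: norm_mult complex_mod_cnj)
qed

text \<open>The difference of the squares of the two sides factors. Exchanging a zero for its mirror
  image in the circle thus can only increase the modulus inside, while by
  \<open>circle_reflection\<close> nothing changes on the circle.\<close>

lemma disc_reflection:
  assumes "cmod z \<le> R" "cmod a \<le> R"
  shows "R * cmod (z - a) \<le> cmod (of_real (R\<^sup>2) - cnj a * z)"
proof (rule power2_le_imp_le)
  have "(cmod (of_real (R\<^sup>2) - cnj a * z))\<^sup>2 - (R * cmod (z - a))\<^sup>2 = (R\<^sup>2 - (cmod z)\<^sup>2) * (R\<^sup>2 - (cmod a)\<^sup>2)"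
    unfolding power_mult_distrib cmod_power2 by (simp add: power2_eq_square algebra_simps)
  also have "\<dots> \<ge> 0" using assms by (intro mult_nonneg_nonneg) (auto intro: power_mono)
  finally show "(R * cmod (z - a))\<^sup>2 \<le> (cmod (of_real (R\<^sup>2) - cnj a * z))\<^sup>2" by simp
qed simp

text \<open>Dividing \<open>f\<close> by the Blaschke product of its zeros in the disc of radius \<open>R\<close> gives
  \<open>exp g\<close> with \<open>Re g\<close> the harmonic majorant of \<open>ln |f|\<close> (the Poisson--Jensen formula).\<close>

lemma disc_log_majorant:
  assumes f: "f holomorphic_on UNIV" and Z: "\<And>z. f z = 0 \<longleftrightarrow> z \<in> Z"
    and simple: "\<And>z. z \<in> Z \<Longrightarrow> deriv f z \<noteq> 0" and fin: "\<And>r. finite {z\<in>Z. cmod z < r}" and 0: "0 \<notin> Z"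
  obtains c where "\<And>R B. R > 0 \<Longrightarrow> (\<And>z. cmod z = R \<Longrightarrow> cmod (f z) \<le> exp B) \<Longrightarrow>
    \<exists>g. g holomorphic_on ball 0 R \<and> (\<forall>z\<in>ball 0 R. cmod (f z) \<le> exp (Re (g z)) \<and> Re (g z) \<le> B) \<and>
      Re (g 0) = ln (cmod (f 0)) + (\<Sum>a\<in>{z\<in>Z. cmod z < R}. ln (R / cmod a)) \<and>
      (\<forall>k\<ge>1. (deriv ^^ k) g 0 / fact k = c k + (\<Sum>a\<in>{z\<in>Z. cmod z < R}. 1 / a^k - (cnj a / of_real (R\<^sup>2))^k) / of_nat k)"
proof -
  have f0: "f 0 \<noteq> 0" using Z 0 by auto
  have contf: "continuous_on UNIV f" using f by (rule holomorphic_on_imp_continuous_on)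
  have "open {z. f z \<noteq> 0}" using contf by (intro open_Collect_neq) auto
  then obtain \<delta> where \<delta>: "\<delta> > 0" "\<And>z. z \<in> ball 0 \<delta> \<Longrightarrow> f z \<noteq> 0" using f0
    unfolding open_contains_ball by blast
  obtain \<psi> where \<psi>: "\<psi> holomorphic_on ball 0 \<delta>" "\<And>z. z \<in> ball 0 \<delta> \<Longrightarrow> exp (\<psi> z) = f z"
    by (rule holomorphic_logarithm_exists[of "ball 0 \<delta>" f 0]) (use \<delta> f in \<open>auto intro: holomorphic_on_subset\<close>)
  \<comment> \<open>The logarithm near 0 is chosen before \<open>R\<close>, so one sequence
    \<open>c\<close> serves all radii.\<close>
  define c where "c k = (deriv ^^ k) \<psi> 0 / fact k" for k
  show ?thesis
  proof (rule that[of c])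
    fix R B :: real assume R: "R > 0" and B: "\<And>z. cmod z = R \<Longrightarrow> cmod (f z) \<le> exp B"
    define T where "T = {z\<in>Z. cmod z < R}"
    have T: "finite T" "\<And>a. a \<in> T \<Longrightarrow> a \<noteq> 0" "\<And>a. a \<in> T \<Longrightarrow> cmod a < R" using fin 0 by (auto simp: T_def)
    have Td: "\<delta> \<le> cmod a" if "a \<in> T" for a using \<delta>(2)[of a] that Z by (auto simp: T_def not_less[symmetric])
    obtain Q where Q: "Q holomorphic_on UNIV" "\<And>z. f z = Q z * (\<Prod>a\<in>T. z - a)" "\<And>a. a \<in> T \<Longrightarrow> Q a \<noteq> 0"
      using entire_divide_simple_zeros[OF T(1) f] Z simple unfolding T_def by auto
    \<comment> \<open>Every zero in the disc is exchanged for its mirror image, scaled so that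
      \<open>G\<close> and \<open>f\<close> have the same modulus on the circle.\<close>
    define G where "G z = Q z * (\<Prod>a\<in>T. (of_real (R\<^sup>2) - cnj a * z) / of_real R)" for z
    have G: "G holomorphic_on UNIV" unfolding G_def using Q(1) R by (intro holomorphic_intros) auto
    have fac: "of_real (R\<^sup>2) - cnj a * z \<noteq> 0" if "a \<in> T" "cmod z \<le> R" for a z
    proof
      assume "of_real (R\<^sup>2) - cnj a * z = 0"
      hence "cmod (cnj a * z) = cmod (of_real (R\<^sup>2))" by simp
      hence "cmod (cnj a * z) = R\<^sup>2" unfolding norm_of_real by simp
      moreover have "cmod a * cmod z < R * R"
      proof (cases "z = 0")
        case False
        hence "cmod a * cmod z < R * cmod z" using T(3)[OF that(1)] by (intro mult_strict_right_mono) auto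
        also have "\<dots> \<le> R * R" using that R by (intro mult_left_mono) auto
        finally show ?thesis .
      qed (use R in auto)
      ultimately show False by (simp add: norm_mult power2_eq_square)
    qed
    have Gnz: "G z \<noteq> 0" if z: "z \<in> ball 0 R" for z
    proof -
      have "Q z \<noteq> 0"
      proof
        assume "Q z = 0"
        hence "z \<in> Z" using Q(2)[of z] Z by auto
        hence "z \<in> T" using z by (simp add: T_def)
        thus False using Q(3) \<open>Q z = 0\<close> by auto
      qed
      thus ?thesis unfolding G_def using T(1) R z fac by auto
    qed
    obtain g where g: "g holomorphic_on ball 0 R" "\<And>z. z \<in> ball 0 R \<Longrightarrow> exp (g z) = G z"
      by (rule holomorphic_logarithm_exists[of "ball 0 R" G 0]) (use R G Gnz in \<open>auto intro: holomorphic_on_subset\<close>)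
    have Reg: "exp (Re (g z)) = cmod (G z)" if "z \<in> ball 0 R" for z using g(2)[OF that] norm_exp_eq_Re[of "g z"] by simp
    have fG: "cmod (f z) \<le> cmod (G z)" if "cmod z \<le> R" for z
    proof -
      have "(\<Prod>a\<in>T. cmod (z - a)) \<le> (\<Prod>a\<in>T. cmod ((of_real (R\<^sup>2) - cnj a * z) / of_real R))"
      proof (intro prod_mono conjI norm_ge_zero)
        fix a assume "a \<in> T"
        thus "cmod (z - a) \<le> cmod ((of_real (R\<^sup>2) - cnj a * z) / of_real R)"
          using disc_reflection[OF that, of a] T(3)[of a] R by (simp only: norm_divide norm_of_real) (simp add: field_simps)
      qed
      thus ?thesis unfolding Q(2) G_def norm_mult prod_norm[symmetric] by (intro mult_left_mono) auto
    qed
    have fGR: "cmod (f z) = cmod (G z)" if "cmod z = R" for z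
    proof -
      have "cmod (z - a) = cmod ((of_real (R\<^sup>2) - cnj a * z) / of_real R)" for a
        unfolding norm_divide circle_reflection[OF that] using R by simp
      thus ?thesis unfolding Q(2) G_def norm_mult prod_norm[symmetric] by simp
    qed
    have GB: "cmod (G z) \<le> exp B" if "z \<in> ball 0 R" for z
    proof (rule maximum_modulus_frontier[of G "ball 0 R"])
      show "G holomorphic_on interior (ball 0 R)" using G by (rule holomorphic_on_subset) auto
      show "continuous_on (closure (ball 0 R)) G" using G holomorphic_on_imp_continuous_on continuous_on_subset by blast
      show "cmod (G w) \<le> exp B" if "w \<in> frontier (ball 0 R)" for w
        using that R B[of w] fGR[of w] by (simp add: dist_norm)
    qed (use that in auto)
    have g0: "Re (g 0) = ln (cmod (f 0)) + (\<Sum>a\<in>T. ln (R / cmod a))"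
    proof -
      have Q0: "Q 0 \<noteq> 0" using Q(2)[of 0] f0 by auto
      have "G 0 = Q 0 * (\<Prod>a\<in>T. of_real R)" unfolding G_def using R by (simp add: power2_eq_square)
      hence 1: "cmod (G 0) = cmod (Q 0) * (\<Prod>a\<in>T. R)" using R by (simp add: norm_mult norm_power)
      have 2: "cmod (f 0) = cmod (Q 0) * (\<Prod>a\<in>T. cmod a)" unfolding Q(2) by (simp add: norm_mult prod_norm[symmetric])
      have "Re (g 0) = ln (cmod (G 0))" using Reg[of 0, symmetric] R by simp
      also have "\<dots> = ln (cmod (Q 0)) + (\<Sum>a\<in>T. ln R)" unfolding 1 using Q0 R T(1) by (simp add: ln_mult ln_realpow)
      also have "(\<Sum>a\<in>T. ln R) = (\<Sum>a\<in>T. ln (R / cmod a)) + (\<Sum>a\<in>T. ln (cmod a))"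
        unfolding sum.distrib[symmetric] using R T(2) by (intro sum.cong refl) (simp add: ln_div)
      also have "ln (cmod (Q 0)) + (\<dots>) = ln (cmod (f 0)) + (\<Sum>a\<in>T. ln (R / cmod a))"
      proof -
        have "(\<Prod>a\<in>T. cmod a) > 0" using T(2) by (intro prod_pos) auto
        moreover have "ln (\<Prod>a\<in>T. cmod a) = (\<Sum>a\<in>T. ln (cmod a))" using T by (intro ln_prod) auto
        ultimately show ?thesis unfolding 2 using Q0 by (simp add: ln_mult)
      qed
      finally show ?thesis .
    qed
    have coeff: "(deriv ^^ k) g 0 / fact k = c k + (\<Sum>a\<in>T. 1 / a^k - (cnj a / of_real (R\<^sup>2))^k) / of_nat k" if k: "k \<ge> 1" for k
    proof -
      define \<rho> where "\<rho> = min \<delta> R"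
      have \<rho>: "\<rho> > 0" "\<rho> \<le> \<delta>" "\<rho> \<le> R" using \<delta> R by (auto simp: \<rho>_def)
      \<comment> \<open>Logarithms of the Blaschke quotients, up to constants: the second summand
        produces the terms \<open>1 / a^k\<close>, the first the terms with
        \<open>cnj a\<close>.\<close>
      define L where "L z = (\<Sum>a\<in>T. ln (1 - (cnj a / of_real (R\<^sup>2)) * z) - ln (1 - (1 / a) * z))" for z
      have small: "cmod ((cnj a / of_real (R\<^sup>2)) * z) < 1" "cmod ((1 / a) * z) < 1" if "a \<in> T" "z \<in> ball 0 \<rho>" for a z
      proof -
        have z: "cmod z < \<delta>" "cmod z < R" using that(2) \<rho> by auto
        have "cmod a * cmod z < R * R" using T(3)[OF that(1)] z(2) R by (intro mult_strict_mono) auto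
        thus "cmod ((cnj a / of_real (R\<^sup>2)) * z) < 1" using R by (simp add: norm_mult norm_divide norm_power power2_eq_square field_simps)
        show "cmod ((1 / a) * z) < 1" using Td[OF that(1)] z T(2)[OF that(1)] by (simp add: norm_mult norm_divide field_simps)
      qed
      have nonneg: "1 - w \<notin> \<real>\<^sub>\<le>\<^sub>0" "1 - w \<noteq> 0" if "cmod w < 1" for w
      proof -
        have "Re w < 1" using complex_Re_le_cmod[of w] that by linarith
        thus "1 - w \<notin> \<real>\<^sub>\<le>\<^sub>0" "1 - w \<noteq> 0" by (auto simp: complex_nonpos_Reals_iff complex_eq_iff)
      qed
      have Lhol: "L holomorphic_on ball 0 \<rho>" unfolding L_def
        by (intro holomorphic_intros) (use small nonneg in auto)
      \<comment> \<open>Its exponential turns out to be constant, so \<open>K\<close> is constant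
        near 0 and affects the coefficient of index 0 only; that one is computed separately as
        \<open>g0\<close>.\<close>
      define K where "K z = g z - \<psi> z - L z" for z
      have Khol: "K holomorphic_on ball 0 \<rho>" unfolding K_def using g(1) \<psi>(1) Lhol \<rho>
        by (intro holomorphic_intros) (auto intro: holomorphic_on_subset)
      have expK: "exp (K z) = (\<Prod>a\<in>T. - of_real R / a)" if z: "z \<in> ball 0 \<rho>" for z
      proof -
        have zz: "z \<in> ball 0 \<delta>" "z \<in> ball 0 R" using z \<rho> by auto
        have fz: "f z \<noteq> 0" using \<delta> zz by auto
        have Qz: "Q z \<noteq> 0" "\<And>a. a \<in> T \<Longrightarrow> z - a \<noteq> 0" using fz Q(2)[of z] T(1) by auto
        have "exp (L z) = (\<Prod>a\<in>T. (1 - (cnj a / of_real (R\<^sup>2)) * z) / (1 - (1 / a) * z))"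
          unfolding L_def exp_sum[OF T(1)]
        proof (intro prod.cong refl)
          fix a assume a: "a \<in> T"
          show "exp (ln (1 - (cnj a / of_real (R\<^sup>2)) * z) - ln (1 - (1 / a) * z)) = (1 - (cnj a / of_real (R\<^sup>2)) * z) / (1 - (1 / a) * z)"
            using nonneg(2)[OF small(1)[OF a z]] nonneg(2)[OF small(2)[OF a z]] by (simp only: exp_diff exp_Ln not_False_eq_True)
        qed
        hence "exp (K z) = G z / f z / (\<Prod>a\<in>T. (1 - (cnj a / of_real (R\<^sup>2)) * z) / (1 - (1 / a) * z))"
          unfolding K_def exp_diff using g(2) \<psi>(2) zz by simp
        also have "\<dots> = (\<Prod>a\<in>T. ((of_real (R\<^sup>2) - cnj a * z) / of_real R) / (z - a) / ((1 - (cnj a / of_real (R\<^sup>2)) * z) / (1 - (1 / a) * z)))"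
          unfolding G_def Q(2) prod_dividef using Qz by simp
        also have "\<dots> = (\<Prod>a\<in>T. - of_real R / a)"
        proof (intro prod.cong refl)
          fix a assume a: "a \<in> T"
          have 1: "1 - (cnj a / of_real (R\<^sup>2)) * z = (of_real (R\<^sup>2) - cnj a * z) / of_real (R\<^sup>2)" using R by (simp add: field_simps)
          have 2: "1 - (1 / a) * z = - (z - a) / a" using T(2)[OF a] by (simp add: field_simps)
          have 3: "of_real (R\<^sup>2) - cnj a * z \<noteq> 0" using fac[OF a, of z] zz by auto
          have gen: "(u / r) / v / ((u / (r^2)) / (- v / a)) = - r / a" if "u \<noteq> 0" "v \<noteq> 0" "a \<noteq> 0" "r \<noteq> 0" for u v r :: complex
            using that by (simp add: field_simps power2_eq_square)
          show "((of_real (R\<^sup>2) - cnj a * z) / of_real R) / (z - a) / ((1 - (cnj a / of_real (R\<^sup>2)) * z) / (1 - (1 / a) * z)) = - of_real R / a"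
            unfolding 1 2 using gen[OF 3 Qz(2)[OF a] T(2)[OF a], of "of_real R"] R by simp
        qed
        finally show ?thesis .
      qed
      have "\<exists>k. \<forall>z\<in>ball 0 \<rho>. K z = k"
      proof (rule has_field_derivative_zero_constant)
        fix w :: complex assume w: "w \<in> ball 0 \<rho>"
        have dK: "(K has_field_derivative deriv K w) (at w)" using Khol w by (intro holomorphic_derivI) auto
        hence "((\<lambda>z. exp (K z)) has_field_derivative exp (K w) * deriv K w) (at w)" by (auto intro!: derivative_eq_intros)
        moreover have "((\<lambda>z. exp (K z)) has_field_derivative 0) (at w)"
        proof (rule DERIV_cong_ev[OF refl _ refl, THEN iffD2])
          show "eventually (\<lambda>z. exp (K z) = (\<Prod>a\<in>T. - of_real R / a)) (nhds w)"
            using eventually_nhds_in_open[OF open_ball w] by eventually_elim (rule expK)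
        qed auto
        ultimately have "exp (K w) * deriv K w = 0" using DERIV_unique by blast
        hence "deriv K w = 0" by simp
        thus "(K has_field_derivative 0) (at w within ball 0 \<rho>)" using dK has_field_derivative_at_within by metis
      qed auto
      hence Kc: "K z = K 0" if z: "z \<in> ball 0 \<rho>" for z using z \<rho>(1) by (metis centre_in_ball)
      have geq: "g z = \<psi> z + L z + K 0" if "z \<in> ball 0 \<rho>" for z
      proof -
        have "K z = g z - \<psi> z - L z" by (simp add: K_def)
        thus ?thesis using Kc[OF that] by (simp add: algebra_simps)
      qed
      have psiexp: "\<psi> has_fps_expansion fps_expansion \<psi> 0"
        using \<psi>(1) \<rho> \<delta> by (intro has_fps_expansion_fps_expansion[of "ball 0 \<delta>"]) auto
      have "(\<lambda>z. \<psi> z + L z + K 0) has_fps_expansion (fps_expansion \<psi> 0 +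
        (\<Sum>a\<in>T. Abs_fps (\<lambda>n. - ((cnj a / of_real (R\<^sup>2))^n) / of_nat n) - Abs_fps (\<lambda>n. - ((1/a)^n) / of_nat n)) + fps_const (K 0))"
        unfolding L_def by (intro has_fps_expansion_add has_fps_expansion_sum has_fps_expansion_diff has_fps_expansion_ln_linear psiexp has_fps_expansion_const)
      hence "g has_fps_expansion (fps_expansion \<psi> 0 +
        (\<Sum>a\<in>T. Abs_fps (\<lambda>n. - ((cnj a / of_real (R\<^sup>2))^n) / of_nat n) - Abs_fps (\<lambda>n. - ((1/a)^n) / of_nat n)) + fps_const (K 0))"
        by (subst has_fps_expansion_cong[OF _ refl]) (use eventually_nhds_in_open[of "ball 0 \<rho>" "0::complex"] \<rho> geq in \<open>auto elim!: eventually_mono\<close>)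
      moreover have "g has_fps_expansion fps_expansion g 0"
        using g(1) R by (intro has_fps_expansion_fps_expansion[of "ball 0 R"]) auto
      ultimately have "fps_expansion g 0 = (fps_expansion \<psi> 0 +
        (\<Sum>a\<in>T. Abs_fps (\<lambda>n. - ((cnj a / of_real (R\<^sup>2))^n) / of_nat n) - Abs_fps (\<lambda>n. - ((1/a)^n) / of_nat n)) + fps_const (K 0))"
        using fps_expansion_unique_complex by blast
      hence "fps_nth (fps_expansion g 0) k = fps_nth (fps_expansion \<psi> 0 +
        (\<Sum>a\<in>T. Abs_fps (\<lambda>n. - ((cnj a / of_real (R\<^sup>2))^n) / of_nat n) - Abs_fps (\<lambda>n. - ((1/a)^n) / of_nat n)) + fps_const (K 0)) k"
        by (rule arg_cong)
      hence "(deriv ^^ k) g 0 / fact k = c k + (\<Sum>a\<in>T. - ((cnj a / of_real (R\<^sup>2))^k) / of_nat k - - ((1/a)^k) / of_nat k)"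
        using k unfolding fps_expansion_def c_def by (simp add: fps_sum_nth)
      also have "(\<Sum>a\<in>T. - ((cnj a / of_real (R\<^sup>2))^k) / of_nat k - - ((1/a)^k) / of_nat k) = (\<Sum>a\<in>T. 1 / a^k - (cnj a / of_real (R\<^sup>2))^k) / of_nat k"
        unfolding sum_divide_distrib by (intro sum.cong refl) (simp add: diff_divide_distrib power_one_over)
      finally show ?thesis .
    qed
    show "\<exists>g. g holomorphic_on ball 0 R \<and> (\<forall>z\<in>ball 0 R. cmod (f z) \<le> exp (Re (g z)) \<and> Re (g z) \<le> B) \<and>
      Re (g 0) = ln (cmod (f 0)) + (\<Sum>a\<in>{z\<in>Z. cmod z < R}. ln (R / cmod a)) \<and>
      (\<forall>k\<ge>1. (deriv ^^ k) g 0 / fact k = c k + (\<Sum>a\<in>{z\<in>Z. cmod z < R}. 1 / a^k - (cnj a / of_real (R\<^sup>2))^k) / of_nat k)"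
    proof (intro exI[of _ g] conjI ballI allI impI)
      fix z :: complex assume z: "z \<in> ball 0 R"
      show "cmod (f z) \<le> exp (Re (g z))" using Reg[OF z] fG[of z] z by simp
      have "exp (Re (g z)) \<le> exp B" using Reg[OF z] GB[OF z] by simp
      thus "Re (g z) \<le> B" by simp
    qed (use g(1) g0 coeff in \<open>auto simp: T_def\<close>)
  qed
qed

text \<open>Adding to the Cauchy integral for \<open>g\<^sub>n\<close> the conjugate of the vanishing integral of \<open>g(u) u\<^sup>n\<close>
  leaves only \<open>Re g\<close> in the integrand.\<close>

lemma taylor_coeff_bound_Re:
  assumes g: "g holomorphic_on ball 0 R" and B: "\<And>z. z \<in> ball 0 R \<Longrightarrow> Re (g z) \<le> B"
    and R: "R > 0" and n: "n \<ge> 1"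
  shows "cmod ((deriv ^^ n) g 0 / fact n) * R^n \<le> 2 * (B - Re (g 0))"
proof -
  define \<gamma> where "\<gamma> = (deriv ^^ n) g 0 / fact n"
  have bound: "cmod \<gamma> * r^n \<le> 2 * (B - Re (g 0))" if r: "r > 0" "r < R" for r
  proof -
    define u where "u t = of_real r * exp (2 * of_real pi * \<i> * of_real t)" for t :: real
    have u0: "u t \<noteq> 0" "cmod (u t) = r" for t using r by (auto simp: u_def norm_mult)
    have cnju: "cnj (u t) = of_real (r\<^sup>2) / u t" for t
    proof -
      have "u t * cnj (u t) = of_real (r\<^sup>2)" using u0(2)[of t] by (simp add: complex_norm_square[symmetric])
      thus ?thesis using u0(1)[of t] by (simp add: field_simps)
    qed
    have param: "((\<lambda>t. h (u t) * u t) has_integral (I / (2 * of_real pi * \<i>))) {0..1}"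
      if "(h has_contour_integral I) (circlepath 0 r)" for h I
    proof -
      have A: "((\<lambda>t. h (circlepath 0 r t) * vector_derivative (circlepath 0 r) (at t within {0..1})) has_integral I) {0..1}"
        using that unfolding has_contour_integral_def .
      have E: "h (circlepath 0 r t) * vector_derivative (circlepath 0 r) (at t within {0..1}) = h (u t) * (2 * of_real pi * \<i> * u t)"
        if "t \<in> {0..1}" for t
      proof -
        have "circlepath 0 r t = u t" by (simp add: circlepath u_def)
        moreover have "vector_derivative (circlepath 0 r) (at t within {0..1}) = 2 * of_real pi * \<i> * u t"
          using vector_derivative_circlepath01[of t 0 r] that by (simp add: u_def)
        ultimately show ?thesis by simp
      qed
      have "((\<lambda>t. h (u t) * (2 * of_real pi * \<i> * u t)) has_integral I) {0..1}"
        by (rule has_integral_eq[OF E A])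
      hence "((\<lambda>t. (1 / (2 * of_real pi * \<i>)) * (h (u t) * (2 * of_real pi * \<i> * u t))) has_integral (1 / (2 * of_real pi * \<i>)) * I) {0..1}"
        by (rule has_integral_mult_right)
      moreover have "(1 / c) * (x * (c * y)) = x * y" "(1 / c) * y = y / c" if "c \<noteq> 0" for c x y :: complex using that by auto
      moreover have "2 * of_real pi * \<i> \<noteq> (0::complex)" by simp
      ultimately show ?thesis by (simp only: not_False_eq_True)
    qed
    have cball: "cball 0 r \<subseteq> ball (0::complex) R" using r by auto
    have cauchy: "((\<lambda>t. h (u t) / (u t)^k) has_integral ((deriv ^^ k) h 0 / fact k)) {0..1}" if h: "h holomorphic_on ball 0 R" for h k
    proof -
      have "((\<lambda>w. h w / (w - 0)^(Suc k)) has_contour_integral ((2 * pi * \<i>) / fact k * (deriv ^^ k) h 0)) (circlepath 0 r)"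
        by (rule Cauchy_has_contour_integral_higher_derivative_circlepath)
          (use h r cball in \<open>auto intro: holomorphic_on_subset holomorphic_on_imp_continuous_on continuous_on_subset\<close>)
      from param[OF this] show ?thesis using u0(1) by simp
    qed
    have 1: "((\<lambda>t. g (u t) / (u t)^n) has_integral \<gamma>) {0..1}" using cauchy[OF g] unfolding \<gamma>_def .
    have 0: "((\<lambda>t. g (u t)) has_integral g 0) {0..1}" using cauchy[OF g, of 0] by simp
    have "((\<lambda>w. g w * w^(n-1)) has_contour_integral 0) (circlepath 0 r)"
      by (rule Cauchy_theorem_disc_simple[of _ 0 R]) (use g r in \<open>auto intro!: holomorphic_intros\<close>)
    from param[OF this] have "((\<lambda>t. g (u t) * (u t)^n) has_integral 0) {0..1}"
      using n by (cases n) (auto simp: mult_ac)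
    hence "((\<lambda>t. cnj (g (u t) * (u t)^n)) has_integral cnj 0) {0..1}"
      using has_integral_linear[OF _ bounded_linear_cnj] unfolding o_def by blast
    hence "((\<lambda>t. (1 / of_real (r\<^sup>2))^n * cnj (g (u t) * (u t)^n)) has_integral (1 / of_real (r\<^sup>2))^n * cnj 0) {0..1}"
      by (rule has_integral_mult_right)
    moreover have "(1 / of_real (r\<^sup>2))^n * cnj (g (u t) * (u t)^n) = cnj (g (u t)) / (u t)^n" for t
      using u0(1)[of t] r by (simp add: cnju power_divide)
    ultimately have 2: "((\<lambda>t. cnj (g (u t)) / (u t)^n) has_integral 0) {0..1}" by simp
    have "((\<lambda>t. 1 / (u t)^n) has_integral ((deriv ^^ n) (\<lambda>_. 1) 0 / fact n)) {0..1}" by (rule cauchy) simp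
    moreover have "(deriv ^^ n) (\<lambda>_. 1::complex) 0 = 0" using n by (simp add: higher_deriv_const)
    ultimately have 3: "((\<lambda>t. 1 / (u t)^n) has_integral 0) {0..1}" by simp
    \<comment> \<open>A constant integrates to 0 against \<open>1 / (u t)^n\<close>, so
      \<open>2 * B\<close> can be subtracted. The integrand then contains \<open>Re g - B\<close>,
      which has constant sign, and a one-sided bound on \<open>Re g\<close> suffices.\<close>
    have "((\<lambda>t. g (u t) / (u t)^n + cnj (g (u t)) / (u t)^n - (2 * of_real B) * (1 / (u t)^n)) has_integral (\<gamma> + 0 - (2 * of_real B) * 0)) {0..1}"
      by (intro has_integral_diff has_integral_add has_integral_mult_right 1 2 3)
    moreover have "g (u t) / (u t)^n + cnj (g (u t)) / (u t)^n - (2 * of_real B) * (1 / (u t)^n) = of_real (2 * (Re (g (u t)) - B)) / (u t)^n" for t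
      using complex_add_cnj[of "g (u t)"] by (simp add: add_divide_distrib[symmetric] diff_divide_distrib[symmetric] algebra_simps)
    ultimately have int: "((\<lambda>t. of_real (2 * (Re (g (u t)) - B)) / (u t)^n) has_integral \<gamma>) {0..1}" by simp
    have "((\<lambda>t. Re (g (u t))) has_integral Re (g 0)) {0..1}"
      using has_integral_linear[OF 0 bounded_linear_Re] unfolding o_def .
    hence "((\<lambda>t. (2 / r^n) * (B - Re (g (u t)))) has_integral (2 / r^n) * (B - Re (g 0))) {0..1}"
      by (intro has_integral_mult_right has_integral_diff) (use has_integral_const_real[of B 0 1] in auto)
    note maj = this
    have "cmod (integral {0..1} (\<lambda>t. of_real (2 * (Re (g (u t)) - B)) / (u t)^n)) \<le> integral {0..1} (\<lambda>t. (2 / r^n) * (B - Re (g (u t))))"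
    proof (rule integral_norm_bound_integral)
      fix t :: real
      have "Re (g (u t)) \<le> B" using u0(2)[of t] r by (intro B) auto
      thus "cmod (of_real (2 * (Re (g (u t)) - B)) / (u t)^n) \<le> (2 / r^n) * (B - Re (g (u t)))"
        unfolding norm_divide norm_power u0(2) norm_of_real by simp
    qed (use int maj in auto)
    hence "cmod \<gamma> \<le> (2 / r^n) * (B - Re (g 0))" unfolding integral_unique[OF int] integral_unique[OF maj] .
    thus ?thesis using r by (simp add: field_simps)
  qed
  have "((\<lambda>r. cmod \<gamma> * r^n) \<longlongrightarrow> cmod \<gamma> * R^n) (at_left R)" by (intro tendsto_intros)
  moreover have "eventually (\<lambda>r. cmod \<gamma> * r^n \<le> 2 * (B - Re (g 0))) (at_left R)"
    using eventually_at_left_real[OF R] by eventually_elim (use bound in auto)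
  ultimately have "cmod \<gamma> * R^n \<le> 2 * (B - Re (g 0))" by (intro tendsto_upperbound[of _ _ "at_left R"]) auto
  thus ?thesis unfolding \<gamma>_def .
qed

section \<open>Gaussian kernels and uniqueness\<close>

lemma L2_seminorm_nonneg: "L2_seminorm f \<ge> 0"
  unfolding L2_seminorm_def by simp

lemma L2_seminorm_sq: "(L2_seminorm f)\<^sup>2 = integral\<^sup>L lborel (\<lambda>t. (cmod (f t))\<^sup>2)"
  unfolding L2_seminorm_def by (simp add: integral_nonneg_AE)

lemma L2_space_scale: "f \<in> L2_space \<Longrightarrow> (\<lambda>t. c * f t) \<in> L2_space"
  by (auto simp: L2_space_def norm_mult power_mult_distrib)

lemma L2_seminorm_scale: "L2_seminorm (\<lambda>t. c * f t) = cmod c * L2_seminorm f"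
  unfolding L2_seminorm_def by (simp add: norm_mult power_mult_distrib real_sqrt_mult)

lemma norm_add_sq_le:
  fixes a b :: complex
  assumes "s > 0"
  shows "(cmod (a + b))\<^sup>2 \<le> (1 + s) * (cmod a)\<^sup>2 + (1 + 1/s) * (cmod b)\<^sup>2"
proof -
  have "(cmod (a + b))\<^sup>2 \<le> (cmod a + cmod b)\<^sup>2" by (intro power_mono norm_triangle_ineq) auto
  also have "\<dots> \<le> (1 + s) * (cmod a)\<^sup>2 + (1 + 1/s) * (cmod b)\<^sup>2"
  proof -
    have "0 \<le> (s * cmod a - cmod b)\<^sup>2 / s" using assms by simp
    also have "\<dots> = s * (cmod a)\<^sup>2 - 2 * cmod a * cmod b + (cmod b)\<^sup>2 / s"
      using assms by (simp add: power2_eq_square field_simps)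
    finally show ?thesis by (simp add: power2_eq_square algebra_simps)
  qed
  finally show ?thesis .
qed

lemma L2_space_add:
  assumes "f \<in> L2_space" "h \<in> L2_space" shows "(\<lambda>t. f t + h t) \<in> L2_space"
proof -
  have "integrable lborel (\<lambda>t. (cmod (f t + h t))\<^sup>2)"
  proof (rule Bochner_Integration.integrable_bound)
    show "integrable lborel (\<lambda>t. 2 * (cmod (f t))\<^sup>2 + 2 * (cmod (h t))\<^sup>2)"
      using assms by (auto simp: L2_space_def)
    show "AE t in lborel. norm ((cmod (f t + h t))\<^sup>2) \<le> norm (2 * (cmod (f t))\<^sup>2 + 2 * (cmod (h t))\<^sup>2)"
      using norm_add_sq_le[of 1] by (auto intro!: AE_I2 order_trans[OF norm_add_sq_le[of 1]])
  qed (use assms in \<open>auto simp: L2_space_def\<close>)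
  thus ?thesis using assms by (auto simp: L2_space_def)
qed

lemma L2_space_diff: "f \<in> L2_space \<Longrightarrow> h \<in> L2_space \<Longrightarrow> (\<lambda>t. f t - h t) \<in> L2_space"
  using L2_space_add[of f "\<lambda>t. (-1) * h t"] L2_space_scale[of h "-1"] by simp

text \<open>The weighted inequality \<open>norm_add_sq_le\<close> becomes sharp when the weight is
  the quotient of the two seminorms. Adding \<open>e\<close> to both keeps that quotient positive
  and defined even if a seminorm vanishes.\<close>

lemma L2_seminorm_triangle:
  assumes "f \<in> L2_space" "h \<in> L2_space"
  shows "L2_seminorm (\<lambda>t. f t + h t) \<le> L2_seminorm f + L2_seminorm h"
proof -
  have le: "(L2_seminorm (\<lambda>t. f t + h t))\<^sup>2 \<le> (1 + s) * (L2_seminorm f)\<^sup>2 + (1 + 1/s) * (L2_seminorm h)\<^sup>2" if "s > 0" for s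
  proof -
    have "(L2_seminorm (\<lambda>t. f t + h t))\<^sup>2 \<le> integral\<^sup>L lborel (\<lambda>t. (1 + s) * (cmod (f t))\<^sup>2 + (1 + 1/s) * (cmod (h t))\<^sup>2)"
      unfolding L2_seminorm_sq using assms L2_space_add[OF assms] norm_add_sq_le[OF that]
      by (intro integral_mono) (auto simp: L2_space_def)
    also have "\<dots> = (1 + s) * (L2_seminorm f)\<^sup>2 + (1 + 1/s) * (L2_seminorm h)\<^sup>2"
      unfolding L2_seminorm_sq using assms by (subst Bochner_Integration.integral_add) (auto simp: L2_space_def)
    finally show ?thesis .
  qed
  have *: "L2_seminorm (\<lambda>t. f t + h t) \<le> (L2_seminorm f + e) + (L2_seminorm h + e)" if "e > 0" for e
  proof (rule power2_le_imp_le)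
    define a b where "a = L2_seminorm f" "b = L2_seminorm h"
    have ab: "a \<ge> 0" "b \<ge> 0" unfolding a_b_def by (auto simp: L2_seminorm_nonneg)
    have s: "(b + e) / (a + e) > 0" using ab that by (auto simp: field_simps add_nonneg_pos)
    have "(L2_seminorm (\<lambda>t. f t + h t))\<^sup>2 \<le> (1 + (b+e)/(a+e)) * a\<^sup>2 + (1 + 1/((b+e)/(a+e))) * b\<^sup>2"
      using le[OF s] unfolding a_b_def .
    also have "\<dots> \<le> (1 + (b+e)/(a+e)) * (a+e)\<^sup>2 + (1 + 1/((b+e)/(a+e))) * (b+e)\<^sup>2"
      using ab that s by (intro add_mono mult_left_mono power_mono) auto
    also have "\<dots> = ((a+e)+(b+e))\<^sup>2"
    proof -
      have "a + e \<noteq> 0" "b + e \<noteq> 0" using ab that by auto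
      thus ?thesis by (simp add: power2_eq_square divide_simps) (simp add: algebra_simps)
    qed
    finally show "(L2_seminorm (\<lambda>t. f t + h t))\<^sup>2 \<le> ((L2_seminorm f + e) + (L2_seminorm h + e))\<^sup>2"
      unfolding a_b_def .
    show "0 \<le> L2_seminorm f + e + (L2_seminorm h + e)" using ab that unfolding a_b_def by auto
  qed
  hence "L2_seminorm (\<lambda>t. f t + h t) \<le> L2_seminorm f + L2_seminorm h + e" if "e > 0" for e
    using *[of "e/2"] that by simp
  thus ?thesis by (rule field_le_epsilon)
qed

lemma L2_seminorm_triangle_diff:
  assumes "f \<in> L2_space" "h \<in> L2_space"
  shows "L2_seminorm (\<lambda>t. f t - h t) \<le> L2_seminorm f + L2_seminorm h"
  using L2_seminorm_triangle[of f "\<lambda>t. (-1) * h t"] L2_seminorm_scale[of "-1" h] L2_space_scale[of h "-1"] assms by simp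

lemma L2_seminorm_diff_trans:
  assumes "f \<in> L2_space" "h \<in> L2_space" "k \<in> L2_space"
  shows "L2_seminorm (\<lambda>t. f t - k t) \<le> L2_seminorm (\<lambda>t. f t - h t) + L2_seminorm (\<lambda>t. h t - k t)"
  using L2_seminorm_triangle[of "\<lambda>t. f t - h t" "\<lambda>t. h t - k t"] assms by (simp add: L2_space_diff)

text \<open>The Bargmann kernel without its factor \<open>exp (- pi * w^2 / 2)\<close>. It differs
  from the time-frequency shift of the Gaussian by a nonzero scalar depending on the point alone,
  which leaves all spans unchanged and makes the dependence on \<open>w\<close> holomorphic.\<close>

definition gauss_kernel :: "complex \<Rightarrow> real \<Rightarrow> complex" where
  "gauss_kernel w t = exp (- of_real (pi * t\<^sup>2) + 2 * of_real pi * of_real t * w)"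

lemma gabor_eq_gauss_kernel:
  "gabor (\<lambda>t. complex_of_real (exp (- pi * t\<^sup>2))) p = (\<lambda>t. of_real (exp (- pi * (fst p)\<^sup>2)) * gauss_kernel (to_complex p) t)"
proof
  fix t obtain x y where p: "p = (x, y)" by fastforce
  have "complex_of_real (exp (- pi * (t - x)\<^sup>2)) = exp (of_real (- pi * (t-x)^2))" by (simp only: exp_of_real)
  moreover have "complex_of_real (exp (- pi * x\<^sup>2)) = exp (of_real (- pi * x^2))" by (simp only: exp_of_real)
  moreover have "Complex x y = of_real x + \<i> * of_real y" by (simp add: complex_eq_iff)
  ultimately show "gabor (\<lambda>t. complex_of_real (exp (- pi * t\<^sup>2))) p t
      = of_real (exp (- pi * (fst p)\<^sup>2)) * gauss_kernel (to_complex p) t"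
    by (simp add: gabor_def tf_shift_def p gauss_kernel_def to_complex_def mult_exp_exp power2_eq_square algebra_simps
      del: of_real_exp)
qed

lemma cmod_gauss_kernel: "cmod (gauss_kernel w t) = exp (- pi * t\<^sup>2 + 2 * pi * t * Re w)"
  by (simp add: gauss_kernel_def norm_exp_eq_Re)

lemma gauss_kernel_measurable[measurable]: "gauss_kernel w \<in> borel_measurable lborel"
proof -
  have "continuous_on UNIV (gauss_kernel w)" unfolding gauss_kernel_def[abs_def] by (intro continuous_intros)
  thus ?thesis by (simp add: borel_measurable_continuous_onI)
qed

lemma integrable_gaussian_exp:
  fixes a b :: real assumes "a > 0"
  shows "integrable lborel (\<lambda>t. exp (- a * t\<^sup>2 + b * t))"
proof -
  define \<sigma> where "\<sigma> = sqrt (1 / (2*a))"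
  have s: "\<sigma> > 0" "\<sigma>^2 = 1/(2*a)" using assms by (auto simp: \<sigma>_def)
  have "integrable lborel (\<lambda>t. normal_density (b/(2*a)) \<sigma> t * (sqrt (2 * pi * \<sigma>\<^sup>2) * exp (b\<^sup>2/(4*a))))"
    using s by (intro integrable_mult_left integrable_normal_density) auto
  moreover have "normal_density (b/(2*a)) \<sigma> t * (sqrt (2 * pi * \<sigma>\<^sup>2) * exp (b\<^sup>2/(4*a))) = exp (- a * t\<^sup>2 + b * t)" for t
  proof -
    have "sqrt (2 * pi * \<sigma>\<^sup>2) > 0" using s(1) by simp
    with s(1) have "normal_density (b/(2*a)) \<sigma> t * (sqrt (2 * pi * \<sigma>\<^sup>2) * exp (b\<^sup>2/(4*a)))
       = exp (- (t - b/(2*a))\<^sup>2 / (2 * \<sigma>\<^sup>2)) * exp (b\<^sup>2/(4*a))" unfolding normal_density_def by simp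
    also have "\<dots> = exp (- (t - b/(2*a))\<^sup>2 / (2 * \<sigma>\<^sup>2) + b\<^sup>2/(4*a))" by (simp only: mult_exp_exp)
    also have "- (t - b/(2*a))\<^sup>2 / (2 * \<sigma>\<^sup>2) + b\<^sup>2/(4*a) = - a * t\<^sup>2 + b * t"
      unfolding s(2) using assms by (simp add: power2_eq_square field_simps)
    finally show ?thesis .
  qed
  ultimately show ?thesis by simp
qed

lemma gauss_kernel_L2: "gauss_kernel w \<in> L2_space"
proof -
  have "(cmod (gauss_kernel w t))\<^sup>2 = exp (- (2*pi) * t\<^sup>2 + (4 * pi * Re w) * t)" for t
    unfolding cmod_gauss_kernel unfolding power2_eq_square[of "exp _"] mult_exp_exp by (simp add: algebra_simps)
  thus ?thesis using integrable_gaussian_exp[of "2*pi" "4 * pi * Re w"] by (simp add: L2_space_def)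
qed

text \<open>The real part of \<open>z\<close> shifts the Gaussian density; the imaginary part is the
  frequency at which the characteristic function of the normal law is evaluated.\<close>

lemma gauss_integral:
  fixes z :: complex
  shows "has_bochner_integral lborel (\<lambda>t. exp (- of_real (2 * pi * t\<^sup>2) + 2 * of_real pi * of_real t * z))
           (of_real (1 / sqrt 2) * exp (of_real pi * z\<^sup>2 / 2))"
proof -
  let ?f = "\<lambda>t::real. exp (- of_real (2 * pi * t\<^sup>2) + 2 * of_real pi * of_real t * z) :: complex"
  define u v where "u = Re z" "v = Im z"
  have z: "z = of_real u + \<i> * of_real v" by (simp add: u_v_def complex_eq_iff)
  \<comment> \<open>\<open>exp (- 2 * pi * t^2)\<close> is a multiple of a normal density with
    standard deviation \<open>c\<close>, and completing the square moves its mean to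
    \<open>u / 2\<close>.\<close>
  define c where "c = 1 / (2 * sqrt pi)"
  have c: "c > 0" "c\<^sup>2 = 1 / (4 * pi)" by (auto simp: c_def power_divide)
  let ?K = "of_real (sqrt (2 * pi)) * exp (of_real (pi * u\<^sup>2/2) + \<i> * of_real (pi * u * v)) :: complex"
  have int: "integrable lborel (\<lambda>x. std_normal_density x *\<^sub>R iexp ((2 * pi * c * v) * x))"
  proof (rule Bochner_Integration.integrable_bound)
    show "integrable lborel std_normal_density" by simp
  qed (auto simp: norm_exp_eq_Re)
  have "char std_normal_distribution (2 * pi * c * v) = (CLINT x|lborel. std_normal_density x *\<^sub>R iexp ((2 * pi * c * v) * x))"
    unfolding char_def by (subst integral_density) auto
  hence val: "(CLINT x|lborel. std_normal_density x *\<^sub>R iexp ((2 * pi * c * v) * x)) = of_real (exp (- (2 * pi * c * v)\<^sup>2 / 2))"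
    by (simp add: char_std_normal_distribution)
  have 1: "has_bochner_integral lborel (\<lambda>x. ?K * (std_normal_density x *\<^sub>R iexp ((2 * pi * c * v) * x)))
      (?K * of_real (exp (- (2 * pi * c * v)\<^sup>2 / 2)))"
    using int val by (intro has_bochner_integral_mult_right) (auto simp: has_bochner_integral_iff)
  have eq: "?K * (std_normal_density x *\<^sub>R iexp ((2 * pi * c * v) * x)) = ?f (u/2 + c * x)" for x
  proof -
    have "?K * (std_normal_density x *\<^sub>R iexp ((2 * pi * c * v) * x)) =
      exp (of_real (pi * u\<^sup>2/2) + \<i> * of_real (pi * u * v)) * (exp (of_real (- x\<^sup>2 / 2)) * iexp ((2 * pi * c * v) * x))"
      unfolding std_normal_density_def exp_of_real scaleR_conv_of_real by simp
    also have "\<dots> = exp (of_real (pi * u\<^sup>2/2) + \<i> * of_real (pi * u * v) + (of_real (- x\<^sup>2 / 2) + \<i> * of_real ((2 * pi * c * v) * x)))"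
      by (simp only: exp_add)
    also have "of_real (pi * u\<^sup>2/2) + \<i> * of_real (pi * u * v) + (of_real (- x\<^sup>2 / 2) + \<i> * of_real ((2 * pi * c * v) * x))
       = - of_real (2 * pi * (u/2 + c * x)\<^sup>2) + 2 * of_real pi * of_real (u/2 + c*x) * z"
    proof -
      have "2 * pi * (u/2 + c * x)\<^sup>2 = pi * u\<^sup>2/2 + 2 * pi * u * c * x + 2 * pi * c\<^sup>2 * x\<^sup>2"
        by (simp add: power2_eq_square algebra_simps)
      also have "\<dots> = pi * u\<^sup>2/2 + 2 * pi * u * c * x + x\<^sup>2 / 2" unfolding c(2) by simp
      finally have e: "2 * pi * (u/2 + c * x)\<^sup>2 = pi * u\<^sup>2/2 + 2 * pi * u * c * x + x\<^sup>2 / 2" .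
      show ?thesis unfolding e z by (simp add: complex_eq_iff algebra_simps power2_eq_square)
    qed
    finally show ?thesis .
  qed
  have "has_bochner_integral lborel (\<lambda>x. ?f (u/2 + c * x)) (?K * of_real (exp (- (2 * pi * c * v)\<^sup>2 / 2)))"
    using 1 unfolding eq .
  moreover have "?K * of_real (exp (- (2 * pi * c * v)\<^sup>2 / 2)) = (of_real (1 / sqrt 2) * exp (of_real pi * z\<^sup>2 / 2)) /\<^sub>R \<bar>c\<bar>"
  proof -
    have "(2 * pi * c * v)\<^sup>2 / 2 = pi * v\<^sup>2 / 2" by (simp add: power_mult_distrib c(2)) (simp add: power2_eq_square)
    hence "?K * of_real (exp (- (2 * pi * c * v)\<^sup>2 / 2)) = of_real (sqrt (2 * pi)) * exp (of_real (pi * u\<^sup>2/2) + \<i> * of_real (pi * u * v) + of_real (- (pi * v\<^sup>2 / 2)))"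
      unfolding exp_add by (simp flip: exp_of_real)
    also have "of_real (pi * u\<^sup>2/2) + \<i> * of_real (pi * u * v) + of_real (- (pi * v\<^sup>2 / 2)) = of_real pi * z\<^sup>2 / 2"
      unfolding z by (simp add: complex_eq_iff power2_eq_square algebra_simps)
    finally have 2: "?K * of_real (exp (- (2 * pi * c * v)\<^sup>2 / 2)) = of_real (sqrt (2 * pi)) * exp (of_real pi * z\<^sup>2 / 2)" .
    have 3: "sqrt (2 * pi) = (1 / sqrt 2) / \<bar>c\<bar>"
      unfolding c_def by (simp add: real_sqrt_mult field_simps)
    show ?thesis using c(1) unfolding 2 unfolding 3 by (simp add: scaleR_conv_of_real field_simps)
  qed
  ultimately show ?thesis
    using lborel_has_bochner_integral_real_affine_iff[of c ?f _ "u/2"] c(1) by simp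
qed

text \<open>Apart from a constant and from factors in \<open>w\<close> or \<open>v\<close> alone,
  the inner product is \<open>exp (pi * w * cnj v)\<close>, the reproducing kernel of the Fock
  space. This identification carries all later Hilbert space arguments over to entire
  functions.\<close>

lemma gauss_kernel_inner:
  "has_bochner_integral lborel (\<lambda>t. gauss_kernel w t * cnj (gauss_kernel v t))
     (of_real (1 / sqrt 2) * (exp (of_real pi * w\<^sup>2 / 2) * cnj (exp (of_real pi * v\<^sup>2 / 2)) * exp (of_real pi * (w * cnj v))))"
proof -
  have "gauss_kernel w t * cnj (gauss_kernel v t) = exp (- of_real (2 * pi * t\<^sup>2) + 2 * of_real pi * of_real t * (w + cnj v))" for t
    by (simp add: gauss_kernel_def exp_cnj mult_exp_exp algebra_simps)
  moreover have "exp (of_real pi * w\<^sup>2 / 2) * cnj (exp (of_real pi * v\<^sup>2 / 2)) * exp (of_real pi * (w * cnj v)) = exp (of_real pi * (w + cnj v)\<^sup>2 / 2)"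
    unfolding exp_cnj mult_exp_exp
    by (rule arg_cong[where f=exp]) (simp add: field_simps power2_eq_square)
  ultimately show ?thesis using gauss_integral[of "w + cnj v"] by (simp only:)
qed

lemma L2_seminorm_gauss_kernel: "L2_seminorm (gauss_kernel w) \<le> exp (pi * (Re w)\<^sup>2)"
proof -
  have "has_bochner_integral lborel (\<lambda>t. complex_of_real ((cmod (gauss_kernel w t))\<^sup>2))
     (of_real (1 / sqrt 2 * exp (2 * pi * (Re w)\<^sup>2)))"
  proof -
    have "exp (of_real pi * w\<^sup>2 / 2) * cnj (exp (of_real pi * w\<^sup>2 / 2)) * exp (of_real pi * (w * cnj w)) = exp (of_real (2 * pi * (Re w)\<^sup>2))"
      unfolding exp_cnj mult_exp_exp
      by (rule arg_cong[where f=exp]) (simp add: complex_eq_iff field_simps power2_eq_square)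
    thus ?thesis using gauss_kernel_inner[of w w] by (simp flip: complex_norm_square exp_of_real)
  qed
  hence "(LINT t|lborel. (cmod (gauss_kernel w t))\<^sup>2) = 1 / sqrt 2 * exp (2 * pi * (Re w)\<^sup>2)"
    unfolding has_bochner_integral_iff integral_complex_of_real of_real_eq_iff by auto
  hence "(L2_seminorm (gauss_kernel w))\<^sup>2 = 1 / sqrt 2 * exp (2 * pi * (Re w)\<^sup>2)" by (simp add: L2_seminorm_sq)
  also have "\<dots> \<le> 1 * exp (2 * pi * (Re w)\<^sup>2)" by (intro mult_right_mono) auto
  also have "\<dots> = (exp (pi * (Re w)\<^sup>2))\<^sup>2" unfolding power2_eq_square[of "exp _"] mult_exp_exp by (simp add: algebra_simps)
  finally show ?thesis by (rule power2_le_imp_le) simp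
qed

text \<open>Expanding the reproducing kernel in powers of \<open>w * cnj v\<close> diagonalizes the
  Gram form of the kernels: each power contributes the square of one linear form in the
  coefficients.\<close>

lemma gauss_kernel_comb_sums:
  fixes c w :: "'i \<Rightarrow> complex"
  assumes I: "finite I"
  shows "(\<lambda>n. pi^n / fact n * (cmod (\<Sum>i\<in>I. c i * exp (of_real pi * (w i)\<^sup>2 / 2) * w i ^ n))\<^sup>2)
           sums (sqrt 2 * (L2_seminorm (\<lambda>t. \<Sum>i\<in>I. c i * gauss_kernel (w i) t))\<^sup>2)"
proof -
  define d where "d i = c i * exp (of_real pi * (w i)\<^sup>2 / 2)" for i
  have "has_bochner_integral lborel (\<lambda>t. \<Sum>i\<in>I. \<Sum>j\<in>I. (c i * cnj (c j)) * (gauss_kernel (w i) t * cnj (gauss_kernel (w j) t)))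
     (\<Sum>i\<in>I. \<Sum>j\<in>I. (c i * cnj (c j)) * (of_real (1 / sqrt 2) * (exp (of_real pi * (w i)\<^sup>2 / 2) * cnj (exp (of_real pi * (w j)\<^sup>2 / 2)) * exp (of_real pi * (w i * cnj (w j))))))"
    by (intro has_bochner_integral_sum has_bochner_integral_mult_right gauss_kernel_inner)
  moreover have "(\<Sum>i\<in>I. \<Sum>j\<in>I. (c i * cnj (c j)) * (gauss_kernel (w i) t * cnj (gauss_kernel (w j) t))) =
      complex_of_real ((cmod (\<Sum>i\<in>I. c i * gauss_kernel (w i) t))\<^sup>2)" for t
    unfolding complex_norm_square cnj_sum sum_product by (simp add: mult_ac)
  moreover have "(\<Sum>i\<in>I. \<Sum>j\<in>I. (c i * cnj (c j)) * (of_real (1 / sqrt 2) * (exp (of_real pi * (w i)\<^sup>2 / 2) * cnj (exp (of_real pi * (w j)\<^sup>2 / 2)) * exp (of_real pi * (w i * cnj (w j))))))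
     = of_real (1 / sqrt 2) * (\<Sum>i\<in>I. \<Sum>j\<in>I. d i * cnj (d j) * exp (of_real pi * (w i * cnj (w j))))"
    unfolding sum_distrib_left by (simp add: d_def mult_ac)
  ultimately have "has_bochner_integral lborel (\<lambda>t. complex_of_real ((cmod (\<Sum>i\<in>I. c i * gauss_kernel (w i) t))\<^sup>2))
      (of_real (1 / sqrt 2) * (\<Sum>i\<in>I. \<Sum>j\<in>I. d i * cnj (d j) * exp (of_real pi * (w i * cnj (w j)))))"
    by (simp only:)
  from has_bochner_integral_integral_eq[OF this]
  have "complex_of_real ((L2_seminorm (\<lambda>t. \<Sum>i\<in>I. c i * gauss_kernel (w i) t))\<^sup>2) =
      of_real (1 / sqrt 2) * (\<Sum>i\<in>I. \<Sum>j\<in>I. d i * cnj (d j) * exp (of_real pi * (w i * cnj (w j))))"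
    unfolding L2_seminorm_sq integral_complex_of_real .
  hence E: "(\<Sum>i\<in>I. \<Sum>j\<in>I. d i * cnj (d j) * exp (of_real pi * (w i * cnj (w j)))) =
     complex_of_real (sqrt 2 * (L2_seminorm (\<lambda>t. \<Sum>i\<in>I. c i * gauss_kernel (w i) t))\<^sup>2)" by (simp add: field_simps)
  have "(\<lambda>n. \<Sum>i\<in>I. \<Sum>j\<in>I. d i * cnj (d j) * ((of_real pi * (w i * cnj (w j)))^n /\<^sub>R fact n)) sums
     (\<Sum>i\<in>I. \<Sum>j\<in>I. d i * cnj (d j) * exp (of_real pi * (w i * cnj (w j))))"
    by (intro sums_sum sums_mult exp_converges)
  moreover have "(\<Sum>i\<in>I. \<Sum>j\<in>I. d i * cnj (d j) * ((of_real pi * (w i * cnj (w j)))^n /\<^sub>R fact n)) =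
      complex_of_real (pi^n / fact n * (cmod (\<Sum>i\<in>I. d i * w i ^ n))\<^sup>2)" for n
  proof -
    have "complex_of_real (pi^n / fact n * (cmod (\<Sum>i\<in>I. d i * w i ^ n))\<^sup>2) =
      of_real (pi^n / fact n) * (\<Sum>i\<in>I. \<Sum>j\<in>I. d i * w i ^ n * cnj (d j * w j ^ n))"
      unfolding of_real_mult complex_norm_square cnj_sum sum_product ..
    thus ?thesis unfolding sum_distrib_left
      by (simp add: scaleR_conv_of_real power_mult_distrib divide_inverse mult_ac)
  qed
  ultimately have "(\<lambda>n. complex_of_real (pi^n / fact n * (cmod (\<Sum>i\<in>I. d i * w i ^ n))\<^sup>2)) sums
     complex_of_real (sqrt 2 * (L2_seminorm (\<lambda>t. \<Sum>i\<in>I. c i * gauss_kernel (w i) t))\<^sup>2)" unfolding E by simp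
  thus ?thesis unfolding sums_of_real_iff d_def .
qed

text \<open>The Fock space norm of \<open>F = \<Sum> a\<^sub>n z\<^sup>n\<close> is \<open>(\<Sum> |a\<^sub>n|\<^sup>2 n!/\<pi>\<^sup>n)\<^sup>1\<^sup>/\<^sup>2\<close>;
  by \<open>gauss_kernel_comb_sums\<close> evaluation of \<open>F\<close> is then a bounded functional of the kernels.\<close>

lemma fock_functional_bound:
  fixes F :: "complex \<Rightarrow> complex"
  assumes a: "\<And>z. (\<lambda>n. a n * z^n) sums F z"
    and K: "\<And>N. (\<Sum>n<N. (cmod (a n))\<^sup>2 * fact n / pi^n) \<le> K\<^sup>2" "K \<ge> 0"
    and I: "finite I"
  shows "cmod (\<Sum>i\<in>I. c i * exp (of_real pi * (w i)\<^sup>2 / 2) * F (w i)) \<le> 2 * K * L2_seminorm (\<lambda>t. \<Sum>i\<in>I. c i * gauss_kernel (w i) t)"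
proof -
  define d where "d i = c i * exp (of_real pi * (w i)\<^sup>2 / 2)" for i
  define V where "V n = (\<Sum>i\<in>I. d i * w i ^ n)" for n
  define L where "L = L2_seminorm (\<lambda>t. \<Sum>i\<in>I. c i * gauss_kernel (w i) t)"
  have L: "L \<ge> 0" unfolding L_def by (rule L2_seminorm_nonneg)
  have sV: "(\<lambda>n. pi^n / fact n * (cmod (V n))\<^sup>2) sums (sqrt 2 * L\<^sup>2)"
    using gauss_kernel_comb_sums[OF I, of c w] unfolding V_def L_def d_def .
  have part: "cmod (\<Sum>n<N. a n * V n) \<le> 2 * K * L" for N
  proof -
    \<comment> \<open>Reciprocal weights split each product between the Fock norm of
      \<open>F\<close> and the Gram series, as Cauchy--Schwarz requires.\<close>
    define p q where "p n = cmod (a n) * sqrt (fact n / pi^n)" and "q n = cmod (V n) * sqrt (pi^n / fact n)" for n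
    have pq: "cmod (a n * V n) = p n * q n" for n
    proof -
      have "sqrt (fact n / pi^n) * sqrt (pi^n / fact n) = 1" by (simp flip: real_sqrt_mult)
      thus ?thesis by (simp add: p_def q_def norm_mult algebra_simps)
    qed
    have "(\<Sum>n<N. (p n)\<^sup>2) = (\<Sum>n<N. (cmod (a n))\<^sup>2 * fact n / pi^n)" by (simp add: p_def power_mult_distrib)
    moreover have "(\<Sum>n<N. (q n)\<^sup>2) \<le> sqrt 2 * L\<^sup>2"
    proof -
      have "(\<Sum>n<N. (q n)\<^sup>2) = (\<Sum>n<N. pi^n / fact n * (cmod (V n))\<^sup>2)" by (simp add: q_def power_mult_distrib mult_ac)
      also have "\<dots> \<le> suminf (\<lambda>n. pi^n / fact n * (cmod (V n))\<^sup>2)"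
        using sV by (intro sum_le_suminf) (auto simp: sums_iff)
      finally show ?thesis using sV by (simp add: sums_iff)
    qed
    ultimately have "(\<Sum>n<N. p n * q n)\<^sup>2 \<le> K\<^sup>2 * (sqrt 2 * L\<^sup>2)"
      using K by (intro order_trans[OF Cauchy_Schwarz_ineq_sum] mult_mono) (auto intro: sum_nonneg)
    also have "\<dots> \<le> K\<^sup>2 * (4 * L\<^sup>2)" using sqrt2_less_2 by (intro mult_left_mono mult_right_mono) auto
    also have "\<dots> = (2 * K * L)\<^sup>2" by (simp add: power_mult_distrib)
    finally have "(\<Sum>n<N. p n * q n) \<le> 2 * K * L" by (rule power2_le_imp_le) (use K L in auto)
    moreover have "cmod (\<Sum>n<N. a n * V n) \<le> (\<Sum>n<N. p n * q n)" unfolding pq[symmetric] by (rule norm_sum)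
    ultimately show ?thesis by linarith
  qed
  have "(\<lambda>n. \<Sum>i\<in>I. d i * (a n * w i ^ n)) sums (\<Sum>i\<in>I. d i * F (w i))"
    by (intro sums_sum sums_mult a)
  hence "(\<lambda>N. \<Sum>n<N. a n * V n) \<longlonglongrightarrow> (\<Sum>i\<in>I. d i * F (w i))"
    by (simp add: sums_def V_def sum_distrib_left mult_ac)
  hence "cmod (\<Sum>i\<in>I. d i * F (w i)) \<le> 2 * K * L"
    by (intro tendsto_upperbound[OF tendsto_norm]) (use part in auto)
  thus ?thesis unfolding d_def L_def .
qed

section \<open>Coefficients of functions in Fock space and uniqueness\<close>

lemma fact_le_exp_power: "n \<ge> 1 \<Longrightarrow> fact n \<le> exp 1 * real n * (real n / exp 1) ^ n"
proof (induction n rule: nat_induct_at_least)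
  case base thus ?case by simp
next
  case (Suc n)
  define x where "x = real n"
  have x: "x \<ge> 1" using Suc by (simp add: x_def)
  have e: "exp 1 * x^n * x \<le> (x+1)^(n+1)"
  proof -
    have "ln (x / (x+1)) \<le> x / (x+1) - 1" using x by (intro ln_le_minus_one) auto
    hence "(x+1) * ln (x/(x+1)) \<le> (x+1) * (x / (x+1) - 1)" using x by (intro mult_left_mono) auto
    also have "\<dots> = -1" using x by (simp add: field_simps)
    finally have "1 + (x+1) * ln (x/(x+1)) \<le> 0" by simp
    hence "exp (1 + (x+1) * ln (x/(x+1))) \<le> 1" by simp
    also have "exp (1 + (x+1) * ln (x/(x+1))) = exp 1 * exp (ln (x/(x+1))) ^ (n+1)"
      unfolding exp_add exp_of_nat_mult[symmetric] by (simp add: x_def add_ac)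
    also have "exp (ln (x/(x+1))) = x / (x+1)" using x by simp
    finally have "exp 1 * (x^(n+1) / (x+1)^(n+1)) \<le> 1" by (simp only: power_divide)
    moreover have "(x+1)^(n+1) > 0" using x by simp
    ultimately show ?thesis by (simp add: divide_le_eq mult_ac)
  qed
  have "fact (Suc n) = (x + 1) * fact n" by (simp add: x_def)
  also have "\<dots> \<le> (x + 1) * (exp 1 * x * (x / exp 1)^n)" using Suc x unfolding x_def by (intro mult_left_mono) auto
  also have "\<dots> = (x + 1) * (exp 1 * x^n * x) / exp 1 ^ n" by (simp add: power_divide)
  also have "\<dots> \<le> (x + 1) * (x+1)^(n+1) / exp 1^n" using e x by (intro divide_right_mono mult_left_mono) auto
  also have "\<dots> = exp 1 * real (Suc n) * (real (Suc n) / exp 1) ^ (Suc n)"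
    by (simp add: x_def power_divide field_simps)
  finally show ?case .
qed

text \<open>The Cauchy estimate is taken on the circle of radius \<open>sqrt (n / pi)\<close>, where
  \<open>exp (pi/2 * r^2) / r^n\<close> is smallest. The exponent 3 is the least integer for which
  this works: it contributes \<open>r^6\<close>, of order \<open>n^3\<close>, to the denominator
  after squaring, the crude factorial bound costs one power of \<open>n\<close>, and the remaining
  \<open>1 / n^2\<close> is summable.\<close>

lemma fock_coeff_bound:
  assumes F: "F holomorphic_on UNIV"
    and B: "\<And>z. cmod (F z) \<le> C * exp (pi/2 * (cmod z)\<^sup>2) / (1 + cmod z)^3"
  defines "a \<equiv> \<lambda>n. (deriv ^^ n) F 0 / fact n"
  shows "n \<ge> 1 \<Longrightarrow> (cmod (a n))\<^sup>2 * fact n / pi^n \<le> C\<^sup>2 * exp 1 * pi^3 / (real n)\<^sup>2"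
    and "(\<lambda>n. a n * z^n) sums F z"
proof -
  show "(\<lambda>n. a n * z^n) sums F z"
    using holomorphic_power_series[of F 0 "cmod z + 1" z] F holomorphic_on_subset unfolding a_def by fastforce
  assume n: "n \<ge> 1"
  define r where "r = sqrt (n / pi)"
  have r: "r > 0" "r\<^sup>2 = n / pi" using n by (auto simp: r_def)
  have C: "C \<ge> 0" using B[of 0] norm_ge_zero[of "F 0"] by (simp del: norm_ge_zero)
  have "cmod ((deriv ^^ n) F 0) \<le> fact n * (C * exp (pi/2 * r\<^sup>2) / (1 + r)^3) / r^n"
  proof (rule Cauchy_inequality)
    show "F holomorphic_on ball 0 r" using F by (rule holomorphic_on_subset) auto
    show "continuous_on (cball 0 r) F" using F holomorphic_on_imp_continuous_on continuous_on_subset by blast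
    show "cmod (F z) \<le> C * exp (pi/2 * r\<^sup>2) / (1 + r)^3" if "cmod (0 - z) = r" for z using B[of z] that by simp
  qed fact
  hence "cmod (a n) \<le> (C * exp (pi/2 * r\<^sup>2) / (1 + r)^3) / r^n"
    unfolding a_def norm_divide by (simp add: field_simps)
  also have "\<dots> \<le> (C * exp (pi/2 * r\<^sup>2) / r^3) / r^n"
    using r C by (intro divide_right_mono divide_left_mono power_mono) auto
  finally have "(cmod (a n))\<^sup>2 \<le> ((C * exp (pi/2 * r\<^sup>2) / r^3) / r^n)\<^sup>2" by (intro power_mono) auto
  also have "\<dots> = C\<^sup>2 * exp (pi * r\<^sup>2) / (r\<^sup>2)^3 / (r\<^sup>2)^n"
  proof -
    have "(exp (pi/2 * r\<^sup>2))\<^sup>2 = exp (pi * r\<^sup>2)" unfolding power2_eq_square[of "exp _"] mult_exp_exp by simp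
    thus ?thesis by (simp add: power_mult_distrib power_divide power_mult[symmetric] mult.commute)
  qed
  also have "\<dots> = C\<^sup>2 * exp 1 ^ n / (n/pi)^3 / (n/pi)^n" unfolding r(2) by (simp flip: exp_of_nat_mult)
  finally have "(cmod (a n))\<^sup>2 * (fact n / pi^n) \<le> (C\<^sup>2 * exp 1 ^ n / (n/pi)^3 / (n/pi)^n) * ((exp 1 * real n * (real n / exp 1) ^ n) / pi^n)"
    using fact_le_exp_power[OF n] by (intro mult_mono divide_right_mono) auto
  also have "\<dots> = C\<^sup>2 * exp 1 * pi^3 / (real n)\<^sup>2"
    using n by (simp add: power_divide field_simps power2_eq_square power3_eq_cube)
  finally show "(cmod (a n))\<^sup>2 * fact n / pi^n \<le> C\<^sup>2 * exp 1 * pi^3 / (real n)\<^sup>2" by simp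
qed

lemma span_gabor_comb:
  assumes "h \<in> cfun.span (gabor (\<lambda>t. complex_of_real (exp (- pi * t\<^sup>2))) ` A)"
  shows "\<exists>I c. finite I \<and> I \<subseteq> A \<and> h = (\<lambda>t. \<Sum>p\<in>I. c p * gauss_kernel (to_complex p) t)"
proof -
  let ?g = "gabor (\<lambda>t. complex_of_real (exp (- pi * t\<^sup>2)))"
  obtain T r where T: "finite T" "T \<subseteq> ?g ` A" "h = (\<Sum>a\<in>T. (\<lambda>t. r a * a t))"
    using assms unfolding cfun.span_explicit by auto
  obtain I where I: "I \<subseteq> A" "inj_on ?g I" "T = ?g ` I"
    using T(2) by (meson subset_image_inj)
  have "finite I" using T(1) I(2,3) by (simp add: finite_image_iff)
  have app: "(\<Sum>a\<in>T. (\<lambda>t. r a * a t)) t = (\<Sum>a\<in>T. r a * a t)" for t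
    using T(1) by (induction T rule: finite_induct) auto
  have "h t = (\<Sum>p\<in>I. (r (?g p) * of_real (exp (- pi * (fst p)\<^sup>2))) * gauss_kernel (to_complex p) t)" for t
    unfolding T(3) app unfolding I(3) sum.reindex[OF I(2)] o_def
    unfolding gabor_eq_gauss_kernel by (simp add: mult_ac)
  thus ?thesis using I(1) \<open>finite I\<close>
    by (intro exI[of _ I] exI[of _ "\<lambda>p. r (?g p) * of_real (exp (- pi * (fst p)\<^sup>2))"]) auto
qed

text \<open>Completeness approximates the kernel at \<open>w\<close> by combinations of kernels at
  points where \<open>F\<close> vanishes. The functional of \<open>fock_functional_bound\<close>,
  applied to the difference, sees only the value at \<open>w\<close>, and the seminorm of the
  difference is arbitrarily small.\<close>

lemma complete_uniqueness:
  assumes compl: "L2_complete (gabor (\<lambda>t. complex_of_real (exp (- pi * t\<^sup>2)))) A"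
    and F: "F holomorphic_on UNIV"
    and B: "\<And>z. cmod (F z) \<le> C * exp (pi/2 * (cmod z)\<^sup>2) / (1 + cmod z)^3"
    and zero: "\<And>p. p \<in> A \<Longrightarrow> F (to_complex p) = 0"
  shows "F w = 0"
proof -
  define a where "a = (\<lambda>n. (deriv ^^ n) F 0 / fact n)"
  have a: "(\<lambda>n. a n * z^n) sums F z" for z using fock_coeff_bound(2)[OF F B] unfolding a_def .
  have "summable (\<lambda>n. (cmod (a n))\<^sup>2 * fact n / pi^n)"
  proof (rule summable_comparison_test_ev)
    show "summable (\<lambda>n. (C\<^sup>2 * exp 1 * pi^3) * (1 / (real n)\<^sup>2))"
      using inverse_power_summable[of 2, where 'a=real] by (intro summable_mult) (auto simp: field_simps)
    show "eventually (\<lambda>n. norm ((cmod (a n))\<^sup>2 * fact n / pi^n) \<le> (C\<^sup>2 * exp 1 * pi^3) * (1 / (real n)\<^sup>2)) sequentially"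
      using eventually_ge_at_top[of 1] by eventually_elim (use fock_coeff_bound(1)[OF F B] in \<open>auto simp: a_def\<close>)
  qed
  hence K0: "(\<Sum>n<N. (cmod (a n))\<^sup>2 * fact n / pi^n) \<le> suminf (\<lambda>n. (cmod (a n))\<^sup>2 * fact n / pi^n)" for N
    by (intro sum_le_suminf) auto
  define K where "K = sqrt (suminf (\<lambda>n. (cmod (a n))\<^sup>2 * fact n / pi^n))"
  have K: "(\<Sum>n<N. (cmod (a n))\<^sup>2 * fact n / pi^n) \<le> K\<^sup>2" "K \<ge> 0" for N
    using K0[of N] K0[of 0] by (auto simp: K_def)
  have small: "cmod (exp (of_real pi * w\<^sup>2 / 2) * F w) \<le> 2 * K * e" if e: "e > 0" for e
  proof -
    have "gauss_kernel w \<in> L2_closed_span (gabor (\<lambda>t. complex_of_real (exp (- pi * t\<^sup>2))) ` A)"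
      using compl gauss_kernel_L2 unfolding L2_complete_def by simp
    then obtain h where h: "h \<in> cfun.span (gabor (\<lambda>t. complex_of_real (exp (- pi * t\<^sup>2))) ` A)"
      "L2_seminorm (\<lambda>t. gauss_kernel w t - h t) < e" unfolding L2_closed_span_def using e by blast
    obtain I c where I: "finite I" "I \<subseteq> A" "h = (\<lambda>t. \<Sum>p\<in>I. c p * gauss_kernel (to_complex p) t)"
      using span_gabor_comb[OF h(1)] by blast
    \<comment> \<open>\<open>None\<close> stands for \<open>w\<close>, which is thereby kept apart
      from the approximating points even when it is one of them.\<close>
    define J where "J = insert None (Some ` I)"
    define c' where "c' q = (case q of None \<Rightarrow> 1 | Some p \<Rightarrow> - c p)" for q
    define w' where "w' q = (case q of None \<Rightarrow> w | Some p \<Rightarrow> to_complex p)" for q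
    have "(\<Sum>i\<in>J. c' i * exp (of_real pi * (w' i)\<^sup>2 / 2) * F (w' i)) = exp (of_real pi * w\<^sup>2 / 2) * F w"
      unfolding J_def using I zero by (subst sum.insert) (auto simp: c'_def w'_def sum.reindex intro!: sum.neutral)
    moreover have "(\<Sum>i\<in>J. c' i * gauss_kernel (w' i) t) = gauss_kernel w t - h t" for t
      unfolding J_def using I by (subst sum.insert) (auto simp: c'_def w'_def sum.reindex sum_negf)
    ultimately have "cmod (exp (of_real pi * w\<^sup>2 / 2) * F w) \<le> 2 * K * L2_seminorm (\<lambda>t. gauss_kernel w t - h t)"
      using fock_functional_bound[OF a K, of J c' w'] I(1) by (simp add: J_def)
    also have "\<dots> \<le> 2 * K * e" using h(2) K(2) by (intro mult_left_mono) auto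
    finally show ?thesis .
  qed
  have "cmod (exp (of_real pi * w\<^sup>2 / 2) * F w) \<le> e" if e: "e > 0" for e
  proof -
    have "cmod (exp (of_real pi * w\<^sup>2 / 2) * F w) \<le> 2 * K * (e / (2 * K + 1))"
      using K(2) e by (intro small) auto
    also have "\<dots> \<le> e" using K(2) e by (simp add: field_simps)
    finally show ?thesis .
  qed
  hence "cmod (exp (of_real pi * w\<^sup>2 / 2) * F w) \<le> 0" by (metis add_0 field_le_epsilon)
  thus ?thesis by simp
qed

section \<open>The generating function\<close>

lemma L2_spaceI_gauss_kernel:
  assumes [measurable]: "f \<in> borel_measurable borel"
    and B: "\<And>t. cmod (f t) \<le> K * exp (b * \<bar>t\<bar>) * cmod (gauss_kernel w t)"
  shows "f \<in> L2_space"
proof -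
  let ?h = "\<lambda>s t. K\<^sup>2 * exp (- (2*pi) * t\<^sup>2 + (4 * pi * Re w + 2 * s) * t)"
  have "integrable lborel (\<lambda>t. (cmod (f t))\<^sup>2)"
  proof (rule Bochner_Integration.integrable_bound)
    show "integrable lborel (\<lambda>t. ?h b t + ?h (-b) t)"
      by (intro Bochner_Integration.integrable_add integrable_mult_right integrable_gaussian_exp) auto
    have "(cmod (f t))\<^sup>2 \<le> ?h b t + ?h (-b) t" for t
    proof -
      have "(cmod (f t))\<^sup>2 \<le> (K * exp (b * \<bar>t\<bar>) * cmod (gauss_kernel w t))\<^sup>2"
        using B[of t] by (intro power_mono) auto
      also have "\<dots> = K\<^sup>2 * (exp (b * \<bar>t\<bar>) * exp (- pi * t\<^sup>2 + 2 * pi * t * Re w))\<^sup>2"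
        unfolding cmod_gauss_kernel by (simp add: power_mult_distrib mult_ac)
      also have "(exp (b * \<bar>t\<bar>) * exp (- pi * t\<^sup>2 + 2 * pi * t * Re w))\<^sup>2 = exp (2 * b * \<bar>t\<bar> - 2 * pi * t\<^sup>2 + 4 * pi * t * Re w)"
        unfolding mult_exp_exp power2_eq_square[of "exp _"] by (simp add: algebra_simps)
      also have "K\<^sup>2 * \<dots> \<le> ?h b t + ?h (-b) t"
        by (cases "t \<ge> 0") (auto simp: algebra_simps)
      finally show ?thesis .
    qed
    thus "AE t in lborel. norm ((cmod (f t))\<^sup>2) \<le> norm (?h b t + ?h (-b) t)"
      by (intro AE_I2) (simp add: order_trans[OF _ abs_ge_self])
  qed auto
  thus ?thesis by (simp add: L2_space_def)
qed

lemma L2_seminorm_mono: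
  assumes "f \<in> L2_space" "h \<in> L2_space" "\<And>t. cmod (f t) \<le> cmod (h t)"
  shows "L2_seminorm f \<le> L2_seminorm h"
  unfolding L2_seminorm_def using assms
  by (intro real_sqrt_le_mono integral_mono) (auto simp: L2_space_def intro: power_mono)

lemma span_subset_L2_space:
  assumes S: "S \<subseteq> L2_space"
  shows "cfun.span S \<subseteq> L2_space"
proof
  fix h assume "h \<in> cfun.span S"
  thus "h \<in> L2_space"
  proof (induction rule: cfun.span_induct_alt)
    case base
    thus ?case by (simp add: L2_space_def)
  next
    case (step c x y)
    thus ?case using S L2_space_add[of "\<lambda>t. c * x t" y] L2_space_scale[of x c] by (auto simp: plus_fun_def)
  qed
qed

lemma L2_closed_span_subset: "L2_closed_span S \<subseteq> L2_space"
  by (auto simp: L2_closed_span_def)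

lemma L2_closed_span_add:
  assumes S: "S \<subseteq> L2_space" and f: "f \<in> L2_closed_span S" "g \<in> L2_closed_span S"
  shows "(\<lambda>t. f t + g t) \<in> L2_closed_span S"
  unfolding L2_closed_span_def
proof (intro CollectI conjI allI impI)
  have L: "f \<in> L2_space" "g \<in> L2_space" using f L2_closed_span_subset by auto
  thus "(\<lambda>t. f t + g t) \<in> L2_space" by (rule L2_space_add)
  fix e :: real assume e: "e > 0"
  obtain h1 h2 where h: "h1 \<in> cfun.span S" "h2 \<in> cfun.span S" "L2_seminorm (\<lambda>t. f t - h1 t) < e/2" "L2_seminorm (\<lambda>t. g t - h2 t) < e/2"
    using f e half_gt_zero[OF e] unfolding L2_closed_span_def by blast
  have hL: "h1 \<in> L2_space" "h2 \<in> L2_space" using h span_subset_L2_space[OF S] by auto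
  have "L2_seminorm (\<lambda>t. (f t - h1 t) + (g t - h2 t)) \<le> L2_seminorm (\<lambda>t. f t - h1 t) + L2_seminorm (\<lambda>t. g t - h2 t)"
    using L hL by (intro L2_seminorm_triangle L2_space_diff)
  also have "\<dots> < e" using h by simp
  finally have "L2_seminorm (\<lambda>t. f t + g t - (h1 + h2) t) < e" by (simp add: algebra_simps)
  thus "\<exists>h\<in>cfun.span S. L2_seminorm (\<lambda>t. f t + g t - h t) < e" using cfun.span_add[OF h(1,2)] by blast
qed

lemma L2_closed_span_scale:
  assumes S: "S \<subseteq> L2_space" and f: "f \<in> L2_closed_span S"
  shows "(\<lambda>t. c * f t) \<in> L2_closed_span S"
  unfolding L2_closed_span_def
proof (intro CollectI conjI allI impI)
  have L: "f \<in> L2_space" using f L2_closed_span_subset by auto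
  thus "(\<lambda>t. c * f t) \<in> L2_space" by (rule L2_space_scale)
  fix e :: real assume e: "e > 0"
  have "e / (cmod c + 1) > 0" using e by (simp add: add_nonneg_pos)
  then obtain h where h: "h \<in> cfun.span S" "L2_seminorm (\<lambda>t. f t - h t) < e / (cmod c + 1)"
    using f unfolding L2_closed_span_def by blast
  have "L2_seminorm (\<lambda>t. c * f t - c * h t) = cmod c * L2_seminorm (\<lambda>t. f t - h t)"
    using L2_seminorm_scale[of c "\<lambda>t. f t - h t"] by (simp add: algebra_simps)
  also have "\<dots> \<le> cmod c * (e / (cmod c + 1))" using h by (intro mult_left_mono) auto
  also have "\<dots> < e"
  proof -
    have "cmod c * e < e * (cmod c + 1)" using e by (simp add: algebra_simps)
    moreover have "cmod c + 1 > 0" by (simp add: add_nonneg_pos)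
    ultimately show ?thesis by (simp add: divide_less_eq)
  qed
  finally show "\<exists>h\<in>cfun.span S. L2_seminorm (\<lambda>t. c * f t - h t) < e"
    by (intro bexI[of _ "\<lambda>t. c * h t"] cfun.span_scale[OF h(1)])
qed

lemma span_subset_L2_closed_span:
  assumes S: "S \<subseteq> L2_space" and h: "h \<in> cfun.span S" shows "h \<in> L2_closed_span S"
  using h span_subset_L2_space[OF S] unfolding L2_closed_span_def
  by (auto intro!: bexI[of _ h] simp: L2_seminorm_def)

text \<open>For a complete system and a vector \<open>u\<close> outside the closed span of the others, the
  coefficient of \<open>u\<close> is a bounded functional; no Riesz representation is needed.\<close>

lemma coefficient_functional_exists:
  assumes S: "S \<subseteq> L2_space" and u: "u \<in> L2_space" "u \<notin> L2_closed_span S"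
    and compl: "L2_closed_span (insert u S) = L2_space"
  obtains l d where "d > (0::real)"
    "\<And>f g. f \<in> L2_space \<Longrightarrow> g \<in> L2_space \<Longrightarrow> l (\<lambda>t. f t + g t) = l f + l g"
    "\<And>c f. f \<in> L2_space \<Longrightarrow> l (\<lambda>t. c * f t) = c * l f"
    "\<And>f. f \<in> L2_space \<Longrightarrow> cmod (l f) * d \<le> L2_seminorm f"
    "l u = 1" "\<And>f. f \<in> S \<Longrightarrow> l f = 0"
proof -
  let ?X = "L2_closed_span S"
  obtain d where d: "d > 0" "\<And>h. h \<in> cfun.span S \<Longrightarrow> d \<le> L2_seminorm (\<lambda>t. u t - h t)"
  proof -
    have "\<not> (\<forall>e>0. \<exists>h\<in>cfun.span S. L2_seminorm (\<lambda>t. u t - h t) < e)"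
      using u unfolding L2_closed_span_def by simp
    thus ?thesis using that by (auto simp: not_less)
  qed
  have XL: "x \<in> L2_space" if "x \<in> ?X" for x using that L2_closed_span_subset by auto
  have dX: "d \<le> L2_seminorm (\<lambda>t. u t - x t)" if x: "x \<in> ?X" for x
  proof (rule field_le_epsilon)
    fix e :: real assume e: "e > 0"
    obtain h where h: "h \<in> cfun.span S" "L2_seminorm (\<lambda>t. x t - h t) < e" using x e unfolding L2_closed_span_def by blast
    have "d \<le> L2_seminorm (\<lambda>t. u t - h t)" using d(2) h by auto
    also have "\<dots> \<le> L2_seminorm (\<lambda>t. u t - x t) + L2_seminorm (\<lambda>t. x t - h t)"
      using u XL[OF x] h span_subset_L2_space[OF S] by (intro L2_seminorm_diff_trans) auto
    finally show "d \<le> L2_seminorm (\<lambda>t. u t - x t) + e" using h by simp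
  qed
  have bound: "cmod c * d \<le> L2_seminorm f" if f: "f \<in> L2_space" and X: "(\<lambda>t. f t - c * u t) \<in> ?X" for f c
  proof (cases "c = 0")
    case True thus ?thesis by (simp add: L2_seminorm_nonneg)
  next
    case False
    have "(\<lambda>t. (- 1 / c) * (f t - c * u t)) \<in> ?X" using L2_closed_span_scale[OF S X] .
    from dX[OF this] have "d \<le> L2_seminorm (\<lambda>t. (1/c) * f t)" using False by (simp add: field_simps)
    thus ?thesis unfolding L2_seminorm_scale using False by (simp add: norm_divide field_simps)
  qed
  \<comment> \<open>Approximants of \<open>f\<close> from the span of \<open>u\<close> and
    \<open>S\<close> have a coefficient at \<open>u\<close>. By \<open>bound\<close>, applied to
    differences of approximants, these coefficients form a Cauchy sequence, and its limit is the
    coefficient of \<open>f\<close>.\<close>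
  have ex: "\<exists>c. (\<lambda>t. f t - c * u t) \<in> ?X" if f: "f \<in> L2_space" for f
  proof -
    have "\<exists>h c. (\<lambda>t. h t - c * u t) \<in> cfun.span S \<and> h \<in> L2_space \<and> L2_seminorm (\<lambda>t. f t - h t) < 1 / Suc n" for n
    proof -
      have "1 / Suc n > (0::real)" by simp
      then obtain h where h: "h \<in> cfun.span (insert u S)" "L2_seminorm (\<lambda>t. f t - h t) < 1 / Suc n"
        using f compl unfolding L2_closed_span_def by blast
      then obtain c where "h - (\<lambda>t. c * u t) \<in> cfun.span S" by (auto simp: cfun.span_insert)
      moreover have "h \<in> L2_space" using h(1) span_subset_L2_space[of "insert u S"] S u by auto
      ultimately show ?thesis using h by (auto simp: fun_diff_def)
    qed
    then obtain h c where hc: "\<And>n. (\<lambda>t. h n t - c n * u t) \<in> cfun.span S" "\<And>n. h n \<in> L2_space" "\<And>n. L2_seminorm (\<lambda>t. f t - h n t) < 1 / Suc n"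
      by metis
    have sX: "(\<lambda>t. h n t - c n * u t) \<in> ?X" for n using hc(1) by (rule span_subset_L2_closed_span[OF S])
    have cau: "cmod (c n - c m) * d \<le> 1 / Suc n + 1 / Suc m" for m n
    proof -
      have "(\<lambda>t. (h n t - c n * u t) + (-1) * (h m t - c m * u t)) \<in> ?X"
        by (intro L2_closed_span_add L2_closed_span_scale S sX)
      hence "(\<lambda>t. (h n t - h m t) - (c n - c m) * u t) \<in> ?X" by (simp add: algebra_simps)
      hence "cmod (c n - c m) * d \<le> L2_seminorm (\<lambda>t. h n t - h m t)" using hc(2) by (intro bound L2_space_diff) auto
      also have "\<dots> = L2_seminorm (\<lambda>t. (f t - h m t) - (f t - h n t))" by simp
      also have "\<dots> \<le> L2_seminorm (\<lambda>t. f t - h m t) + L2_seminorm (\<lambda>t. f t - h n t)"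
        using f hc(2) by (intro L2_seminorm_triangle_diff L2_space_diff) auto
      finally show ?thesis using hc(3)[of m] hc(3)[of n] by linarith
    qed
    have "Cauchy c"
    proof (rule metric_CauchyI)
      fix e :: real assume e: "e > 0"
      obtain N where N: "2 / (e * d) < real (Suc N)" using reals_Archimedean2[of "2 / (e * d)"] by (metis less_SucI of_nat_less_iff lessI less_trans)
      have "dist (c m) (c n) < e" if "m \<ge> N" "n \<ge> N" for m n
      proof -
        have "1 / real (Suc m) \<le> 1 / Suc N" "1 / real (Suc n) \<le> 1 / Suc N" using that by (auto intro!: divide_left_mono)
        hence "cmod (c m - c n) * d \<le> 2 / Suc N" using cau[of m n] by simp
        also have "2 / Suc N < e * d" using N e d(1) by (simp add: field_simps)
        finally show ?thesis using d(1) by (simp add: dist_norm)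
      qed
      thus "\<exists>M. \<forall>m\<ge>M. \<forall>n\<ge>M. dist (c m) (c n) < e" by blast
    qed
    then obtain c0 where c0: "c \<longlonglongrightarrow> c0" using Cauchy_convergent convergent_def by blast
    have "(\<lambda>n. 1 / real (Suc n) + cmod (c n - c0) * L2_seminorm u) \<longlonglongrightarrow> 0 + cmod (c0 - c0) * L2_seminorm u"
      by (intro tendsto_intros c0 LIMSEQ_Suc lim_1_over_n)
    hence lim: "(\<lambda>n. 1 / real (Suc n) + cmod (c n - c0) * L2_seminorm u) \<longlonglongrightarrow> 0" by simp
    have "(\<lambda>t. f t - c0 * u t) \<in> ?X"
      unfolding L2_closed_span_def
    proof (intro CollectI conjI allI impI)
      show "(\<lambda>t. f t - c0 * u t) \<in> L2_space" using f u by (intro L2_space_diff L2_space_scale)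
      fix e :: real assume "e > 0"
      hence "eventually (\<lambda>n. 1 / real (Suc n) + cmod (c n - c0) * L2_seminorm u < e) sequentially"
        using lim by (auto elim: order_tendstoD)
      then obtain n where n: "1 / real (Suc n) + cmod (c n - c0) * L2_seminorm u < e" by (auto simp: eventually_sequentially)
      have "L2_seminorm (\<lambda>t. f t - c0 * u t - (h n t - c n * u t)) = L2_seminorm (\<lambda>t. (f t - h n t) + (c n - c0) * u t)"
        by (simp add: algebra_simps)
      also have "\<dots> \<le> L2_seminorm (\<lambda>t. f t - h n t) + L2_seminorm (\<lambda>t. (c n - c0) * u t)"
        using f u hc by (intro L2_seminorm_triangle L2_space_diff L2_space_scale) auto
      also have "\<dots> < e" unfolding L2_seminorm_scale using n hc(3)[of n] by linarith
      finally show "\<exists>h\<in>cfun.span S. L2_seminorm (\<lambda>t. f t - c0 * u t - h t) < e" using hc(1)[of n]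
        by (intro bexI[of _ "\<lambda>t. h n t - c n * u t"])
    qed
    thus ?thesis by blast
  qed
  have zeroX: "(\<lambda>t. 0) \<in> ?X" using span_subset_L2_closed_span[OF S cfun.span_zero] by (simp add: zero_fun_def)
  have uniq: "c = c'" if "f \<in> L2_space" "(\<lambda>t. f t - c * u t) \<in> ?X" "(\<lambda>t. f t - c' * u t) \<in> ?X" for f c c'
  proof -
    have "(\<lambda>t. (f t - c * u t) + (-1) * (f t - c' * u t)) \<in> ?X"
      by (intro L2_closed_span_add L2_closed_span_scale S that)
    hence "(\<lambda>t. 0 - (c - c') * u t) \<in> ?X" by (simp add: algebra_simps)
    hence "cmod (c - c') * d \<le> L2_seminorm (\<lambda>t. 0)" using zeroX XL by (intro bound) auto
    thus ?thesis using d(1) by (simp add: L2_seminorm_def mult_le_0_iff)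
  qed
  define l where "l f = (SOME c. (\<lambda>t. f t - c * u t) \<in> ?X)" for f
  have l: "(\<lambda>t. f t - l f * u t) \<in> ?X" if "f \<in> L2_space" for f
    unfolding l_def using someI_ex[OF ex[OF that]] .
  have lI: "l f = c" if "f \<in> L2_space" "(\<lambda>t. f t - c * u t) \<in> ?X" for f c using uniq[OF that(1) l that(2)] that by auto
  show ?thesis
  proof (rule that[of d l])
    show "l (\<lambda>t. f t + g t) = l f + l g" if "f \<in> L2_space" "g \<in> L2_space" for f g
      using L2_closed_span_add[OF S l[OF that(1)] l[OF that(2)]] L2_space_add[OF that]
      by (intro lI) (auto simp: algebra_simps)
    show "l (\<lambda>t. c * f t) = c * l f" if "f \<in> L2_space" for c f
      using L2_closed_span_scale[OF S l[OF that], of c] L2_space_scale[OF that]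
      by (intro lI) (auto simp: algebra_simps)
    show "cmod (l f) * d \<le> L2_seminorm f" if "f \<in> L2_space" for f using bound[OF that l[OF that]] .
    show "l u = 1" using zeroX u by (intro lI) auto
    show "l f = 0" if "f \<in> S" for f using span_subset_L2_closed_span[OF S cfun.span_base[OF that]] S that by (intro lI) auto
  qed fact
qed

text \<open>The kernel is differentiable in \<open>w\<close> in the seminorm, not merely pointwise,
  and a bounded functional passes to the derivative. It is stated for an arbitrary functional
  because it serves twice: for the coefficient functional and for the pairing with a
  half-Gaussian.\<close>

lemma functional_gauss_kernel_holomorphic:
  assumes add: "\<And>f g. f \<in> L2_space \<Longrightarrow> g \<in> L2_space \<Longrightarrow> l (\<lambda>t. f t + g t) = l f + l g"
   and scale: "\<And>c f. f \<in> L2_space \<Longrightarrow> l (\<lambda>t. c * f t) = c * l f"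
   and bound: "\<And>f. f \<in> L2_space \<Longrightarrow> cmod (l f) * d \<le> L2_seminorm f" and d: "d > 0"
  shows "(\<lambda>w. l (gauss_kernel w)) holomorphic_on UNIV"
proof -
  have "((\<lambda>w. l (gauss_kernel w)) has_field_derivative l (\<lambda>t. of_real (2 * pi * t) * gauss_kernel w t)) (at w)" for w
  proof -
    define D where "D = (\<lambda>t. of_real (2 * pi * t) * gauss_kernel w t)"
    \<comment> \<open>A majorant, up to \<open>h^2\<close>, of the second-order Taylor remainder for
      \<open>|h| \<le> 1\<close>; the factor \<open>exp (2 * pi * \<bar>t\<bar>)\<close> bounds the
      exponential on the segment between the two arguments.\<close>
    define Q where "Q = (\<lambda>t. of_real ((2 * pi * t)\<^sup>2 * exp (2 * pi * \<bar>t\<bar>)) * gauss_kernel w t)"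
    have [measurable]: "gauss_kernel w \<in> borel_measurable borel" for w using gauss_kernel_measurable[of w] by simp
    have D: "D \<in> L2_space"
    proof (rule L2_spaceI_gauss_kernel)
      show "cmod (D t) \<le> 1 * exp (2 * pi * \<bar>t\<bar>) * cmod (gauss_kernel w t)" for t
      proof -
        have "cmod (of_real (2 * pi * t)) \<le> exp (2 * pi * \<bar>t\<bar>)"
        proof -
          have "2 * pi * \<bar>t\<bar> \<le> exp (2 * pi * \<bar>t\<bar>)"
            using exp_ge_add_one_self[of "2 * pi * \<bar>t\<bar>"] by linarith
          thus ?thesis by (simp only: norm_of_real abs_mult) simp
        qed
        thus ?thesis unfolding D_def norm_mult by (simp add: mult_right_mono)
      qed
    qed (simp add: D_def)
    have Q: "Q \<in> L2_space"
    proof (rule L2_spaceI_gauss_kernel)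
      show "cmod (Q t) \<le> 2 * exp (4 * pi * \<bar>t\<bar>) * cmod (gauss_kernel w t)" for t
      proof -
        have "(2 * pi * \<bar>t\<bar>)\<^sup>2 / 2 \<le> exp (2 * pi * \<bar>t\<bar>)"
        proof -
          have "0 \<le> 2 * pi * \<bar>t\<bar>" by simp
          thus ?thesis using exp_lower_Taylor_quadratic[of "2 * pi * \<bar>t\<bar>"] by linarith
        qed
        hence "(2 * pi * t)\<^sup>2 * exp (2 * pi * \<bar>t\<bar>) \<le> (2 * exp (2 * pi * \<bar>t\<bar>)) * exp (2 * pi * \<bar>t\<bar>)"
          by (intro mult_right_mono) (auto simp: power_mult_distrib)
        also have "\<dots> = 2 * exp (4 * pi * \<bar>t\<bar>)" by (simp add: mult_exp_exp)
        finally have "cmod (of_real ((2 * pi * t)\<^sup>2 * exp (2 * pi * \<bar>t\<bar>))) \<le> 2 * exp (4 * pi * \<bar>t\<bar>)"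
          by (simp only: norm_of_real) simp
        thus ?thesis unfolding Q_def norm_mult by (simp add: mult_right_mono)
      qed
    qed (simp add: Q_def)
    have E: "gauss_kernel w \<in> L2_space" for w by (rule gauss_kernel_L2)
    have quad: "cmod (l (gauss_kernel (w + h)) - l (gauss_kernel w) - h * l D) * d \<le> (cmod h)\<^sup>2 * L2_seminorm Q" if h: "cmod h \<le> 1" for h
    proof -
      define R where "R = (\<lambda>t. gauss_kernel (w + h) t + (- 1) * gauss_kernel w t + (- h) * D t)"
      have R: "R \<in> L2_space" unfolding R_def using E D by (intro L2_space_add L2_space_scale)
      have "l R = l (\<lambda>t. gauss_kernel (w + h) t + (- 1) * gauss_kernel w t) + l (\<lambda>t. (- h) * D t)"
        unfolding R_def using E D by (intro add L2_space_add L2_space_scale)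
      also have "l (\<lambda>t. gauss_kernel (w + h) t + (- 1) * gauss_kernel w t) = l (gauss_kernel (w + h)) + l (\<lambda>t. (- 1) * gauss_kernel w t)"
        using E D by (intro add L2_space_scale)
      finally have "l R = l (gauss_kernel (w + h)) - l (gauss_kernel w) - h * l D"
        using scale[OF E, of "-1" w] scale[OF D, of "-h"] by simp
      moreover have "cmod (l R) * d \<le> L2_seminorm R" using bound[OF R] .
      moreover have "L2_seminorm R \<le> L2_seminorm (\<lambda>t. h\<^sup>2 * Q t)"
      proof (rule L2_seminorm_mono[OF R L2_space_scale[OF Q]])
        fix t
        define a where "a = of_real (2 * pi * t) * h"
        have Rt: "R t = gauss_kernel w t * (exp a - (\<Sum>k\<le>1. a ^ k / fact k))"
        proof -
          have "gauss_kernel (w + h) t = gauss_kernel w t * exp a"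
            by (simp add: gauss_kernel_def a_def mult_exp_exp algebra_simps)
          thus ?thesis unfolding R_def D_def a_def by (simp add: algebra_simps)
        qed
        have na: "cmod a = \<bar>2 * pi * t\<bar> * cmod h" by (simp add: a_def norm_mult abs_mult)
        have "\<bar>Re a\<bar> \<le> 2 * pi * \<bar>t\<bar> * 1"
        proof -
          have "\<bar>Re a\<bar> \<le> cmod a" by (rule abs_Re_le_cmod)
          also have "\<dots> = (2 * pi * \<bar>t\<bar>) * cmod h" by (simp add: na abs_mult)
          also have "\<dots> \<le> 2 * pi * \<bar>t\<bar> * 1" using h by (intro mult_left_mono) auto
          finally show ?thesis .
        qed
        hence "cmod (exp a - (\<Sum>k\<le>1. a ^ k / fact k)) \<le> exp (2 * pi * \<bar>t\<bar>) * (cmod a ^ Suc 1) / fact 1"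
          by (intro order_trans[OF Taylor_exp] divide_right_mono mult_right_mono) auto
        also have "\<dots> = (cmod h)\<^sup>2 * ((2 * pi * t)\<^sup>2 * exp (2 * pi * \<bar>t\<bar>))"
          by (simp add: na power_mult_distrib power2_eq_square[symmetric] numeral_2_eq_2[symmetric] del: power_Suc)
        finally have "cmod (R t) \<le> cmod (gauss_kernel w t) * ((cmod h)\<^sup>2 * ((2 * pi * t)\<^sup>2 * exp (2 * pi * \<bar>t\<bar>)))"
          unfolding Rt norm_mult by (intro mult_left_mono) auto
        also have "\<dots> = cmod (h\<^sup>2 * Q t)" unfolding Q_def by (simp add: norm_mult norm_power abs_mult power_mult_distrib mult_ac)
        finally show "cmod (R t) \<le> cmod (h\<^sup>2 * Q t)" .
      qed
      ultimately show ?thesis by (simp add: L2_seminorm_scale norm_power)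
    qed
    define K where "K = L2_seminorm Q / d"
    have "((\<lambda>h. (l (gauss_kernel (w + h)) - l (gauss_kernel w)) / h - l D) \<longlongrightarrow> 0) (at 0)"
    proof (rule Lim_null_comparison)
      have "((\<lambda>h. cmod h * K) \<longlongrightarrow> cmod 0 * K) (at (0::complex))" by (intro tendsto_intros)
      thus "((\<lambda>h. cmod h * K) \<longlongrightarrow> 0) (at (0::complex))" by simp
      have "cmod ((l (gauss_kernel (w + h)) - l (gauss_kernel w)) / h - l D) \<le> cmod h * K" if "dist h 0 < 1" "h \<noteq> 0" for h
      proof -
        have "(l (gauss_kernel (w + h)) - l (gauss_kernel w)) / h - l D = (l (gauss_kernel (w + h)) - l (gauss_kernel w) - h * l D) / h"
          using that by (simp add: field_simps)
        moreover have "cmod (l (gauss_kernel (w + h)) - l (gauss_kernel w) - h * l D) \<le> (cmod h)\<^sup>2 * K"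
          using quad[of h] that d unfolding K_def by (simp add: field_simps)
        ultimately show ?thesis using that by (simp add: norm_divide field_simps power2_eq_square)
      qed
      thus "eventually (\<lambda>h. cmod ((l (gauss_kernel (w + h)) - l (gauss_kernel w)) / h - l D) \<le> cmod h * K) (at 0)"
        unfolding eventually_at by (intro exI[of _ 1]) auto
    qed
    thus ?thesis unfolding DERIV_def D_def by (simp add: LIM_zero_iff)
  qed
  thus ?thesis by (auto simp: holomorphic_on_open)
qed

text \<open>\<open>F\<close> is the coefficient functional of the vector at \<open>p\<close>,
  applied to the normalized Bargmann kernels. The normalizing factor turns the kernel bound
  \<open>exp (pi * (Re w)^2)\<close> into the rotation-invariant
  \<open>exp (pi/2 * |w|^2)\<close>.\<close>

lemma interpolating_function:
  assumes compl: "L2_complete (gabor (\<lambda>t. complex_of_real (exp (- pi * t\<^sup>2)))) A"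
    and minim: "L2_minimal (gabor (\<lambda>t. complex_of_real (exp (- pi * t\<^sup>2)))) A"
    and p: "p \<in> A"
  obtains F C where "F holomorphic_on UNIV" "\<And>z. cmod (F z) \<le> C * exp (pi/2 * (cmod z)\<^sup>2)"
     "F (to_complex p) \<noteq> 0" "\<And>q. q \<in> A \<Longrightarrow> q \<noteq> p \<Longrightarrow> F (to_complex q) = 0"
proof -
  let ?\<phi> = "gabor (\<lambda>t. complex_of_real (exp (- pi * t\<^sup>2)))"
  have \<phi>L: "?\<phi> q \<in> L2_space" for q unfolding gabor_eq_gauss_kernel by (intro L2_space_scale gauss_kernel_L2)
  have ins: "insert (?\<phi> p) (?\<phi> ` (A - {p})) = ?\<phi> ` A" using p by auto
  obtain l d where l: "d > 0"
    "\<And>f g. f \<in> L2_space \<Longrightarrow> g \<in> L2_space \<Longrightarrow> l (\<lambda>t. f t + g t) = l f + l g"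
    "\<And>c f. f \<in> L2_space \<Longrightarrow> l (\<lambda>t. c * f t) = c * l f"
    "\<And>f. f \<in> L2_space \<Longrightarrow> cmod (l f) * d \<le> L2_seminorm f"
    "l (?\<phi> p) = 1" "\<And>f. f \<in> ?\<phi> ` (A - {p}) \<Longrightarrow> l f = 0"
    by (rule coefficient_functional_exists[of "?\<phi> ` (A - {p})" "?\<phi> p"])
      (use compl minim p \<phi>L ins in \<open>auto simp: L2_complete_def L2_minimal_def\<close>)
  define F where "F w = l (gauss_kernel w) * exp (- of_real pi * w\<^sup>2 / 2)" for w
  have lphi: "l (?\<phi> q) = of_real (exp (- pi * (fst q)\<^sup>2)) * l (gauss_kernel (to_complex q))" for q
    unfolding gabor_eq_gauss_kernel by (rule l(3)[OF gauss_kernel_L2])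
  show ?thesis
  proof (rule that[of F "1/d"])
    have "(\<lambda>w. l (gauss_kernel w)) holomorphic_on UNIV"
      using functional_gauss_kernel_holomorphic[of l d] l by blast
    thus "F holomorphic_on UNIV" unfolding F_def by (intro holomorphic_intros) auto
    show "cmod (F z) \<le> 1/d * exp (pi/2 * (cmod z)\<^sup>2)" for z
    proof -
      have "cmod (l (gauss_kernel z)) * d \<le> exp (pi * (Re z)\<^sup>2)"
        using l(4)[OF gauss_kernel_L2, of z] L2_seminorm_gauss_kernel[of z] by linarith
      hence "cmod (l (gauss_kernel z)) \<le> exp (pi * (Re z)\<^sup>2) / d" using l(1) by (simp add: field_simps)
      hence "cmod (F z) \<le> exp (pi * (Re z)\<^sup>2) / d * exp (Re (- of_real pi * z\<^sup>2 / 2))"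
        unfolding F_def norm_mult norm_exp_eq_Re by (intro mult_right_mono) auto
      also have "\<dots> = 1/d * exp (pi * (Re z)\<^sup>2 + Re (- of_real pi * z\<^sup>2 / 2))" by (simp only: mult_exp_exp times_divide_eq_left mult_1)
      also have "pi * (Re z)\<^sup>2 + Re (- of_real pi * z\<^sup>2 / 2) = pi/2 * (cmod z)\<^sup>2"
        unfolding cmod_power2 by (simp add: power2_eq_square field_simps)
      finally show ?thesis .
    qed
    show "F (to_complex p) \<noteq> 0" using l(5) lphi[of p] unfolding F_def by auto
    show "F (to_complex q) = 0" if "q \<in> A" "q \<noteq> p" for q
    proof -
      have "l (?\<phi> q) = 0" using that by (intro l(6)) auto
      thus ?thesis unfolding lphi F_def by simp
    qed
  qed
qed

lemma power_le_exp_square: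
  fixes c :: real
  assumes c: "c > 0"
  obtains K where "\<And>x. x \<ge> 0 \<Longrightarrow> (1 + x)^n \<le> K * exp (c * x\<^sup>2)"
proof (rule that[of "fact n * exp (1 + 1/(4*c))"])
  fix x :: real assume x: "x \<ge> 0"
  have s: "(\<lambda>k. (1 + x)^k /\<^sub>R fact k) sums exp (1 + x)" by (rule exp_converges)
  have "(\<Sum>k\<in>{n}. (1 + x)^k /\<^sub>R fact k) \<le> (\<Sum>k. (1 + x)^k /\<^sub>R fact k)"
    using s x by (intro sum_le_suminf) (auto simp: sums_iff)
  hence "(1 + x)^n \<le> fact n * exp (1 + x)" using s by (simp add: sums_iff field_simps)
  also have "exp (1 + x) \<le> exp (1 + 1/(4*c) + c * x\<^sup>2)"
  proof -
    have "0 \<le> (2 * c * x - 1)\<^sup>2 / (4 * c)" using c by simp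
    also have "\<dots> = c * x\<^sup>2 - x + 1/(4*c)" using c by (simp add: power2_eq_square field_simps)
    finally show ?thesis by simp
  qed
  finally show "(1 + x)^n \<le> fact n * exp (1 + 1/(4*c)) * exp (c * x\<^sup>2)" by (simp add: exp_add mult_ac)
qed

text \<open>A function vanishing on all of \<open>\<Lambda>\<close> with decay \<open>(1 + |z|)\<^sup>-\<^sup>3\<close> relative to the extremal growth is zero,
  so an interpolating function has at most three zeros that are not forced; dividing these out
  leaves exactly the required simple zeros.\<close>

lemma generating_function:
  assumes compl: "L2_complete (gabor (\<lambda>t. complex_of_real (exp (- pi * t\<^sup>2)))) A"
    and minim: "L2_minimal (gabor (\<lambda>t. complex_of_real (exp (- pi * t\<^sup>2)))) A"
  obtains f C p where "p \<in> to_complex ` A" "f holomorphic_on UNIV" "\<And>z. cmod (f z) \<le> C * exp (pi/2 * (cmod z)\<^sup>2)"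
    "\<And>z. f z = 0 \<longleftrightarrow> z \<in> to_complex ` A - {p}" "\<And>z. z \<in> to_complex ` A - {p} \<Longrightarrow> deriv f z \<noteq> 0"
    "0 \<notin> to_complex ` A - {p}"
proof -
  define \<Lambda> where "\<Lambda> = to_complex ` A"
  have inj: "inj to_complex" by (auto simp: inj_def to_complex_def)
  obtain K where exq: "\<And>x::real. x \<ge> 0 \<Longrightarrow> (1 + x)^3 \<le> K * exp (pi/2 * x\<^sup>2)"
    using power_le_exp_square[of "pi/2" 3] by auto
  \<comment> \<open>For an empty system the constant function 1 would violate uniqueness.\<close>
  have "A \<noteq> {}"
  proof
    assume "A = {}"
    have "(1::complex) = 0"
    proof (rule complete_uniqueness[OF compl, where F = "\<lambda>_. 1"])
      show "cmod (1::complex) \<le> K * exp (pi/2 * (cmod z)\<^sup>2) / (1 + cmod z)^3" for z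
        using exq[of "cmod z"] by (simp add: le_divide_eq add_pos_nonneg)
    qed (use \<open>A = {}\<close> in auto)
    thus False by simp
  qed
  hence "\<Lambda> \<noteq> {}" by (simp add: \<Lambda>_def)
  then obtain p0 where "p0 \<in> \<Lambda>" by blast
  \<comment> \<open>The origin, if present, is the point left out. Hence 0 is never among the zeros,
    and the logarithm of the function and the inverse powers of its zeros make sense.\<close>
  define p where "p = (if 0 \<in> \<Lambda> then 0 else p0)"
  have p: "p \<in> \<Lambda>" "0 \<in> \<Lambda> \<Longrightarrow> p = 0" using \<open>p0 \<in> \<Lambda>\<close> by (auto simp: p_def)
  then obtain p' where p': "p' \<in> A" "p = to_complex p'" by (auto simp: \<Lambda>_def)
  define Z where "Z = \<Lambda> - {p}"
  \<comment> \<open>\<open>P j\<close> asks for a nonzero function vanishing on \<open>Z\<close>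
    with \<open>j\<close> additional orders of decay. Restoring the zero at \<open>p\<close> costs
    one order, so \<open>P 4\<close> would contradict uniqueness at decay 3; a function for the last
    possible \<open>j\<close> has no zero to spare.\<close>
  define P where "P j \<longleftrightarrow> (\<exists>F C. F holomorphic_on UNIV \<and> (\<forall>z. cmod (F z) \<le> C * exp (pi/2 * (cmod z)\<^sup>2) / (1 + cmod z)^j) \<and>
      (\<forall>z\<in>Z. F z = 0) \<and> (\<exists>z. F z \<noteq> 0))" for j :: nat
  have "P 0"
  proof -
    obtain F C where F: "F holomorphic_on UNIV" "\<And>z. cmod (F z) \<le> C * exp (pi/2 * (cmod z)\<^sup>2)"
     "F (to_complex p') \<noteq> 0" "\<And>q. q \<in> A \<Longrightarrow> q \<noteq> p' \<Longrightarrow> F (to_complex q) = 0"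
      using interpolating_function[OF compl minim p'(1)] by blast
    have "\<forall>z\<in>Z. F z = 0" using F(4) p'(2) inj by (auto simp: Z_def \<Lambda>_def inj_def)
    thus ?thesis unfolding P_def using F by (intro exI[of _ F] exI[of _ C]) auto
  qed
  have one: "1 + cmod z > 0" for z :: complex by (simp add: add_pos_nonneg)
  have "\<not> P 4"
  proof
    assume "P 4"
    then obtain F C where F: "F holomorphic_on UNIV" "\<And>z. cmod (F z) \<le> C * exp (pi/2 * (cmod z)\<^sup>2) / (1 + cmod z)^4"
      "\<And>z. z \<in> Z \<Longrightarrow> F z = 0" "\<exists>z. F z \<noteq> 0" unfolding P_def by blast
    have "(z - p) * F z = 0" for z
    proof (rule complete_uniqueness[OF compl, where F = "\<lambda>z. (z - p) * F z"])
      show "(\<lambda>z. (z - p) * F z) holomorphic_on UNIV" using F(1) by (intro holomorphic_intros)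
      show "cmod ((z - p) * F z) \<le> ((1 + cmod p) * C) * exp (pi/2 * (cmod z)\<^sup>2) / (1 + cmod z)^3" for z
      proof -
        have "cmod (z - p) \<le> cmod z + cmod p" by (rule norm_triangle_ineq4)
        also have "\<dots> \<le> (1 + cmod p) * (1 + cmod z)" by (simp add: algebra_simps)
        finally have "cmod ((z - p) * F z) \<le> ((1 + cmod p) * (1 + cmod z)) * (C * exp (pi/2 * (cmod z)\<^sup>2) / (1 + cmod z)^4)"
          unfolding norm_mult using F(2)[of z] by (intro mult_mono) auto
        also have "\<dots> = ((1 + cmod p) * C) * exp (pi/2 * (cmod z)\<^sup>2) / (1 + cmod z)^3"
        proof -
          have "(1 + cmod z)^4 = (1 + cmod z) * (1 + cmod z)^3" by (simp add: numeral_eq_Suc)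
          thus ?thesis using one[of z] by simp
        qed
        finally show ?thesis .
      qed
      show "(to_complex q - p) * F (to_complex q) = 0" if "q \<in> A" for q
        using F(3)[of "to_complex q"] that by (auto simp: Z_def \<Lambda>_def)
    qed
    hence z0: "F z = 0" if "z \<noteq> p" for z using that by auto
    have "isCont F p" using holomorphic_on_imp_continuous_on[OF F(1)] by (simp add: continuous_on_eq_continuous_at)
    hence "(F \<longlongrightarrow> F p) (at p)" by (rule isContD)
    moreover have "(F \<longlongrightarrow> 0) (at p)"
      by (rule tendsto_eventually) (use z0 in \<open>auto simp: eventually_at_filter\<close>)
    ultimately have "F p = 0" using tendsto_unique[of "at p" F] by auto
    hence "F z = 0" for z using z0[of z] by (cases "z = p") auto
    thus False using F(4) by blast
  qed
  have "\<exists>j. P j \<and> \<not> P (Suc j)"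
  proof (rule ccontr)
    assume "\<nexists>j. P j \<and> \<not> P (Suc j)"
    hence "P j" for j using \<open>P 0\<close> by (induction j) auto
    thus False using \<open>\<not> P 4\<close> by blast
  qed
  then obtain j where j: "P j" "\<not> P (Suc j)" by blast
  obtain F C where F: "F holomorphic_on UNIV" "\<And>z. cmod (F z) \<le> C * exp (pi/2 * (cmod z)\<^sup>2) / (1 + cmod z)^j"
      "\<And>z. z \<in> Z \<Longrightarrow> F z = 0" "\<exists>z. F z \<noteq> 0" using j(1) unfolding P_def by blast
  have C0: "C \<ge> 0" using F(2)[of 0] norm_ge_zero[of "F 0"] by (simp del: norm_ge_zero)
  \<comment> \<open>A zero outside \<open>Z\<close> and a multiple zero are treated alike: dividing
    by \<open>z - a\<close> preserves the vanishing on \<open>Z\<close> and gains one order of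
    decay, against the choice of \<open>j\<close>.\<close>
  have key: "a \<in> Z \<and> deriv F a \<noteq> 0" if a: "F a = 0" for a
  proof (rule ccontr)
    assume n: "\<not> (a \<in> Z \<and> deriv F a \<noteq> 0)"
    define h where "h = (\<lambda>z. if z = a then deriv F a else (F z - F a) / (z - a))"
    have h: "h holomorphic_on UNIV" unfolding h_def using F(1) by (intro pole_lemma) auto
    have Fh: "F z = (z - a) * h z" for z by (auto simp: h_def a)
    have ha: "h a = deriv F a" by (simp add: h_def)
    have hZ: "h z = 0" if "z \<in> Z" for z
    proof (cases "z = a")
      case True
      thus ?thesis using n that ha by simp
    next
      case False
      have "(z - a) * h z = 0" using F(3)[OF that] by (simp only: Fh[symmetric])
      thus ?thesis using False by simp
    qed
    have "continuous_on (cball a 1) h"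
      using holomorphic_on_imp_continuous_on[OF h] by (rule continuous_on_subset) simp
    hence "bounded (h ` cball a 1)" by (intro compact_imp_bounded compact_continuous_image) auto
    then obtain K where K: "\<And>z. z \<in> cball a 1 \<Longrightarrow> cmod (h z) \<le> K" unfolding bounded_iff by blast
    have K0: "K \<ge> 0" using K[of a] norm_ge_zero[of "h a"] by (simp del: norm_ge_zero)
    \<comment> \<open>The first summand serves \<open>|z - a| > 1\<close>, where
      \<open>1 + |z| \<le> (2 + |a|) * |z - a|\<close>; the second serves the disc around
      \<open>a\<close>, where \<open>1 + |z| \<le> 2 + |a|\<close>.\<close>
    define D where "D = (2 + cmod a) * C + K * (2 + cmod a)^(Suc j)"
    have "cmod (h z) \<le> D * exp (pi/2 * (cmod z)\<^sup>2) / (1 + cmod z)^(Suc j)" for z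
    proof (cases "cmod (z - a) \<le> 1")
      case True
      have "cmod z \<le> cmod a + 1" using True norm_triangle_ineq2[of z a] by linarith
      hence "(1 + cmod z)^(Suc j) \<le> (2 + cmod a)^(Suc j)" by (intro power_mono) auto
      hence "K * (1 + cmod z)^(Suc j) \<le> K * (2 + cmod a)^(Suc j)" using K0 by (intro mult_left_mono)
      also have "\<dots> \<le> D * 1" using C0 by (simp add: D_def)
      also have "D * 1 \<le> D * exp (pi/2 * (cmod z)\<^sup>2)"
      proof (intro mult_left_mono)
        show "D \<ge> 0" using C0 K0 by (simp add: D_def)
      qed auto
      finally have "K \<le> D * exp (pi/2 * (cmod z)\<^sup>2) / (1 + cmod z)^(Suc j)" using one[of z] by (simp add: le_divide_eq)
      thus ?thesis using K[of z] True by (simp add: dist_norm norm_minus_commute)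
    next
      case False
      hence d: "cmod (z - a) > 1" by simp
      have "cmod z \<le> cmod a + cmod (z - a)" using norm_triangle_ineq2[of z a] by linarith
      moreover have "(1 + cmod a) * 1 \<le> (1 + cmod a) * cmod (z - a)" using d by (intro mult_left_mono) auto
      ultimately have le: "1 + cmod z \<le> (2 + cmod a) * cmod (z - a)" by (simp add: algebra_simps)
      have "cmod (h z) * cmod (z - a) \<le> C * exp (pi/2 * (cmod z)\<^sup>2) / (1 + cmod z)^j"
        using F(2)[of z] unfolding Fh[of z] norm_mult by (simp add: mult.commute)
      hence "(cmod (h z) * cmod (z - a)) * (2 + cmod a) \<le> (C * exp (pi/2 * (cmod z)\<^sup>2) / (1 + cmod z)^j) * (2 + cmod a)"
        by (intro mult_right_mono) auto
      moreover have "cmod (h z) * (1 + cmod z) \<le> cmod (h z) * ((2 + cmod a) * cmod (z - a))" using le by (intro mult_left_mono) auto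
      ultimately have "cmod (h z) * (1 + cmod z) \<le> ((2 + cmod a) * C) * exp (pi/2 * (cmod z)\<^sup>2) / (1 + cmod z)^j" by (simp add: mult_ac)
      also have "\<dots> \<le> D * exp (pi/2 * (cmod z)\<^sup>2) / (1 + cmod z)^j"
        using K0 one[of z] by (intro divide_right_mono mult_right_mono) (auto simp: D_def)
      finally have "cmod (h z) \<le> D * exp (pi/2 * (cmod z)\<^sup>2) / (1 + cmod z)^j / (1 + cmod z)"
        using one[of z] by (simp only: pos_le_divide_eq)
      thus ?thesis by (simp add: mult.commute)
    qed
    note hD = this
    have hnz: "\<exists>z. h z \<noteq> 0"
    proof -
      obtain z where "F z \<noteq> 0" using F(4) by blast
      hence "(z - a) * h z \<noteq> 0" by (simp only: Fh[symmetric] not_False_eq_True)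
      thus ?thesis by auto
    qed
    have "P (Suc j)" unfolding P_def
      by (intro exI[of _ h] exI[of _ D] conjI allI ballI) (rule h hD hZ hnz | assumption)+
    thus False using j(2) by simp
  qed
  show ?thesis
  proof (rule that[of p F C])
    show "cmod (F z) \<le> C * exp (pi/2 * (cmod z)\<^sup>2)" for z
    proof -
      have "C * exp (pi/2 * (cmod z)\<^sup>2) / (1 + cmod z)^j \<le> C * exp (pi/2 * (cmod z)\<^sup>2) / 1"
        using C0 zero_less_power[OF one[of z], of j] by (intro divide_left_mono) (auto simp: one_le_power)
      thus ?thesis using F(2)[of z] by simp
    qed
    have "F z = 0 \<longleftrightarrow> z \<in> Z" for z using key[of z] F(3)[of z] by blast
    thus "F z = 0 \<longleftrightarrow> z \<in> to_complex ` A - {p}" for z unfolding Z_def \<Lambda>_def .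
    show "deriv F z \<noteq> 0" if "z \<in> to_complex ` A - {p}" for z
      using key[of z] F(3)[of z] that unfolding Z_def \<Lambda>_def by blast
    show "p \<in> to_complex ` A" "0 \<notin> to_complex ` A - {p}" using p by (auto simp: \<Lambda>_def)
  qed fact
qed

section \<open>A multiplier for a sector\<close>

text \<open>A complementary error function in disguise: the value is
  \<open>exp (pi * w^2 / 2) * erfc (- sqrt (pi/2) * w) / (2 * sqrt 2)\<close>. It is large only in
  the sector \<open>|arg w| < pi/4\<close>.\<close>

definition half_gauss :: "complex \<Rightarrow> complex" where
  "half_gauss w = (LINT t|lborel. of_real (indicator {0..} t * exp (- pi * t\<^sup>2)) * gauss_kernel w t)"

lemma half_gauss_integrand:
  "of_real (indicator {0..} t * exp (- pi * t\<^sup>2)) * gauss_kernel w t =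
     of_real (indicator {0..} t) * exp (- of_real (2 * pi * t\<^sup>2) + 2 * of_real pi * of_real t * w)"
proof -
  have "complex_of_real (exp (- pi * t\<^sup>2)) = exp (of_real (- pi * t\<^sup>2))" by (simp only: exp_of_real)
  thus ?thesis by (simp add: gauss_kernel_def mult_exp_exp algebra_simps)
qed

text \<open>The free parameter \<open>s\<close> takes the place of Cauchy--Schwarz: with
  \<open>s\<close> close to the inverse of the seminorm, the second part says that pairing with the
  half-Gaussian is a bounded functional. \<open>half_gauss_holomorphic\<close> uses it in this
  way.\<close>

lemma gaussian_weight_integrable:
  assumes "f \<in> L2_space"
  shows "integrable lborel (\<lambda>t. of_real (indicator {0..} t * exp (- pi * t\<^sup>2)) * f t)"
    and "s > 0 \<Longrightarrow> cmod (LINT t|lborel. of_real (indicator {0..} t * exp (- pi * t\<^sup>2)) * f t) \<le> (s * (L2_seminorm f)\<^sup>2 + 1 / s) / 2"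
proof -
  have [measurable]: "f \<in> borel_measurable borel" and f2: "integrable lborel (\<lambda>t. (cmod (f t))\<^sup>2)" using assms by (auto simp: L2_space_def)
  have g2: "has_bochner_integral lborel (\<lambda>t. exp (- (2 * pi * t\<^sup>2))) (1 / sqrt 2)"
  proof -
    have "has_bochner_integral lborel (\<lambda>t. complex_of_real (exp (- (2 * pi * t\<^sup>2)))) (of_real (1 / sqrt 2))"
      using gauss_integral[of 0] by (simp flip: exp_of_real)
    thus ?thesis unfolding has_bochner_integral_iff integral_complex_of_real of_real_eq_iff complex_of_real_integrable_eq .
  qed
  have pt: "cmod (of_real (indicator {0..} t * exp (- pi * t\<^sup>2)) * f t) \<le> (s * (cmod (f t))\<^sup>2 + exp (- (2 * pi * t\<^sup>2)) / s) / 2" if s: "s > 0" for s t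
  proof -
    define a b where "a = exp (- pi * t\<^sup>2)" and "b = cmod (f t)"
    have "0 \<le> (s * b - a)\<^sup>2 / s" using s by simp
    also have "\<dots> = s * b\<^sup>2 + a\<^sup>2 / s - 2 * (a * b)" using s by (simp add: power2_eq_square field_simps)
    finally have "a * b \<le> (s * b\<^sup>2 + a\<^sup>2 / s) / 2" by simp
    moreover have "a\<^sup>2 = exp (- (2 * pi * t\<^sup>2))" unfolding a_def power2_eq_square[of "exp _"] mult_exp_exp by simp
    moreover have "cmod (of_real (indicator {0..} t * exp (- pi * t\<^sup>2)) * f t) \<le> a * b"
      unfolding norm_mult norm_of_real a_def b_def by (intro mult_right_mono) (auto simp: indicator_def)
    ultimately show ?thesis unfolding b_def by simp
  qed
  show int: "integrable lborel (\<lambda>t. of_real (indicator {0..} t * exp (- pi * t\<^sup>2)) * f t)"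
  proof (rule Bochner_Integration.integrable_bound)
    show "integrable lborel (\<lambda>t. (1 * (cmod (f t))\<^sup>2 + exp (- (2 * pi * t\<^sup>2)) / 1) / 2)"
      using f2 g2 by (auto simp: has_bochner_integral_iff)
    show "AE t in lborel. cmod (of_real (indicator {0..} t * exp (- pi * t\<^sup>2)) * f t) \<le> norm ((1 * (cmod (f t))\<^sup>2 + exp (- (2 * pi * t\<^sup>2)) / 1) / 2)"
      using pt[of 1] by (intro AE_I2 order_trans[OF pt[of 1]]) auto
  qed measurable
  show "cmod (LINT t|lborel. of_real (indicator {0..} t * exp (- pi * t\<^sup>2)) * f t) \<le> (s * (L2_seminorm f)\<^sup>2 + 1 / s) / 2" if s: "s > 0"
  proof -
    have "cmod (LINT t|lborel. of_real (indicator {0..} t * exp (- pi * t\<^sup>2)) * f t) \<le> (LINT t|lborel. cmod (of_real (indicator {0..} t * exp (- pi * t\<^sup>2)) * f t))"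
      by (rule integral_norm_bound)
    also have "\<dots> \<le> (LINT t|lborel. (s * (cmod (f t))\<^sup>2 + exp (- (2 * pi * t\<^sup>2)) / s) / 2)"
      using f2 g2 int pt[OF s] by (intro integral_mono) (auto simp: has_bochner_integral_iff)
    also have "\<dots> = (s * (L2_seminorm f)\<^sup>2 + (1 / sqrt 2) / s) / 2"
      unfolding L2_seminorm_sq using f2 g2 by (simp add: has_bochner_integral_iff)
    also have "\<dots> \<le> (s * (L2_seminorm f)\<^sup>2 + 1 / s) / 2"
      using s by (intro divide_right_mono add_mono) auto
    finally show ?thesis .
  qed
qed

lemma half_gauss_holomorphic: "half_gauss holomorphic_on UNIV"
proof -
  define l where "l f = (LINT t|lborel. of_real (indicator {0..} t * exp (- pi * t\<^sup>2)) * f t)" for f :: "real \<Rightarrow> complex"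
  have "(\<lambda>w. l (gauss_kernel w)) holomorphic_on UNIV"
  proof (rule functional_gauss_kernel_holomorphic[where d = 1])
    show "l (\<lambda>t. f t + g t) = l f + l g" if "f \<in> L2_space" "g \<in> L2_space" for f g
      unfolding l_def distrib_left using that by (intro Bochner_Integration.integral_add gaussian_weight_integrable)
    show "l (\<lambda>t. c * f t) = c * l f" if "f \<in> L2_space" for c f
      unfolding l_def mult.left_commute[of _ c] using that gaussian_weight_integrable by (intro Bochner_Integration.integral_mult_right) auto
    show "cmod (l f) * 1 \<le> L2_seminorm f" if f: "f \<in> L2_space" for f
    proof -
      define N where "N = L2_seminorm f"
      have N: "N \<ge> 0" unfolding N_def by (rule L2_seminorm_nonneg)
      have "cmod (l f) \<le> N + e" if e: "e > 0" for e
      proof -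
        have "cmod (l f) \<le> (1 / (N + e) * N\<^sup>2 + 1 / (1 / (N + e))) / 2"
          unfolding l_def N_def[symmetric] using gaussian_weight_integrable(2)[OF f, of "1 / (N + e)"] N e by (simp add: N_def)
        also have "\<dots> \<le> ((N + e) + (N + e)) / 2"
        proof -
          have "N\<^sup>2 \<le> (N + e)\<^sup>2" using N e by (intro power_mono) auto
          hence "1 / (N + e) * N\<^sup>2 \<le> N + e" using N e by (simp add: field_simps power2_eq_square)
          moreover have "1 / (1 / (N + e)) = N + e" by simp
          ultimately show ?thesis by (intro divide_right_mono add_mono) auto
        qed
        finally show ?thesis by simp
      qed
      hence "cmod (l f) \<le> N" by (rule field_le_epsilon)
      thus ?thesis by (simp add: N_def)
    qed
  qed auto
  thus ?thesis unfolding l_def half_gauss_def[abs_def] .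
qed

lemma half_gauss_bochner:
  "has_bochner_integral lborel (\<lambda>t. of_real (indicator {0..} t) * exp (- of_real (2 * pi * t\<^sup>2) + 2 * of_real pi * of_real t * w)) (half_gauss w)"
  unfolding half_gauss_integrand[symmetric] half_gauss_def
  using gaussian_weight_integrable(1)[OF gauss_kernel_L2, of w] by (simp add: has_bochner_integral_iff)

text \<open>The two half-line integrals add up to the full Gaussian integral. This carries the decay
  from the left half-plane to the part of the right one where \<open>Re (w^2) < 0\<close>.\<close>

lemma half_gauss_reflect: "half_gauss w + half_gauss (- w) = of_real (1 / sqrt 2) * exp (of_real pi * w\<^sup>2 / 2)"
proof -
  let ?f = "\<lambda>w t::real. exp (- of_real (2 * pi * t\<^sup>2) + 2 * of_real pi * of_real t * w) :: complex"
  have "has_bochner_integral lborel (\<lambda>t. of_real (indicator {0..} (0 + (-1) * t)) * ?f (- w) (0 + (-1) * t)) (half_gauss (- w) /\<^sub>R \<bar>-1\<bar>)"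
    using lborel_has_bochner_integral_real_affine_iff[of "-1" "\<lambda>t. of_real (indicator {0..} t) * ?f (- w) t" _ 0] half_gauss_bochner[of "-w"] by simp
  hence "has_bochner_integral lborel (\<lambda>t. of_real (indicator {..0} t) * ?f w t) (half_gauss (- w))"
    by (simp add: indicator_def)
  hence "has_bochner_integral lborel (\<lambda>t. of_real (indicator {0..} t) * ?f w t + of_real (indicator {..0} t) * ?f w t) (half_gauss w + half_gauss (- w))"
    by (intro has_bochner_integral_add half_gauss_bochner)
  moreover have "AE t in lborel. of_real (indicator {0..} t) * ?f w t + of_real (indicator {..0} t) * ?f w t = ?f w t"
  proof (rule AE_mp[OF AE_lborel_singleton[of 0]], intro AE_I2 impI)
    fix t :: real assume "t \<noteq> 0"
    thus "of_real (indicator {0..} t) * ?f w t + of_real (indicator {..0} t) * ?f w t = ?f w t" by (auto simp: indicator_def)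
  qed
  ultimately have "has_bochner_integral lborel (?f w) (half_gauss w + half_gauss (- w))"
    using has_bochner_integral_cong_AE[of "\<lambda>t. of_real (indicator {0..} t) * ?f w t + of_real (indicator {..0} t) * ?f w t" lborel "?f w"]
      borel_measurable_has_bochner_integral gauss_integral[of w] by blast
  thus ?thesis using has_bochner_integral_eq[OF _ gauss_integral[of w]] by blast
qed

lemma half_gauss_bound:
  assumes h: "has_bochner_integral lborel h I"
    and le: "\<And>t. indicator {0..} t * exp (- (2 * pi * t\<^sup>2) + 2 * pi * t * Re w) \<le> h t"
  shows "cmod (half_gauss w) \<le> I"
proof -
  let ?f = "\<lambda>t. of_real (indicator {0..} t) * exp (- of_real (2 * pi * t\<^sup>2) + 2 * of_real pi * of_real t * w)"
  have int: "integrable lborel ?f" "half_gauss w = (LINT t|lborel. ?f t)"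
    using half_gauss_bochner[of w] by (auto simp: has_bochner_integral_iff)
  have n: "cmod (?f t) = indicator {0..} t * exp (- (2 * pi * t\<^sup>2) + 2 * pi * t * Re w)" for t :: real
    unfolding norm_mult norm_of_real norm_exp_eq_Re by (simp add: indicator_def)
  have "cmod (half_gauss w) \<le> (LINT t|lborel. cmod (?f t))" unfolding int(2) by (rule integral_norm_bound)
  also have "\<dots> \<le> (LINT t|lborel. h t)"
    using h int(1) le unfolding n[symmetric] by (intro integral_mono) (auto simp: has_bochner_integral_iff)
  also have "\<dots> = I" using h by (simp add: has_bochner_integral_iff)
  finally show ?thesis .
qed

lemma half_gauss_le: "cmod (half_gauss w) \<le> exp (pi/2 * (cmod w)\<^sup>2)"
proof -
  define x where "x = Re w"
  have "has_bochner_integral lborel (\<lambda>t. complex_of_real (exp (- (2 * pi * t\<^sup>2) + 2 * pi * t * x))) (of_real (1 / sqrt 2 * exp (pi * x\<^sup>2 / 2)))"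
    using gauss_integral[of "of_real x"] by (simp flip: exp_of_real)
  hence "has_bochner_integral lborel (\<lambda>t. exp (- (2 * pi * t\<^sup>2) + 2 * pi * t * x)) (1 / sqrt 2 * exp (pi * x\<^sup>2 / 2))"
    unfolding has_bochner_integral_iff integral_complex_of_real of_real_eq_iff complex_of_real_integrable_eq .
  hence "cmod (half_gauss w) \<le> 1 / sqrt 2 * exp (pi * x\<^sup>2 / 2)"
    by (rule half_gauss_bound) (auto simp: indicator_def x_def)
  also have "\<dots> \<le> 1 * exp (pi * x\<^sup>2 / 2)" by (intro mult_right_mono) auto
  also have "\<dots> \<le> exp (pi/2 * (cmod w)\<^sup>2)"
    using abs_le_square_iff[of x "cmod w"] abs_Re_le_cmod[of w] by (simp add: x_def)
  finally show ?thesis .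
qed

text \<open>For \<open>Re w < 0\<close> the linear exponent alone makes the integral converge, and
  the Gaussian factor is estimated by 1.\<close>

lemma half_gauss_left_half_plane:
  assumes "Re w < 0" shows "cmod (half_gauss w) \<le> 1 / (2 * pi * (- Re w))"
proof -
  define a where "a = 2 * pi * (- Re w)"
  have a: "a > 0" using assms by (simp add: a_def mult_pos_neg)
  have "has_bochner_integral lborel (\<lambda>x. exp (- x) * indicator {0..} x :: real) 1"
    using has_bochner_integral_I0i_power_exp_m'[of 0] by simp
  hence "has_bochner_integral lborel (\<lambda>t. exp (- (0 + a * t)) * indicator {0..} (0 + a * t)) (1 /\<^sub>R \<bar>a\<bar>)"
    using lborel_has_bochner_integral_real_affine_iff[of a "\<lambda>x. exp (- x) * indicator {0..} x :: real" 1 0] a by simp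
  moreover have "1 /\<^sub>R \<bar>a\<bar> = 1 / a" using a by (simp add: field_simps)
  ultimately have "has_bochner_integral lborel (\<lambda>t. exp (- (0 + a * t)) * indicator {0..} (0 + a * t)) (1 / a)" by simp
  hence "cmod (half_gauss w) \<le> 1 / a"
  proof (rule half_gauss_bound)
    fix t :: real
    show "indicator {0..} t * exp (- (2 * pi * t\<^sup>2) + 2 * pi * t * Re w) \<le> exp (- (0 + a * t)) * indicator {0..} (0 + a * t)"
    proof (cases "t \<ge> 0")
      case True
      hence "0 + a * t \<ge> 0" using a by simp
      moreover have "- (2 * pi * t\<^sup>2) + 2 * pi * t * Re w \<le> - (0 + a * t)" by (simp add: a_def)
      ultimately show ?thesis using True by simp
    next
      case False
      thus ?thesis by simp
    qed
  qed
  thus ?thesis by (simp add: a_def)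
qed

lemma half_gauss_cnj: "half_gauss (cnj w) = cnj (half_gauss w)"
proof -
  have "half_gauss (cnj w) = (LINT t|lborel. cnj (of_real (indicator {0..} t) * exp (- of_real (2 * pi * t\<^sup>2) + 2 * of_real pi * of_real t * w)))"
    unfolding half_gauss_def half_gauss_integrand
    by (intro Bochner_Integration.integral_cong refl) (simp add: exp_cnj)
  also have "\<dots> = cnj (half_gauss w)" unfolding half_gauss_def half_gauss_integrand
    using has_bochner_integral_bounded_linear[OF bounded_linear_cnj half_gauss_bochner[of w]]
    unfolding half_gauss_def half_gauss_integrand by (simp add: has_bochner_integral_iff)
  finally show ?thesis .
qed

text \<open>In the upper half-plane three ranges of the argument are needed. To the left the
  exponential integral applies; between \<open>pi/4 + s\<close> and \<open>3 * pi/8\<close>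
  reflection applies, with \<open>exp (pi * w^2 / 2)\<close> small; near the imaginary axis both
  bounds degenerate, and Phragmen--Lindelof for \<open>w * half_gauss w\<close> fills a sector of
  opening \<open>pi/4\<close> from its sides. Conjugation gives the lower half-plane.\<close>

lemma half_gauss_sector_decay:
  assumes s: "0 < s" "s \<le> pi/8"
  obtains C where "\<And>r \<theta>. r \<ge> 0 \<Longrightarrow> pi/4 + s \<le> \<theta> \<Longrightarrow> \<theta> \<le> 2 * pi - (pi/4 + s) \<Longrightarrow> cmod (half_gauss (rcis r \<theta>)) * (1 + r) \<le> C"
proof -
  define \<kappa> where "\<kappa> = sin (pi/8)"
  have \<kappa>: "\<kappa> > 0" unfolding \<kappa>_def by (intro sin_gt_zero) auto
  define c where "c = pi/2 * sin (2 * s)"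
  have c: "c > 0" unfolding c_def using s by (intro mult_pos_pos sin_gt_zero) auto
  define C1 where "C1 = 1 / (2 * pi * \<kappa>) + 1 + 1 / c"
  have C1: "C1 \<ge> 1" "C1 \<ge> 1 / (2 * pi * \<kappa>)" using \<kappa> c by (auto simp: C1_def)
  have neg: "r * cmod (half_gauss w) \<le> 1 / (2 * pi * \<kappa>)" if "Re w \<le> - (r * \<kappa>)" "r \<ge> 0" for r w
  proof (cases "r = 0")
    case False
    hence r: "r > 0" using that by simp
    hence rk: "r * \<kappa> > 0" using \<kappa> by simp
    hence "Re w < 0" using that by linarith
    hence "cmod (half_gauss w) \<le> 1 / (2 * pi * (- Re w))" by (rule half_gauss_left_half_plane)
    also have "\<dots> \<le> 1 / (2 * pi * (r * \<kappa>))" using that rk r \<kappa> \<open>Re w < 0\<close> by (intro divide_left_mono mult_left_mono mult_pos_pos) auto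
    finally have "r * cmod (half_gauss w) \<le> r * (1 / (2 * pi * (r * \<kappa>)))" using r by (intro mult_left_mono) auto
    also have "\<dots> = 1 / (2 * pi * \<kappa>)" using r by simp
    finally show ?thesis .
  qed (use \<kappa> in simp)
  have right: "r * cmod (half_gauss (rcis r \<theta>)) \<le> C1" if r: "r \<ge> 0" and t: "pi/4 + s \<le> \<theta>" "\<theta> \<le> 3 * pi/8" for r \<theta>
  proof -
    define w where "w = rcis r \<theta>"
    have cos: "cos \<theta> \<ge> \<kappa>"
    proof -
      have "cos \<theta> \<ge> cos (pi/2 - pi/8)" using t s by (intro cos_monotone_0_pi_le) auto
      thus ?thesis unfolding \<kappa>_def cos_sin_eq by simp
    qed
    have "Re (- w) \<le> - (r * \<kappa>)" unfolding w_def using cos r by (simp add: mult_left_mono)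
    note A = neg[OF this r]
    have "cos (2 * \<theta>) \<le> cos (pi/2 + 2 * s)" using t s by (intro cos_monotone_0_pi_le) auto
    hence "cos (2 * \<theta>) \<le> - sin (2 * s)" by (simp add: cos_add)
    hence "pi/2 * r\<^sup>2 * cos (2 * \<theta>) \<le> pi/2 * r\<^sup>2 * - sin (2 * s)" by (intro mult_left_mono) auto
    moreover have "Re (of_real pi * w\<^sup>2 / 2) = pi/2 * r\<^sup>2 * cos (2 * \<theta>)"
      using Re_rcis_power[of 1 r \<theta> 2] unfolding w_def by simp
    ultimately have "Re (of_real pi * w\<^sup>2 / 2) \<le> - (c * r\<^sup>2)" by (simp add: c_def mult_ac)
    hence "cmod (exp (of_real pi * w\<^sup>2 / 2)) \<le> exp (- (c * r\<^sup>2))" unfolding norm_exp_eq_Re by simp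
    also have "\<dots> \<le> 1 / (1 + c * r\<^sup>2)"
    proof -
      have "1 + c * r\<^sup>2 \<le> exp (c * r\<^sup>2)" by (rule exp_ge_add_one_self)
      moreover have "1 + c * r\<^sup>2 > 0" using c by (simp add: add_pos_nonneg)
      ultimately show ?thesis unfolding exp_minus inverse_eq_divide by (intro divide_left_mono) auto
    qed
    finally have E: "r * cmod (exp (of_real pi * w\<^sup>2 / 2)) \<le> r * (1 / (1 + c * r\<^sup>2))" using r by (intro mult_left_mono) auto
    also have "\<dots> \<le> 1 + 1 / c"
    proof -
      have "0 \<le> (r - 1/2)\<^sup>2" by simp
      hence "r \<le> 1 + r\<^sup>2" by (simp add: power2_eq_square algebra_simps)
      also have "\<dots> \<le> (1 + 1/c) * (1 + c * r\<^sup>2)" using c by (simp add: algebra_simps)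
      finally have "r \<le> (1 + 1/c) * (1 + c * r\<^sup>2)" .
      moreover have "1 + c * r\<^sup>2 > 0" using c by (simp add: add_pos_nonneg)
      ultimately show ?thesis by (simp add: divide_le_eq)
    qed
    finally have E: "r * cmod (exp (of_real pi * w\<^sup>2 / 2)) \<le> 1 + 1 / c" .
    have "half_gauss w = of_real (1 / sqrt 2) * exp (of_real pi * w\<^sup>2 / 2) - half_gauss (- w)"
      using half_gauss_reflect[of w] by (simp add: algebra_simps)
    hence "cmod (half_gauss w) \<le> cmod (of_real (1 / sqrt 2) * exp (of_real pi * w\<^sup>2 / 2)) + cmod (half_gauss (- w))"
      by (simp only: norm_triangle_ineq4)
    also have "cmod (of_real (1 / sqrt 2) * exp (of_real pi * w\<^sup>2 / 2)) \<le> 1 * cmod (exp (of_real pi * w\<^sup>2 / 2))"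
      unfolding norm_mult norm_of_real by (intro mult_right_mono) auto
    finally have "r * cmod (half_gauss w) \<le> r * (cmod (exp (of_real pi * w\<^sup>2 / 2)) + cmod (half_gauss (- w)))" using r by (intro mult_left_mono) auto
    also have "\<dots> \<le> (1 + 1 / c) + 1 / (2 * pi * \<kappa>)" unfolding distrib_left using E A by (intro add_mono)
    finally show ?thesis unfolding C1_def w_def by simp
  qed
  have left: "r * cmod (half_gauss (rcis r \<theta>)) \<le> C1" if r: "r \<ge> 0" and t: "5 * pi/8 \<le> \<theta>" "\<theta> \<le> pi" for r \<theta>
  proof -
    have "cos \<theta> \<le> cos (pi/2 + pi/8)" using t by (intro cos_monotone_0_pi_le) auto
    hence "cos \<theta> \<le> - \<kappa>" unfolding cos_add \<kappa>_def by simp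
    hence "r * cos \<theta> \<le> r * - \<kappa>" using r by (intro mult_left_mono)
    hence "Re (rcis r \<theta>) \<le> - (r * \<kappa>)" by simp
    from neg[OF this r] show ?thesis using C1 by linarith
  qed
  have mid: "r * cmod (half_gauss (rcis r \<theta>)) \<le> C1" if r: "r \<ge> 0" and t: "3 * pi/8 \<le> \<theta>" "\<theta> \<le> 5 * pi/8" for r \<theta>
  proof -
    have "cmod (rcis r \<theta> * half_gauss (rcis r \<theta>)) \<le> C1 * exp (sinusoid (3 * pi/8) 0 (5 * pi/8) 0 \<theta> * r\<^sup>2)"
    proof (rule sector_bound[where B = "pi/2 + 1"])
      show "(\<lambda>w. w * half_gauss w) holomorphic_on UNIV" by (intro holomorphic_intros half_gauss_holomorphic)
      show "cmod (z * half_gauss z) \<le> C1 * exp ((pi/2 + 1) * (cmod z)\<^sup>2)" for z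
      proof -
        have "0 \<le> (cmod z - 1/2)\<^sup>2" by simp
        hence "cmod z \<le> 1 + (cmod z)\<^sup>2" by (simp add: power2_eq_square algebra_simps)
        also have "\<dots> \<le> exp ((cmod z)\<^sup>2)" by (rule exp_ge_add_one_self)
        finally have "cmod (z * half_gauss z) \<le> exp ((cmod z)\<^sup>2) * exp (pi/2 * (cmod z)\<^sup>2)"
          unfolding norm_mult using half_gauss_le[of z] by (intro mult_mono) auto
        also have "\<dots> = 1 * exp ((pi/2 + 1) * (cmod z)\<^sup>2)" by (simp add: mult_exp_exp algebra_simps)
        also have "\<dots> \<le> C1 * exp ((pi/2 + 1) * (cmod z)\<^sup>2)" using C1 by (intro mult_right_mono) auto
        finally show ?thesis .
      qed
      show "cmod (rcis r (3 * pi/8) * half_gauss (rcis r (3 * pi/8))) \<le> C1 * exp (0 * r\<^sup>2)" if "r \<ge> 0" for r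
        using right[OF that, of "3 * pi/8"] s that by (simp add: norm_mult)
      show "cmod (rcis r (5 * pi/8) * half_gauss (rcis r (5 * pi/8))) \<le> C1 * exp (0 * r\<^sup>2)" if "r \<ge> 0" for r
        using left[OF that, of "5 * pi/8"] that by (simp add: norm_mult)
    qed (use t r in auto)
    thus ?thesis using r by (simp add: norm_mult sinusoid_def)
  qed
  have upper: "r * cmod (half_gauss (rcis r \<theta>)) \<le> C1" if r: "r \<ge> 0" and t: "pi/4 + s \<le> \<theta>" "\<theta> \<le> pi" for r \<theta>
    using right[OF r, of \<theta>] mid[OF r, of \<theta>] left[OF r, of \<theta>] t by linarith
  have all: "r * cmod (half_gauss (rcis r \<theta>)) \<le> C1" if r: "r \<ge> 0" and t: "pi/4 + s \<le> \<theta>" "\<theta> \<le> 2 * pi - (pi/4 + s)" for r \<theta>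
  proof (cases "\<theta> \<le> pi")
    case False
    have "rcis r \<theta> = cnj (rcis r (2 * pi - \<theta>))" by (simp add: complex_eq_iff cos_diff sin_diff)
    thus ?thesis using upper[OF r, of "2 * pi - \<theta>"] t False by (simp add: half_gauss_cnj)
  qed (use upper r t in auto)
  show ?thesis
  proof (rule that[of "exp (pi/2) + 2 * C1"])
    fix r \<theta> :: real assume r: "r \<ge> 0" and t: "pi/4 + s \<le> \<theta>" "\<theta> \<le> 2 * pi - (pi/4 + s)"
    have "cmod (half_gauss (rcis r \<theta>)) \<le> exp (pi/2) + C1"
    proof (cases "r \<le> 1")
      case True
      have "cmod (half_gauss (rcis r \<theta>)) \<le> exp (pi/2 * r\<^sup>2)" using half_gauss_le[of "rcis r \<theta>"] r by simp
      also have "\<dots> \<le> exp (pi/2)" using True r by (simp add: power_le_one)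
      finally show ?thesis using C1 by linarith
    next
      case False
      have "1 * cmod (half_gauss (rcis r \<theta>)) \<le> r * cmod (half_gauss (rcis r \<theta>))" using False by (intro mult_right_mono) auto
      thus ?thesis using all[OF r t] exp_gt_zero[of "pi/2"] by linarith
    qed
    thus "cmod (half_gauss (rcis r \<theta>)) * (1 + r) \<le> exp (pi/2) + 2 * C1" using all[OF r t] by (simp add: algebra_simps)
  qed
qed

text \<open>Rotation puts the sector of growth in the middle of the interval from
  \<open>\<alpha>\<close> to \<open>\<beta>\<close>, and the dilation \<open>\<kappa>\<close> lowers
  the growth of the fourth power to \<open>\<epsilon>\<close>. Four factors give decay of order 4,
  one more than uniqueness asks for, because one order is later spent on the factor
  \<open>z - p\<close>.\<close>

lemma sector_multiplier:
  assumes ab: "\<alpha> + pi/2 < \<beta>" and \<epsilon>: "\<epsilon> > 0"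
  obtains H C where "H holomorphic_on UNIV" "H 0 \<noteq> 0" "\<And>z. cmod (H z) \<le> C * exp (\<epsilon> * (cmod z)\<^sup>2)"
    "\<And>r \<theta>. r \<ge> 0 \<Longrightarrow> \<beta> \<le> \<theta> \<Longrightarrow> \<theta> \<le> \<alpha> + 2 * pi \<Longrightarrow> cmod (H (rcis r \<theta>)) \<le> C / (1 + r)^4"
proof -
  define \<mu> where "\<mu> = (\<alpha> + \<beta>) / 2"
  define s where "s = min ((\<beta> - \<alpha>) / 2 - pi/4) (pi/8)"
  have s: "0 < s" "s \<le> pi/8" "pi/4 + s \<le> (\<beta> - \<alpha>) / 2"
  proof -
    show "s > 0" using ab by (auto simp: s_def)
    show "s \<le> pi/8" unfolding s_def by (rule min.cobounded2)
    have "s \<le> (\<beta> - \<alpha>) / 2 - pi/4" unfolding s_def by (rule min.cobounded1)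
    thus "pi/4 + s \<le> (\<beta> - \<alpha>) / 2" by linarith
  qed
  obtain C where C: "\<And>r \<theta>. r \<ge> 0 \<Longrightarrow> pi/4 + s \<le> \<theta> \<Longrightarrow> \<theta> \<le> 2 * pi - (pi/4 + s) \<Longrightarrow> cmod (half_gauss (rcis r \<theta>)) * (1 + r) \<le> C"
    using half_gauss_sector_decay[OF s(1,2)] by blast
  define \<kappa> where "\<kappa> = sqrt (\<epsilon> / (2 * pi))"
  have \<kappa>: "\<kappa> > 0" "\<kappa>\<^sup>2 = \<epsilon> / (2 * pi)" using \<epsilon> by (auto simp: \<kappa>_def)
  define H where "H z = half_gauss (rcis \<kappa> (- \<mu>) * z) ^ 4" for z
  define D where "D = C * (1 + 1/\<kappa>)"
  show ?thesis
  proof (rule that[of H "1 + D^4"])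
    show "H holomorphic_on UNIV" unfolding H_def
      using holomorphic_on_compose_gen[OF _ half_gauss_holomorphic, of "\<lambda>z. rcis \<kappa> (- \<mu>) * z" UNIV]
      by (auto simp: o_def intro!: holomorphic_intros)
    have "half_gauss 0 \<noteq> 0" using half_gauss_reflect[of 0] by auto
    thus "H 0 \<noteq> 0" by (simp add: H_def)
    show "cmod (H z) \<le> (1 + D^4) * exp (\<epsilon> * (cmod z)\<^sup>2)" for z
    proof -
      have "cmod (H z) \<le> exp (pi/2 * (cmod (rcis \<kappa> (- \<mu>) * z))\<^sup>2) ^ 4"
        unfolding H_def norm_power by (intro power_mono half_gauss_le) auto
      also have "\<dots> = exp (of_nat 4 * (pi/2 * (cmod (rcis \<kappa> (- \<mu>) * z))\<^sup>2))" by (rule exp_of_nat_mult[symmetric])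
      also have "of_nat 4 * (pi/2 * (cmod (rcis \<kappa> (- \<mu>) * z))\<^sup>2) = \<epsilon> * (cmod z)\<^sup>2"
        using \<kappa> by (simp add: norm_mult power_mult_distrib)
      also have "exp (\<epsilon> * (cmod z)\<^sup>2) \<le> (1 + D^4) * exp (\<epsilon> * (cmod z)\<^sup>2)" by (simp add: zero_le_even_power)
      finally show ?thesis .
    qed
    fix r \<theta> assume r: "(r::real) \<ge> 0" and t: "\<beta> \<le> \<theta>" "\<theta> \<le> \<alpha> + 2 * pi"
    have "rcis \<kappa> (- \<mu>) * rcis r \<theta> = rcis (\<kappa> * r) (\<theta> - \<mu>)" by (simp add: rcis_mult)
    moreover have "cmod (half_gauss (rcis (\<kappa> * r) (\<theta> - \<mu>))) * (1 + \<kappa> * r) \<le> C"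
      using r \<kappa> t s by (intro C) (auto simp: \<mu>_def field_simps)
    moreover have pos: "1 + \<kappa> * r > 0" "1 + r > 0" using r \<kappa> by (auto simp: add_pos_nonneg)
    ultimately have "cmod (half_gauss (rcis \<kappa> (- \<mu>) * rcis r \<theta>)) \<le> C / (1 + \<kappa> * r)" by (simp add: le_divide_eq)
    also have "\<dots> \<le> D / (1 + r)"
    proof -
      have C0: "C \<ge> 0"
      proof -
        have "cmod (half_gauss (rcis 0 pi)) * (1 + 0) \<le> C" using s by (intro C) auto
        thus ?thesis by (simp add: order_trans[OF norm_ge_zero])
      qed
      have "1 + r \<le> (1 + 1/\<kappa>) * (1 + \<kappa> * r)" using r \<kappa> by (simp add: algebra_simps)
      hence "C * (1 + r) \<le> C * ((1 + 1/\<kappa>) * (1 + \<kappa> * r))" using C0 by (intro mult_left_mono)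
      thus ?thesis unfolding D_def using pos by (simp add: divide_le_eq le_divide_eq mult_ac)
    qed
    finally have "cmod (H (rcis r \<theta>)) \<le> (D / (1 + r))^4" unfolding H_def norm_power by (intro power_mono) auto
    also have "\<dots> \<le> (1 + D^4) / (1 + r)^4" unfolding power_divide using pos by (intro divide_right_mono) auto
    finally show "cmod (H (rcis r \<theta>)) \<le> (1 + D^4) / (1 + r)^4" .
  qed
qed

section \<open>Sums over sets with angular density\<close>

lemma convergent_at_topI:
  fixes x :: "real \<Rightarrow> complex"
  assumes "\<And>e. e > 0 \<Longrightarrow> \<exists>R0. \<forall>R\<ge>R0. \<forall>R'\<ge>R0. dist (x R) (x R') \<le> e"
  shows "\<exists>L. (x \<longlongrightarrow> L) at_top"
proof -
  have "Cauchy (\<lambda>n. x (real n))"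
  proof (rule metric_CauchyI)
    fix e :: real assume "e > 0"
    then obtain R0 where R0: "\<And>R R'. R \<ge> R0 \<Longrightarrow> R' \<ge> R0 \<Longrightarrow> dist (x R) (x R') \<le> e/2" using assms[of "e/2"] by auto
    obtain M where M: "real M \<ge> R0" using real_arch_simple by blast
    show "\<exists>M. \<forall>m\<ge>M. \<forall>n\<ge>M. dist (x (real m)) (x (real n)) < e"
    proof (intro exI[of _ M] allI impI)
      fix m n assume "m \<ge> M" "n \<ge> M"
      hence "real m \<ge> R0" "real n \<ge> R0" using M by linarith+
      from R0[OF this] show "dist (x (real m)) (x (real n)) < e" using \<open>e > 0\<close> by linarith
    qed
  qed
  then obtain L where L: "(\<lambda>n. x (real n)) \<longlonglongrightarrow> L" using Cauchy_convergent convergent_def by blast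
  have "(x \<longlongrightarrow> L) at_top"
  proof (rule tendstoI)
    fix e :: real assume e: "e > 0"
    then obtain R0 where R0: "\<And>R R'. R \<ge> R0 \<Longrightarrow> R' \<ge> R0 \<Longrightarrow> dist (x R) (x R') \<le> e/2" using assms[of "e/2"] by auto
    have "eventually (\<lambda>n. dist (x (real n)) L < e/2) sequentially" using L e by (intro tendstoD) auto
    moreover have "eventually (\<lambda>n. real n \<ge> R0) sequentially"
      using filterlim_real_sequentially unfolding filterlim_at_top by blast
    ultimately have "eventually (\<lambda>n. dist (x (real n)) L < e/2 \<and> real n \<ge> R0) sequentially" by eventually_elim auto
    then obtain n where n: "dist (x (real n)) L < e/2" "real n \<ge> R0" by (auto simp: eventually_sequentially)
    show "eventually (\<lambda>R. dist (x R) L < e) at_top"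
      using eventually_ge_at_top[of R0]
    proof eventually_elim
      case (elim R)
      show ?case using R0[OF elim n(2)] n(1) dist_triangle[of "x R" L "x (real n)"] by linarith
    qed
  qed
  thus ?thesis by blast
qed

lemma convergent_at_top_approx:
  fixes x :: "real \<Rightarrow> complex"
  assumes "\<And>e. e > 0 \<Longrightarrow> \<exists>v L. (v \<longlongrightarrow> L) at_top \<and> eventually (\<lambda>R. dist (x R) (v R) \<le> e) at_top"
  shows "\<exists>L. (x \<longlongrightarrow> L) at_top"
proof (rule convergent_at_topI)
  fix e :: real assume e: "e > 0"
  obtain v L where v: "(v \<longlongrightarrow> L) at_top" "eventually (\<lambda>R. dist (x R) (v R) \<le> e/4) at_top" using assms[of "e/4"] e by auto
  have "eventually (\<lambda>R. dist (v R) L < e/4) at_top" using v(1) e by (intro tendstoD) auto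
  with v(2) have "eventually (\<lambda>R. dist (x R) L \<le> e/2) at_top"
  proof eventually_elim
    case (elim R) thus ?case using dist_triangle[of "x R" L "v R"] by linarith
  qed
  then obtain R0 where R0: "\<And>R. R \<ge> R0 \<Longrightarrow> dist (x R) L \<le> e/2" by (auto simp: eventually_at_top_linorder)
  show "\<exists>R0. \<forall>R\<ge>R0. \<forall>R'\<ge>R0. dist (x R) (x R') \<le> e"
  proof (intro exI[of _ R0] allI impI)
    fix R R' assume "R \<ge> R0" "R' \<ge> R0"
    thus "dist (x R) (x R') \<le> e" using R0[of R] R0[of R'] dist_triangle2[of "x R" "x R'" L] by linarith
  qed
qed

text \<open>If \<open>d\<close> is the oscillation of \<open>x\<close> at infinity, the hypothesis gives
  \<open>d (1 - s\<^sup>-\<^sup>|\<^sup>p\<^sup>|) \<le> 2 K (s - 1)\<^sup>2\<close>, and \<open>s \<rightarrow> 1\<close> forces \<open>d = 0\<close>.\<close>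

lemma convergent_at_top_of_scaling:
  fixes x :: "real \<Rightarrow> complex" and p K B :: real
  assumes bdd: "eventually (\<lambda>R. cmod (x R) \<le> B) at_top" and p: "p \<noteq> 0" and K: "K \<ge> 0"
    and sc: "\<And>s. 1 < s \<Longrightarrow> s \<le> 2 \<Longrightarrow> \<exists>l. eventually (\<lambda>R. cmod (x (s * R) - of_real (s powr p) * x R - l) \<le> K * (s - 1)\<^sup>2) at_top"
  shows "\<exists>L. (x \<longlongrightarrow> L) at_top"
proof -
  define S where "S = {d. d \<ge> 0 \<and> (\<exists>R0. \<forall>R\<ge>R0. \<forall>R'\<ge>R0. dist (x R) (x R') \<le> d)}"
  define D where "D = Inf S"
  obtain R0 where R0: "\<And>R. R \<ge> R0 \<Longrightarrow> cmod (x R) \<le> B" using bdd by (auto simp: eventually_at_top_linorder)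
  have "2 * B \<in> S"
  proof -
    have "dist (x R) (x R') \<le> 2 * B" if "R \<ge> R0" "R' \<ge> R0" for R R'
      using R0[OF that(1)] R0[OF that(2)] norm_triangle_ineq4[of "x R" "x R'"] by (simp add: dist_norm)
    moreover have "B \<ge> 0" using R0[of R0] norm_ge_zero[of "x R0"] by linarith
    ultimately show ?thesis unfolding S_def by auto
  qed
  hence ne: "S \<noteq> {}" by auto
  have bb: "bdd_below S" by (auto simp: S_def bdd_below_def)
  have D0: "D \<ge> 0" unfolding D_def using ne by (intro cInf_greatest) (auto simp: S_def)
  \<comment> \<open>The scaling relation always shrinks the oscillation by
    \<open>s powr (- \<bar>p\<bar>)\<close>: for \<open>p < 0\<close> it is read from
    \<open>R / s\<close> to \<open>R\<close>, for \<open>p > 0\<close> it is solved for the value at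
    \<open>R\<close> in terms of the value at \<open>s * R\<close>.\<close>
  have step: "s powr (- \<bar>p\<bar>) * d + 2 * K * (s - 1)\<^sup>2 \<in> S" if d: "d \<in> S" and s: "1 < s" "s \<le> 2" for d s
  proof -
    obtain l R1 where l: "\<And>R. R \<ge> R1 \<Longrightarrow> cmod (x (s * R) - of_real (s powr p) * x R - l) \<le> K * (s - 1)\<^sup>2"
      using sc[OF s] by (auto simp: eventually_at_top_linorder)
    obtain R2 where R2: "\<And>R R'. R \<ge> R2 \<Longrightarrow> R' \<ge> R2 \<Longrightarrow> dist (x R) (x R') \<le> d" and d0: "d \<ge> 0" using d by (auto simp: S_def)
    define R3 where "R3 = max 0 (max R1 R2)"
    \<comment> \<open>The unspecified number \<open>l\<close> cancels in differences; each of the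
      two radii contributes one error term.\<close>
    have main: "dist (x (s * R)) (x (s * R')) \<le> s powr p * dist (x R) (x R') + 2 * (K * (s - 1)\<^sup>2)"
      "s powr p * dist (x R) (x R') \<le> dist (x (s * R)) (x (s * R')) + 2 * (K * (s - 1)\<^sup>2)" if "R \<ge> R3" "R' \<ge> R3" for R R'
    proof -
      define a b where "a = x (s * R) - of_real (s powr p) * x R - l" and "b = x (s * R') - of_real (s powr p) * x R' - l"
      have ab: "cmod a \<le> K * (s - 1)\<^sup>2" "cmod b \<le> K * (s - 1)\<^sup>2" unfolding a_def b_def using that by (auto intro!: l simp: R3_def)
      have eq: "x (s * R) - x (s * R') = of_real (s powr p) * (x R - x R') + (a - b)" by (simp add: a_def b_def algebra_simps)
      have n: "cmod (of_real (s powr p) * (x R - x R')) = s powr p * dist (x R) (x R')" by (simp add: norm_mult dist_norm)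
      have "cmod (a - b) \<le> 2 * (K * (s - 1)\<^sup>2)" using ab norm_triangle_ineq4[of a b] by linarith
      thus "dist (x (s * R)) (x (s * R')) \<le> s powr p * dist (x R) (x R') + 2 * (K * (s - 1)\<^sup>2)"
        "s powr p * dist (x R) (x R') \<le> dist (x (s * R)) (x (s * R')) + 2 * (K * (s - 1)\<^sup>2)"
        using norm_triangle_ineq[of "of_real (s powr p) * (x R - x R')" "a - b"]
          norm_triangle_ineq4[of "x (s * R) - x (s * R')" "a - b"]
        unfolding dist_norm[of "x (s * R)"] n[symmetric] eq by (auto simp: algebra_simps)
    qed
    have KK: "K * (s - 1)\<^sup>2 \<ge> 0" using K by simp
    have "\<exists>R4. \<forall>R\<ge>R4. \<forall>R'\<ge>R4. dist (x R) (x R') \<le> s powr (- \<bar>p\<bar>) * d + 2 * K * (s - 1)\<^sup>2"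
    proof (cases "p < 0")
      case True
      show ?thesis
      proof (intro exI[of _ "s * R3"] allI impI)
        fix R R' assume RR: "R \<ge> s * R3" "R' \<ge> s * R3"
        hence r: "R / s \<ge> R3" "R' / s \<ge> R3" using s by (auto simp: field_simps)
        have "s powr p * dist (x (R/s)) (x (R'/s)) \<le> s powr p * d" using r by (intro mult_left_mono R2) (auto simp: R3_def)
        thus "dist (x R) (x R') \<le> s powr (- \<bar>p\<bar>) * d + 2 * K * (s - 1)\<^sup>2"
        proof -
          have "dist (x R) (x R') \<le> s powr p * dist (x (R/s)) (x (R'/s)) + 2 * (K * (s - 1)\<^sup>2)"
            using main(1)[OF r] s by simp
          moreover have "- \<bar>p\<bar> = p" using True by simp
          ultimately show ?thesis using \<open>s powr p * dist (x (R/s)) (x (R'/s)) \<le> s powr p * d\<close> by simp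
        qed
      qed
    next
      case False
      hence p: "p > 0" using p by simp
      show ?thesis
      proof (intro exI[of _ R3] allI impI)
        fix R R' assume r: "R \<ge> R3" "R' \<ge> R3"
        have sR: "s * R \<ge> R" "s * R' \<ge> R'" using s r by (auto simp: R3_def mult_le_cancel_right1)
        have "s powr p * dist (x R) (x R') \<le> d + 2 * (K * (s - 1)\<^sup>2)"
          using main(2)[OF r] R2[of "s * R" "s * R'"] sR r by (simp add: R3_def)
        hence "dist (x R) (x R') \<le> s powr (-p) * (d + 2 * (K * (s - 1)\<^sup>2))"
          using s by (simp add: powr_minus field_simps)
        also have "\<dots> \<le> s powr (-p) * d + 1 * (2 * (K * (s - 1)\<^sup>2))"
        proof -
          have "s powr (-p) \<le> 1" using s p by (simp add: powr_le_one_le powr_minus_divide ge_one_powr_ge_zero)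
          hence "s powr (-p) * (2 * (K * (s - 1)\<^sup>2)) \<le> 1 * (2 * (K * (s - 1)\<^sup>2))" using KK by (intro mult_right_mono) auto
          thus ?thesis by (simp add: distrib_left)
        qed
        finally show "dist (x R) (x R') \<le> s powr (- \<bar>p\<bar>) * d + 2 * K * (s - 1)\<^sup>2" using p by simp
      qed
    qed
    thus ?thesis using d0 KK unfolding S_def by simp
  qed
  have ineq: "D * (1 - s powr (- \<bar>p\<bar>)) \<le> 2 * K * (s - 1)\<^sup>2" if s: "1 < s" "s \<le> 2" for s
  proof -
    have "D \<le> s powr (- \<bar>p\<bar>) * D + 2 * K * (s - 1)\<^sup>2"
    proof (rule field_le_epsilon)
      fix e :: real assume e: "e > 0"
      hence "Inf S < D + e" unfolding D_def by simp
      then obtain d where d: "d \<in> S" "d < D + e" using cInf_lessD[OF ne] by blast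
      have "D \<le> s powr (- \<bar>p\<bar>) * d + 2 * K * (s - 1)\<^sup>2" unfolding D_def using step[OF d(1) s] bb by (intro cInf_lower)
      also have "s powr (- \<bar>p\<bar>) * d \<le> s powr (- \<bar>p\<bar>) * (D + e)" using d by (intro mult_left_mono) auto
      also have "\<dots> \<le> s powr (- \<bar>p\<bar>) * D + 1 * e"
      proof -
        have "s powr (- \<bar>p\<bar>) \<le> s powr 0" using s by (intro powr_mono) auto
        hence "s powr (- \<bar>p\<bar>) * e \<le> 1 * e" using e s by (intro mult_right_mono) auto
        thus ?thesis by (simp add: distrib_left)
      qed
      finally show "D \<le> s powr (- \<bar>p\<bar>) * D + 2 * K * (s - 1)\<^sup>2 + e" by simp
    qed
    thus ?thesis by (simp add: algebra_simps)
  qed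
  have "((\<lambda>s. s powr (- \<bar>p\<bar>)) has_real_derivative (- \<bar>p\<bar>)) (at 1)"
    by (auto intro!: derivative_eq_intros)
  hence "((\<lambda>s. (s powr (- \<bar>p\<bar>) - 1) / (s - 1)) \<longlongrightarrow> - \<bar>p\<bar>) (at 1)" by (simp add: has_field_derivative_iff)
  hence "((\<lambda>s. D * - ((s powr (- \<bar>p\<bar>) - 1) / (s - 1))) \<longlongrightarrow> D * - (- \<bar>p\<bar>)) (at_right 1)"
    by (intro tendsto_intros) (auto intro: filterlim_mono at_le)
  moreover have "((\<lambda>s. 2 * K * (s - 1)) \<longlongrightarrow> 2 * K * (1 - 1)) (at_right (1::real))" by (intro tendsto_intros)
  moreover have "eventually (\<lambda>s. D * - ((s powr (- \<bar>p\<bar>) - 1) / (s - 1)) \<le> 2 * K * (s - 1)) (at_right (1::real))"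
    using eventually_at_right_real[of 1 2, simplified]
  proof eventually_elim
    case (elim s)
    hence s: "1 < s" "s \<le> 2" by auto
    have "D * (1 - s powr (- \<bar>p\<bar>)) / (s - 1) \<le> 2 * K * (s - 1)\<^sup>2 / (s - 1)" using ineq[OF s] s by (intro divide_right_mono) auto
    moreover have "2 * K * (s - 1)\<^sup>2 / (s - 1) = 2 * K * (s - 1)" using s by (simp add: power2_eq_square)
    moreover have "- ((s powr (- \<bar>p\<bar>) - 1) / (s - 1)) = (1 - s powr (- \<bar>p\<bar>)) / (s - 1)" by (simp add: minus_divide_left)
    ultimately show ?case by simp
  qed
  ultimately have "D * - (- \<bar>p\<bar>) \<le> 2 * K * (1 - 1)" by (intro tendsto_le[OF trivial_limit_at_right_real])
  hence "D * \<bar>p\<bar> \<le> 0" by simp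
  hence D: "D = 0" using D0 p by (simp add: mult_le_0_iff)
  show ?thesis
  proof (rule convergent_at_topI)
    fix e :: real assume "e > 0"
    hence "Inf S < e" using D unfolding D_def by simp
    then obtain d where d: "d \<in> S" "d < e" using cInf_lessD[OF ne] by blast
    then obtain R0 where "\<forall>R\<ge>R0. \<forall>R'\<ge>R0. dist (x R) (x R') \<le> d" by (auto simp: S_def)
    thus "\<exists>R0. \<forall>R\<ge>R0. \<forall>R'\<ge>R0. dist (x R) (x R') \<le> e" using d(2) by (meson less_imp_le order_trans)
  qed
qed

lemma one_minus_inverse_power_le:
  fixes s :: real assumes "s > 1" shows "1 - (1/s)^n \<le> real n * (s - 1)"
proof -
  have "1 + real n * (1/s - 1) \<le> (1 + (1/s - 1))^n" using assms by (intro Bernoulli_inequality) (auto simp: field_simps)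
  moreover have "real n * (1/s - 1) \<ge> - (real n * (s - 1))"
  proof -
    have "1/s - 1 \<ge> - (s - 1)"
    proof -
      have "(s - 1)^2 / s \<ge> 0" using assms by simp
      thus ?thesis using assms by (simp add: field_simps power2_eq_square)
    qed
    hence "real n * (1/s - 1) \<ge> real n * - (s - 1)" by (intro mult_left_mono) auto
    thus ?thesis by (simp add: algebra_simps)
  qed
  ultimately show ?thesis by simp
qed

section \<open>Sums over discs and annuli under quadratic counting\<close>

definition pts_below :: "complex set \<Rightarrow> real \<Rightarrow> complex set" where
  "pts_below Z R = {z \<in> Z. cmod z < R}"

text \<open>The counts are divided by \<open>R^2\<close> alone, so in the application
  \<open>\<delta>\<close> is \<open>pi\<close> times the density.\<close>

locale quadratic_counting =
  fixes Z :: "complex set" and \<delta> :: real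
  assumes finite_pts_below: "finite (pts_below Z R)" and zero_notin: "0 \<notin> Z"
    and count: "((\<lambda>R. real (card (pts_below Z R)) / R\<^sup>2) \<longlongrightarrow> \<delta>) at_top"
begin

lemma \<delta>_nonneg: "\<delta> \<ge> 0"
  by (rule tendsto_lowerbound[OF count]) auto

definition annulus :: "real \<Rightarrow> real \<Rightarrow> complex set" where
  "annulus s R = {z \<in> Z. R \<le> cmod z \<and> cmod z < s * R}"

lemma sum_pts_below_scale:
  fixes f :: "complex \<Rightarrow> 'b::ab_group_add"
  assumes "s > 1" "R > 0"
  shows "(\<Sum>z\<in>pts_below Z (s * R). f z) = (\<Sum>z\<in>pts_below Z R. f z) + (\<Sum>z\<in>annulus s R. f z)"
    and "finite (annulus s R)"
proof -
  have "R \<le> s * R" using assms by simp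
  hence eq: "pts_below Z (s * R) = pts_below Z R \<union> annulus s R" by (auto simp: pts_below_def annulus_def)
  moreover from this show "finite (annulus s R)" using finite_pts_below[of "s * R"] by simp
  ultimately show "(\<Sum>z\<in>pts_below Z (s * R). f z) = (\<Sum>z\<in>pts_below Z R. f z) + (\<Sum>z\<in>annulus s R. f z)"
    using finite_pts_below[of R] by (subst eq, subst sum.union_disjoint) (auto simp: pts_below_def annulus_def)
qed

lemma filterlim_scale_at_top: "s > 1 \<Longrightarrow> filterlim (\<lambda>R::real. s * R) at_top at_top"
  by (intro filterlim_tendsto_pos_mult_at_top[OF tendsto_const] filterlim_ident) auto

lemma scaled_limit:
  fixes F :: "real \<Rightarrow> 'b::real_normed_field"
  assumes s: "s > 1" and F: "((\<lambda>R. F R / of_real (R\<^sup>2)) \<longlongrightarrow> \<tau>) at_top"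
  shows "((\<lambda>R. (F (s * R) - F R) / of_real (R\<^sup>2)) \<longlongrightarrow> of_real (s\<^sup>2) * \<tau> - \<tau>) at_top"
proof -
  have "((\<lambda>R. F (s * R) / of_real ((s * R)\<^sup>2)) \<longlongrightarrow> \<tau>) at_top"
    using filterlim_compose[OF F filterlim_scale_at_top[OF s]] .
  hence "((\<lambda>R. of_real (s\<^sup>2) * (F (s * R) / of_real ((s * R)\<^sup>2)) - F R / of_real (R\<^sup>2)) \<longlongrightarrow> of_real (s\<^sup>2) * \<tau> - \<tau>) at_top"
    by (intro tendsto_intros F)
  moreover have "of_real (s\<^sup>2) * (F (s * R) / of_real ((s * R)\<^sup>2)) - F R / of_real (R\<^sup>2) = (F (s * R) - F R) / of_real (R\<^sup>2)" for R
    using s by (simp add: power_mult_distrib diff_divide_distrib)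
  ultimately show ?thesis by simp
qed

lemma annulus_count:
  assumes s: "1 < s" "s \<le> 2"
  shows "eventually (\<lambda>R. real (card (annulus s R)) \<le> (3 * \<delta> + 1) * (s - 1) * R\<^sup>2) at_top"
proof -
  have "((\<lambda>R. (real (card (pts_below Z (s * R))) - real (card (pts_below Z R))) / R\<^sup>2) \<longlongrightarrow> s\<^sup>2 * \<delta> - \<delta>) at_top"
    using scaled_limit[OF s(1), where F = "\<lambda>R. real (card (pts_below Z R))"] count by simp
  \<comment> \<open>\<open>s + 1 \<le> 3\<close> gives the factor 3; the additional 1 makes the
    inequality strict, also for \<open>\<delta> = 0\<close>, so that it passes from the limit to all
    large \<open>R\<close>.\<close>
  moreover have "s\<^sup>2 * \<delta> - \<delta> < (3 * \<delta> + 1) * (s - 1)"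
  proof -
    have "s\<^sup>2 * \<delta> - \<delta> = (s + 1) * \<delta> * (s - 1)" by (simp add: power2_eq_square algebra_simps)
    also have "\<dots> \<le> (3 * \<delta>) * (s - 1)" using s \<delta>_nonneg by (intro mult_right_mono) auto
    also have "\<dots> < (3 * \<delta> + 1) * (s - 1)" using s by (intro mult_strict_right_mono) auto
    finally show ?thesis .
  qed
  ultimately have "eventually (\<lambda>R. (real (card (pts_below Z (s * R))) - real (card (pts_below Z R))) / R\<^sup>2 < (3 * \<delta> + 1) * (s - 1)) at_top"
    by (rule order_tendstoD)
  with eventually_gt_at_top[of 0] show ?thesis
  proof eventually_elim
    case (elim R)
    have "real (card (pts_below Z (s * R))) = real (card (pts_below Z R)) + real (card (annulus s R))"
      using sum_pts_below_scale(1)[OF s(1) elim(1), of "\<lambda>_. 1::real"] by simp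
    thus ?case using elim by (simp add: field_simps)
  qed
qed

text \<open>For the angular sums every power of \<open>|z|/R\<close> in an annulus \<open>R \<le> |z| < s R\<close> is \<open>1 + O(s - 1)\<close>,
  so radial weights cost only \<open>O((s - 1)\<^sup>2)\<close>.\<close>

lemma annulus_sum_bound:
  assumes s: "1 < s" "s \<le> 2" and w: "\<And>R z. R > 0 \<Longrightarrow> z \<in> annulus s R \<Longrightarrow> cmod (w R z) \<le> M * (s - 1) / R\<^sup>2" and M: "M \<ge> 0"
  shows "eventually (\<lambda>R. cmod (\<Sum>z\<in>annulus s R. w R z) \<le> (3 * \<delta> + 1) * M * (s - 1)\<^sup>2) at_top"
  using annulus_count[OF s] eventually_gt_at_top[of 0]
proof eventually_elim
  case (elim R)
  have "cmod (\<Sum>z\<in>annulus s R. w R z) \<le> real (card (annulus s R)) * (M * (s - 1) / R\<^sup>2)"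
    using w elim by (intro sum_norm_bound) auto
  also have "\<dots> \<le> ((3 * \<delta> + 1) * (s - 1) * R\<^sup>2) * (M * (s - 1) / R\<^sup>2)"
    using elim M s by (intro mult_right_mono) auto
  also have "\<dots> = (3 * \<delta> + 1) * M * (s - 1)\<^sup>2" using elim by (simp add: power2_eq_square)
  finally show ?case .
qed

lemma sum_bounded:
  assumes "\<And>R z. R > 0 \<Longrightarrow> z \<in> pts_below Z R \<Longrightarrow> cmod (w R z) \<le> 1"
  shows "eventually (\<lambda>R. cmod ((\<Sum>z\<in>pts_below Z R. w R z) / of_real (R\<^sup>2)) \<le> \<delta> + 1) at_top"
proof -
  have "eventually (\<lambda>R. real (card (pts_below Z R)) / R\<^sup>2 < \<delta> + 1) at_top" using count by (rule order_tendstoD) simp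
  with eventually_gt_at_top[of 0] show ?thesis
  proof eventually_elim
    case (elim R)
    have "cmod (\<Sum>z\<in>pts_below Z R. w R z) \<le> real (card (pts_below Z R)) * 1" using assms elim by (intro sum_norm_bound) auto
    hence "cmod (\<Sum>z\<in>pts_below Z R. w R z) / R\<^sup>2 \<le> real (card (pts_below Z R)) / R\<^sup>2" by (intro divide_right_mono) auto
    thus ?case using elim by (simp add: norm_divide norm_power)
  qed
qed

text \<open>From \<open>R\<close> to \<open>s * R\<close> the old points are rescaled by
  \<open>s powr (- (k + 2))\<close>. The new ones lie in an annulus, where replacing
  \<open>cnj z / (s * R)\<close> by the direction \<open>cnj (sgn z)\<close> changes each term by at
  most a multiple of \<open>s - 1\<close>, and the sums over directions converge by
  hypothesis.\<close>

lemma cnj_power_sum_convergent: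
  assumes k: "k \<ge> 1" and T: "((\<lambda>R. (\<Sum>z\<in>pts_below Z R. cnj (sgn z) ^ k) / of_real (R\<^sup>2)) \<longlongrightarrow> \<tau>) at_top"
  shows "\<exists>L. ((\<lambda>R. (\<Sum>z\<in>pts_below Z R. (cnj z / of_real R) ^ k) / of_real (R\<^sup>2)) \<longlongrightarrow> L) at_top"
proof (rule convergent_at_top_of_scaling[where p = "- (real k + 2)" and K = "(3 * \<delta> + 1) * real k + 1"])
  let ?y = "\<lambda>R. (\<Sum>z\<in>pts_below Z R. (cnj z / of_real R) ^ k) / of_real (R\<^sup>2)"
  show "eventually (\<lambda>R. cmod (?y R) \<le> \<delta> + 1) at_top"
    by (rule sum_bounded) (auto simp: norm_power norm_divide pts_below_def intro!: power_le_one)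
  show "0 \<le> (3 * \<delta> + 1) * real k + 1" using \<delta>_nonneg by simp
  have "real k + 2 > 0" by simp
  thus "- (real k + 2) \<noteq> 0" by linarith
  fix s :: real assume s: "1 < s" "s \<le> 2"
  define l where "l = (of_real (s\<^sup>2) * \<tau> - \<tau>) / of_real (s\<^sup>2)"
  have "((\<lambda>R. ((\<Sum>z\<in>pts_below Z (s * R). cnj (sgn z) ^ k) - (\<Sum>z\<in>pts_below Z R. cnj (sgn z) ^ k)) / of_real (R\<^sup>2) / of_real (s\<^sup>2)) \<longlongrightarrow> l) at_top"
    unfolding l_def using s by (intro tendsto_divide scaled_limit T tendsto_const) auto
  hence A: "eventually (\<lambda>R. dist (((\<Sum>z\<in>pts_below Z (s * R). cnj (sgn z) ^ k) - (\<Sum>z\<in>pts_below Z R. cnj (sgn z) ^ k)) / of_real (R\<^sup>2) / of_real (s\<^sup>2)) l < (s-1)\<^sup>2) at_top"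
    using s by (intro tendstoD) auto
  define w where "w R z = ((cnj z / of_real (s * R)) ^ k - cnj (sgn z) ^ k) / of_real ((s * R)\<^sup>2)" for R z
  have W: "eventually (\<lambda>R. cmod (\<Sum>z\<in>annulus s R. w R z) \<le> (3 * \<delta> + 1) * real k * (s - 1)\<^sup>2) at_top"
  proof (rule annulus_sum_bound[OF s])
    fix R z assume R: "R > 0" and z: "z \<in> annulus s R"
    have z': "R \<le> cmod z" "cmod z < s * R" using z by (auto simp: annulus_def)
    define q where "q = cmod z / (s * R)"
    have q: "1/s \<le> q" "q \<le> 1" using z' R s by (auto simp: q_def field_simps)
    have "cnj z / of_real (s * R) = of_real q * cnj (sgn z)"
      using z' R by (simp add: q_def sgn_eq)
    hence "(cnj z / of_real (s * R)) ^ k - cnj (sgn z) ^ k = of_real (q^k - 1) * cnj (sgn z) ^ k"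
      by (simp add: power_mult_distrib algebra_simps)
    hence "cmod ((cnj z / of_real (s * R)) ^ k - cnj (sgn z) ^ k) = \<bar>q^k - 1\<bar> * cmod (cnj (sgn z) ^ k)" by (simp only: norm_mult norm_of_real)
    also have "\<dots> = 1 - q^k"
    proof -
      have "z \<noteq> 0" using z' R by auto
      moreover have "0 \<le> q" using z' R s by (auto simp: q_def)
      hence "q ^ k \<le> 1" using q by (intro power_le_one)
      ultimately show ?thesis by (simp add: norm_power norm_sgn)
    qed
    also have "\<dots> \<le> 1 - (1/s)^k" using q s by (simp add: power_mono)
    also have "\<dots> \<le> real k * (s - 1)" using s by (intro one_minus_inverse_power_le) auto
    finally have "cmod (w R z) \<le> real k * (s - 1) / (s * R)\<^sup>2"
      unfolding w_def norm_divide norm_of_real by (simp add: divide_right_mono)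
    also have "\<dots> \<le> real k * (s - 1) / R\<^sup>2"
      using s R by (intro divide_left_mono power_mono mult_nonneg_nonneg) auto
    finally show "cmod (w R z) \<le> real k * (s - 1) / R\<^sup>2" .
  qed auto
  have "eventually (\<lambda>R. cmod (?y (s * R) - of_real (s powr (- (real k + 2))) * ?y R - l) \<le> ((3 * \<delta> + 1) * real k + 1) * (s - 1)\<^sup>2) at_top"
    using A W eventually_gt_at_top[of 0]
  proof eventually_elim
    case (elim R)
    define P Q where "P = (\<Sum>z\<in>annulus s R. cnj (sgn z) ^ k) / of_real (R\<^sup>2) / of_real (s\<^sup>2)" and "Q = (\<Sum>z\<in>annulus s R. w R z)"
    have p: "s powr (- (real k + 2)) = 1 / (s^k * s\<^sup>2)"
    proof -
      have "s powr (real k + 2) = s ^ (k + 2)" using s powr_realpow[of s "k + 2"] by (simp add: add.commute)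
      thus ?thesis unfolding powr_minus_divide by (simp add: power_add power2_eq_square)
    qed
    have "?y (s * R) - of_real (s powr (- (real k + 2))) * ?y R = P + Q"
    proof -
      have "?y (s * R) = (\<Sum>z\<in>pts_below Z R. (cnj z / of_real (s * R)) ^ k) / of_real ((s * R)\<^sup>2) + (\<Sum>z\<in>annulus s R. (cnj z / of_real (s * R)) ^ k) / of_real ((s * R)\<^sup>2)"
        using sum_pts_below_scale(1)[OF s(1) elim(3), of "\<lambda>z. (cnj z / of_real (s * R)) ^ k"] by (simp only: add_divide_distrib)
      moreover have "(\<Sum>z\<in>pts_below Z R. (cnj z / of_real (s * R)) ^ k) / of_real ((s * R)\<^sup>2) = of_real (s powr (- (real k + 2))) * ?y R"
      proof -
        have "(cnj z / of_real (s * R)) ^ k = (cnj z / of_real R) ^ k / of_real (s ^ k)" for z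
          using s by (simp add: power_divide power_mult_distrib field_simps)
        hence "(\<Sum>z\<in>pts_below Z R. (cnj z / of_real (s * R)) ^ k) = (\<Sum>z\<in>pts_below Z R. (cnj z / of_real R) ^ k) / of_real (s ^ k)"
          by (simp only: sum_divide_distrib)
        thus ?thesis unfolding p by (simp add: power_mult_distrib mult_ac)
      qed
      moreover have "(\<Sum>z\<in>annulus s R. (cnj z / of_real (s * R)) ^ k) / of_real ((s * R)\<^sup>2) = P + Q"
        unfolding P_def Q_def w_def sum_divide_distrib sum.distrib[symmetric]
        using s elim by (intro sum.cong refl) (simp add: diff_divide_distrib power_mult_distrib mult_ac)
      ultimately show ?thesis by simp
    qed
    moreover have "dist P l < (s-1)\<^sup>2" using elim(1) sum_pts_below_scale(1)[OF s(1) elim(3), of "\<lambda>z. cnj (sgn z) ^ k"] by (simp add: P_def)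
    ultimately have "cmod (?y (s * R) - of_real (s powr (- (real k + 2))) * ?y R - l) \<le> (s-1)\<^sup>2 + cmod Q"
      using norm_triangle_ineq[of "P - l" Q] by (simp add: dist_norm algebra_simps)
    thus ?case using elim(2) by (simp add: Q_def algebra_simps)
  qed
  thus "\<exists>l. eventually (\<lambda>R. cmod (?y (s * R) - of_real (s powr (- (real k + 2))) * ?y R - l) \<le> ((3 * \<delta> + 1) * real k + 1) * (s - 1)\<^sup>2) at_top" by blast
qed

text \<open>The two terms for a point \<open>a\<close> coincide when \<open>a\<close> lies on the
  circle itself. Points of an annulus below the new circle therefore contribute only
  \<open>O((s - 1)^2)\<close> in total. What remains is the change of the second terms for the old
  points, a multiple of the convergent sum of \<open>cnj_power_sum_convergent\<close>. The scaling
  exponent is \<open>k - 2\<close>, and in the case where it vanishes both sums converge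
  separately.\<close>

lemma taylor_coeff_convergent:
  assumes k: "k \<ge> 1" and T: "((\<lambda>R. (\<Sum>z\<in>pts_below Z R. cnj (sgn z) ^ k) / of_real (R\<^sup>2)) \<longlongrightarrow> \<tau>) at_top"
    and 2: "k = 2 \<Longrightarrow> \<exists>L. ((\<lambda>R. \<Sum>z\<in>pts_below Z R. 1 / z\<^sup>2) \<longlongrightarrow> L) at_top"
    and \<gamma>: "\<And>R. R > 0 \<Longrightarrow> \<gamma> R = c + (\<Sum>a\<in>pts_below Z R. 1 / a^k - (cnj a / of_real (R\<^sup>2))^k) / of_nat k"
    and bdd: "eventually (\<lambda>R. cmod (\<gamma> R) * R ^ k \<le> B * R\<^sup>2) at_top"
  shows "\<exists>L. ((\<lambda>R. \<gamma> R * of_real (R ^ k / R\<^sup>2)) \<longlongrightarrow> L) at_top"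
proof -
  let ?y = "\<lambda>R. (\<Sum>z\<in>pts_below Z R. (cnj z / of_real R) ^ k) / of_real (R\<^sup>2)"
  let ?x = "\<lambda>R. \<gamma> R * of_real (R ^ k / R\<^sup>2)"
  obtain Y where Y: "(?y \<longlongrightarrow> Y) at_top" using cnj_power_sum_convergent[OF k T] by blast
  have ysum: "(\<Sum>z\<in>pts_below Z R. (cnj z / of_real (R\<^sup>2)) ^ k) * of_real (R ^ k / R\<^sup>2) = ?y R" if "R > 0" for R
  proof -
    have "(cnj z / of_real (R\<^sup>2)) ^ k * of_real (R ^ k) = (cnj z / of_real R) ^ k" for z
      using that by (simp add: power_divide power_mult_distrib power2_eq_square)
    hence "(\<Sum>z\<in>pts_below Z R. (cnj z / of_real (R\<^sup>2)) ^ k) * of_real (R ^ k) = (\<Sum>z\<in>pts_below Z R. (cnj z / of_real R) ^ k)"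
      by (simp only: sum_distrib_right)
    thus ?thesis by (simp add: of_real_divide times_divide_eq_right)
  qed
  show ?thesis
  proof (cases "k = 2")
    case True
    obtain L where L: "((\<lambda>R. \<Sum>z\<in>pts_below Z R. 1 / z\<^sup>2) \<longlongrightarrow> L) at_top" using 2 True by blast
    have "((\<lambda>R. c + (\<Sum>z\<in>pts_below Z R. 1 / z\<^sup>2) / 2 - ?y R / 2) \<longlongrightarrow> c + L / 2 - Y / 2) at_top"
      by (intro tendsto_intros L Y) auto
    moreover have "eventually (\<lambda>R. c + (\<Sum>z\<in>pts_below Z R. 1 / z\<^sup>2) / 2 - ?y R / 2 = ?x R) at_top"
      using eventually_gt_at_top[of 0]
    proof eventually_elim
      case (elim R)
      have "R ^ k / R\<^sup>2 = 1" using elim True by simp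
      moreover from this have "(\<Sum>z\<in>pts_below Z R. (cnj z / of_real (R\<^sup>2)) ^ k) = ?y R" using ysum[OF elim] by simp
      moreover have "(\<Sum>z\<in>pts_below Z R. 1 / z\<^sup>2) = (\<Sum>z\<in>pts_below Z R. 1 / z ^ k)" "of_nat k = (2::complex)" using True by auto
      ultimately show ?case unfolding \<gamma>[OF elim] sum_subtractf by (simp only: diff_divide_distrib of_real_1 mult_1_right) simp
    qed
    ultimately have "(?x \<longlongrightarrow> c + L / 2 - Y / 2) at_top" by (rule Lim_transform_eventually)
    thus ?thesis by blast
  next
    case False
    show ?thesis
    proof (rule convergent_at_top_of_scaling[where p = "real k - 2" and K = "(3 * \<delta> + 1) * (2^k * real (2*k)) + 1"])
      show "eventually (\<lambda>R. cmod (?x R) \<le> B) at_top"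
        using bdd eventually_gt_at_top[of 0]
      proof eventually_elim
        case (elim R) thus ?case by (simp add: norm_mult norm_divide norm_power field_simps)
      qed
      show "real k - 2 \<noteq> 0" using False by simp
      show "0 \<le> (3 * \<delta> + 1) * (2^k * real (2*k)) + 1" using \<delta>_nonneg by simp
      fix s :: real assume s: "1 < s" "s \<le> 2"
      \<comment> \<open>The factor \<open>1 - (1/s)^(2*k)\<close> is the change of
        \<open>(cnj a / R^2)^k\<close>, relative to its value, when \<open>R\<close> becomes
        \<open>s * R\<close>; the remaining factors are the normalization at the new radius.\<close>
      define C where "C = (s ^ k / s\<^sup>2) / real k * (1 - (1/s)^(2*k))"
      define l where "l = of_real C * Y"
      have "((\<lambda>R. of_real C * ?y R) \<longlongrightarrow> l) at_top" unfolding l_def by (intro tendsto_intros Y)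
      hence A: "eventually (\<lambda>R. dist (of_real C * ?y R) l < (s-1)\<^sup>2) at_top" using s by (intro tendstoD) auto
      define w where "w R z = of_real ((s * R)^k / (s * R)\<^sup>2 / real k) * (1 / z ^ k - (cnj z / of_real ((s * R)\<^sup>2)) ^ k)" for R z
      have W: "eventually (\<lambda>R. cmod (\<Sum>z\<in>annulus s R. w R z) \<le> (3 * \<delta> + 1) * (2^k * real (2*k)) * (s - 1)\<^sup>2) at_top"
      proof (rule annulus_sum_bound[OF s])
        fix R z assume R: "R > 0" and z: "z \<in> annulus s R"
        have z': "R \<le> cmod z" "cmod z < s * R" using z by (auto simp: annulus_def)
        define q where "q = cmod z / (s * R)"
        have q: "1/s \<le> q" "q \<le> 1" "q > 0" using z' R s by (auto simp: q_def field_simps)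
        have z0: "cmod z > 0" using z' R by linarith
        have "cnj z / of_real ((s * R)\<^sup>2) = of_real (q\<^sup>2) * (1 / z)"
        proof -
          have "cnj z * z = of_real ((cmod z)\<^sup>2)" using complex_norm_square[of z] by (simp add: mult.commute)
          hence cz: "cnj z = of_real ((cmod z)\<^sup>2) / z" using z0 by (simp add: field_simps)
          show ?thesis unfolding cz by (simp add: q_def power_divide power_mult_distrib)
        qed
        hence "(cnj z / of_real ((s * R)\<^sup>2)) ^ k = of_real (q ^ (2 * k)) * (1 / z) ^ k"
          by (simp only: power_mult_distrib of_real_power power_mult)
        hence "1 / z ^ k - (cnj z / of_real ((s * R)\<^sup>2)) ^ k = of_real (1 - q ^ (2 * k)) * (1 / z) ^ k"
          by (simp add: power_one_over algebra_simps)
        hence "cmod (1 / z ^ k - (cnj z / of_real ((s * R)\<^sup>2)) ^ k) = \<bar>1 - q ^ (2 * k)\<bar> * (1 / cmod z ^ k)"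
          by (simp only: norm_mult norm_of_real norm_power norm_divide norm_one power_one_over)
        also have "\<bar>1 - q ^ (2 * k)\<bar> = 1 - q ^ (2 * k)" using q by (simp add: power_le_one)
        also have "(1 - q ^ (2 * k)) * (1 / cmod z ^ k) \<le> (real (2*k) * (s - 1)) * (1 / R ^ k)"
        proof (intro mult_mono)
          have "(1/s)^(2*k) \<le> q^(2*k)" using q s by (intro power_mono) auto
          thus "1 - q ^ (2 * k) \<le> real (2*k) * (s - 1)" using one_minus_inverse_power_le[OF s(1), of "2*k"] by linarith
          show "1 / cmod z ^ k \<le> 1 / R ^ k" using z' R z0 by (intro divide_left_mono power_mono) auto
        qed (use s in auto)
        finally have "cmod (w R z) \<le> \<bar>(s * R)^k / (s * R)\<^sup>2 / real k\<bar> * ((real (2*k) * (s - 1)) * (1 / R ^ k))"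
          unfolding w_def norm_mult norm_of_real by (intro mult_left_mono) auto
        also have "\<dots> = (s^k / s\<^sup>2 / real k) * (real (2*k) * (s - 1) / R\<^sup>2)"
          using s R k by (simp add: power_mult_distrib field_simps)
        also have "\<dots> \<le> 2^k * (real (2*k) * (s - 1) / R\<^sup>2)"
        proof (intro mult_right_mono)
          have "s^k / s\<^sup>2 / real k \<le> s^k / 1 / 1" using s k by (intro frac_le) (auto simp: one_le_power)
          also have "\<dots> \<le> 2^k" using s by (simp add: power_mono)
          finally show "s^k / s\<^sup>2 / real k \<le> 2^k" .
        qed (use s in auto)
        finally show "cmod (w R z) \<le> 2^k * real (2*k) * (s - 1) / R\<^sup>2" by simp
      qed auto
      have "eventually (\<lambda>R. cmod (?x (s * R) - of_real (s powr (real k - 2)) * ?x R - l) \<le> ((3 * \<delta> + 1) * (2^k * real (2*k)) + 1) * (s - 1)\<^sup>2) at_top"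
        using A W eventually_gt_at_top[of 0]
      proof eventually_elim
        case (elim R)
        define Q where "Q = (\<Sum>z\<in>annulus s R. w R z)"
        have p: "s powr (real k - 2) = s ^ k / s\<^sup>2" using s by (simp add: powr_diff powr_realpow powr_numeral)
        have sR: "s * R > 0" using s elim by simp
        have "?x (s * R) - of_real (s powr (real k - 2)) * ?x R = of_real C * ?y R + Q"
        proof -
          define E where "E = complex_of_real ((s * R)^k / (s * R)\<^sup>2 / real k)"
          have e1: "of_real ((s * R)^k / (s * R)\<^sup>2) = E * of_nat k" using k by (simp add: E_def)
          have e2: "of_real (s powr (real k - 2)) * of_real (R ^ k / R\<^sup>2) = E * of_nat k" unfolding p e1[symmetric] by (simp add: power_mult_distrib)
          define U where "U r R' = (\<Sum>a\<in>pts_below Z R'. 1 / a^k - (cnj a / of_real (r\<^sup>2))^k)" for r R'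
          have 1: "?x (s * R) = E * (of_nat k * c + U (s*R) R + (\<Sum>a\<in>annulus s R. 1 / a^k - (cnj a / of_real ((s * R)\<^sup>2))^k))"
            unfolding e1 \<gamma>[OF sR] sum_pts_below_scale(1)[OF s(1) elim(3)] U_def using k by (simp add: field_simps)
          have "of_real (s powr (real k - 2)) * ?x R = \<gamma> R * (of_real (s powr (real k - 2)) * of_real (R ^ k / R\<^sup>2))" by (simp only: mult_ac)
          also have "\<dots> = E * (of_nat k * c + U R R)" unfolding e2 \<gamma>[OF elim(3)] U_def using k by (simp add: field_simps)
          finally have 2: "of_real (s powr (real k - 2)) * ?x R = E * (of_nat k * c + U R R)" .
          have 3: "U (s*R) R - U R R = of_real (1 - (1/s)^(2*k)) * (\<Sum>z\<in>pts_below Z R. (cnj z / of_real (R\<^sup>2)) ^ k)"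
          proof -
            have "(cnj a / of_real ((s * R)\<^sup>2))^k = of_real ((1/s)^(2*k)) * (cnj a / of_real (R\<^sup>2))^k" for a
            proof -
              have "cnj a / of_real ((s * R)\<^sup>2) = of_real ((1/s)\<^sup>2) * (cnj a / of_real (R\<^sup>2))" by (simp add: power_divide power_mult_distrib)
              thus ?thesis by (simp only: power_mult_distrib of_real_power power_mult)
            qed
            hence "U (s*R) R = (\<Sum>a\<in>pts_below Z R. 1 / a^k) - of_real ((1/s)^(2*k)) * (\<Sum>z\<in>pts_below Z R. (cnj z / of_real (R\<^sup>2)) ^ k)"
              unfolding U_def sum_subtractf by (simp only: sum_distrib_left)
            thus ?thesis unfolding U_def sum_subtractf by (simp add: algebra_simps)
          qed
          have 4: "E * (\<Sum>a\<in>annulus s R. 1 / a^k - (cnj a / of_real ((s * R)\<^sup>2))^k) = Q"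
            unfolding Q_def w_def E_def sum_distrib_left ..
          have "?x (s * R) - of_real (s powr (real k - 2)) * ?x R = E * (U (s*R) R - U R R) + Q"
            unfolding 1 2 4[symmetric] by (simp add: algebra_simps)
          also have "E * (U (s*R) R - U R R) = of_real C * ?y R"
            unfolding 3 ysum[OF elim(3), symmetric] E_def C_def by (simp add: power_mult_distrib mult_ac)
          finally show ?thesis .
        qed
        hence "cmod (?x (s * R) - of_real (s powr (real k - 2)) * ?x R - l) \<le> dist (of_real C * ?y R) l + cmod Q"
          using norm_triangle_ineq[of "of_real C * ?y R - l" Q] by (simp add: dist_norm algebra_simps)
        thus ?case using elim(1,2) by (simp add: Q_def algebra_simps)
      qed
      thus "\<exists>l. eventually (\<lambda>R. cmod (?x (s * R) - of_real (s powr (real k - 2)) * ?x R - l) \<le> ((3 * \<delta> + 1) * (2^k * real (2*k)) + 1) * (s - 1)\<^sup>2) at_top" by blast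
    qed
  qed
qed

text \<open>On passing to \<open>s * R\<close> every old point gains \<open>ln s\<close>, and every
  new one contributes at most \<open>s - 1\<close>. This yields convergence by scaling with exponent
  -2; inserting the limit \<open>L\<close> into the relation, dividing by \<open>s - 1\<close> and
  letting \<open>s\<close> tend to 1 gives \<open>2 * L = \<delta>\<close>. The boundedness is
  supplied later by Jensen's formula.\<close>

lemma log_sum_limit:
  assumes bdd: "eventually (\<lambda>R. (\<Sum>a\<in>pts_below Z R. ln (R / cmod a)) / R\<^sup>2 \<le> B) at_top"
  shows "((\<lambda>R. (\<Sum>a\<in>pts_below Z R. ln (R / cmod a)) / R\<^sup>2) \<longlongrightarrow> \<delta> / 2) at_top"
proof -
  define x where "x R = (\<Sum>a\<in>pts_below Z R. ln (R / cmod a)) / R\<^sup>2" for R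
  define K where "K = 3 * \<delta> + 2"
  have xnn: "x R \<ge> 0" if "R > 0" for R
    unfolding x_def
  proof (intro divide_nonneg_nonneg sum_nonneg ln_ge_zero)
    fix a assume "a \<in> pts_below Z R"
    hence "cmod a > 0" "cmod a < R" using zero_notin by (auto simp: pts_below_def)
    thus "1 \<le> R / cmod a" by simp
  qed auto
  have rel: "eventually (\<lambda>R. \<bar>x (s * R) - x R / s\<^sup>2 - \<delta> * ln s / s\<^sup>2\<bar> \<le> K * (s - 1)\<^sup>2) at_top" if s: "1 < s" "s \<le> 2" for s
  proof -
    have "((\<lambda>R. real (card (pts_below Z R)) / R\<^sup>2 * ln s / s\<^sup>2) \<longlongrightarrow> \<delta> * ln s / s\<^sup>2) at_top"
      using s by (intro tendsto_intros count) auto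
    hence A: "eventually (\<lambda>R. dist (real (card (pts_below Z R)) / R\<^sup>2 * ln s / s\<^sup>2) (\<delta> * ln s / s\<^sup>2) < (s-1)\<^sup>2) at_top"
      using s by (intro tendstoD) auto
    have W: "eventually (\<lambda>R. cmod (\<Sum>z\<in>annulus s R. of_real (ln (s * R / cmod z) / (s * R)\<^sup>2)) \<le> (3 * \<delta> + 1) * 1 * (s - 1)\<^sup>2) at_top"
    proof (rule annulus_sum_bound[OF s])
      fix R z assume R: "R > 0" and z: "z \<in> annulus s R"
      have z': "R \<le> cmod z" "cmod z < s * R" using z by (auto simp: annulus_def)
      have "cmod z > 0" using z' R by linarith
      hence "1 \<le> s * R / cmod z" using z' by (simp add: le_divide_eq)
      hence "0 \<le> ln (s * R / cmod z)" "0 < s * R / cmod z" by (auto intro: ln_ge_zero)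
      moreover have "ln (s * R / cmod z) \<le> s * R / cmod z - 1" using \<open>0 < s * R / cmod z\<close> by (rule ln_le_minus_one)
      moreover have "s * R / cmod z \<le> s" using z' s \<open>cmod z > 0\<close> by (simp add: divide_le_eq)
      ultimately have "\<bar>ln (s * R / cmod z)\<bar> \<le> s - 1" by linarith
      hence "\<bar>ln (s * R / cmod z) / (s * R)\<^sup>2\<bar> \<le> (s - 1) / R\<^sup>2"
        unfolding abs_divide using s R by (intro frac_le) (auto intro!: power_mono)
      thus "cmod (of_real (ln (s * R / cmod z) / (s * R)\<^sup>2)) \<le> 1 * (s - 1) / R\<^sup>2" by (simp only: norm_of_real mult_1)
    qed auto
    from A W eventually_gt_at_top[of 0] show ?thesis
    proof eventually_elim
      case (elim R)
      define P Q where "P = real (card (pts_below Z R)) / R\<^sup>2 * ln s / s\<^sup>2" and "Q = (\<Sum>z\<in>annulus s R. ln (s * R / cmod z) / (s * R)\<^sup>2)"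
      have "x (s * R) = (\<Sum>a\<in>pts_below Z R. ln (s * R / cmod a)) / (s * R)\<^sup>2 + Q"
        unfolding x_def sum_pts_below_scale(1)[OF s(1) elim(3)] Q_def by (simp add: add_divide_distrib sum_divide_distrib)
      moreover have "(\<Sum>a\<in>pts_below Z R. ln (s * R / cmod a)) = (\<Sum>a\<in>pts_below Z R. ln s + ln (R / cmod a))"
      proof (intro sum.cong refl)
        fix a assume "a \<in> pts_below Z R"
        hence "a \<noteq> 0" using zero_notin by (auto simp: pts_below_def)
        thus "ln (s * R / cmod a) = ln s + ln (R / cmod a)" using s elim by (simp add: ln_mult ln_div)
      qed
      hence "(\<Sum>a\<in>pts_below Z R. ln (s * R / cmod a)) / (s * R)\<^sup>2 = P + x R / s\<^sup>2"
        unfolding P_def x_def using s elim by (simp add: sum.distrib power_mult_distrib add_divide_distrib mult_ac)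
      ultimately have "x (s * R) - x R / s\<^sup>2 - \<delta> * ln s / s\<^sup>2 = (P - \<delta> * ln s / s\<^sup>2) + Q" by simp
      moreover have "\<bar>P - \<delta> * ln s / s\<^sup>2\<bar> < (s-1)\<^sup>2" using elim(1) by (simp add: P_def dist_real_def)
      moreover have "\<bar>Q\<bar> \<le> (3 * \<delta> + 1) * (s - 1)\<^sup>2" using elim(2) unfolding Q_def by (simp only: of_real_sum[symmetric] norm_of_real mult_1_right)
      ultimately have "\<bar>x (s * R) - x R / s\<^sup>2 - \<delta> * ln s / s\<^sup>2\<bar> \<le> (s-1)\<^sup>2 + (3 * \<delta> + 1) * (s - 1)\<^sup>2" by linarith
      thus ?case by (simp add: K_def algebra_simps)
    qed
  qed
  have "\<exists>L. ((\<lambda>R. complex_of_real (x R)) \<longlongrightarrow> L) at_top"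
  proof (rule convergent_at_top_of_scaling[where p = "-2" and K = K and B = B])
    show "eventually (\<lambda>R. cmod (of_real (x R)) \<le> B) at_top"
      using bdd eventually_gt_at_top[of 0]
    proof eventually_elim
      case (elim R)
      thus ?case using xnn[OF elim(2)] unfolding norm_of_real by (simp add: x_def)
    qed
    show "K \<ge> 0" using \<delta>_nonneg by (simp add: K_def)
    fix s :: real assume s: "1 < s" "s \<le> 2"
    have p: "s powr -2 = 1 / s\<^sup>2" using s by (simp add: powr_minus_divide powr_numeral)
    show "\<exists>l. eventually (\<lambda>R. cmod (complex_of_real (x (s * R)) - of_real (s powr -2) * of_real (x R) - l) \<le> K * (s - 1)\<^sup>2) at_top"
      using rel[OF s]
    proof (intro exI[of _ "of_real (\<delta> * ln s / s\<^sup>2)"], eventually_elim)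
      case (elim R)
      have "complex_of_real (x (s * R)) - of_real (s powr -2) * of_real (x R) - of_real (\<delta> * ln s / s\<^sup>2) = of_real (x (s * R) - x R / s\<^sup>2 - \<delta> * ln s / s\<^sup>2)"
        unfolding p by simp
      thus ?case using elim by (simp only: norm_of_real)
    qed
  qed auto
  then obtain L' where "((\<lambda>R. complex_of_real (x R)) \<longlongrightarrow> L') at_top" by blast
  hence "((\<lambda>R. Re (complex_of_real (x R))) \<longlongrightarrow> Re L') at_top" by (rule tendsto_Re)
  then obtain L where L: "(x \<longlongrightarrow> L) at_top" by auto
  have LK: "\<bar>L - L / s\<^sup>2 - \<delta> * ln s / s\<^sup>2\<bar> \<le> K * (s - 1)\<^sup>2" if s: "1 < s" "s \<le> 2" for s
  proof (rule tendsto_upperbound[OF _ rel[OF s]])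
    show "((\<lambda>R. \<bar>x (s * R) - x R / s\<^sup>2 - \<delta> * ln s / s\<^sup>2\<bar>) \<longlongrightarrow> \<bar>L - L / s\<^sup>2 - \<delta> * ln s / s\<^sup>2\<bar>) at_top"
      using s by (intro tendsto_intros L filterlim_compose[OF L filterlim_scale_at_top]) auto
  qed auto
  have "((\<lambda>s. \<bar>(L - L / s\<^sup>2 - \<delta> * ln s / s\<^sup>2) / (s - 1)\<bar>) \<longlongrightarrow> \<bar>2 * L - \<delta>\<bar>) (at_right 1)"
    by (intro tendsto_rabs) real_asymp
  moreover have "((\<lambda>s. K * (s - 1)) \<longlongrightarrow> K * (1 - 1)) (at_right (1::real))" by (intro tendsto_intros)
  moreover have "eventually (\<lambda>s. \<bar>(L - L / s\<^sup>2 - \<delta> * ln s / s\<^sup>2) / (s - 1)\<bar> \<le> K * (s - 1)) (at_right (1::real))"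
    using eventually_at_right_real[of 1 2, simplified]
  proof eventually_elim
    case (elim s)
    thus ?case using LK[of s] by (simp add: abs_divide field_simps power2_eq_square)
  qed
  ultimately have "\<bar>2 * L - \<delta>\<bar> \<le> K * (1 - 1)" by (intro tendsto_le[OF trivial_limit_at_right_real])
  hence L2: "L = \<delta> / 2" by simp
  show ?thesis using L unfolding x_def L2 .
qed

end

section \<open>Angular sums from sector counts\<close>

lemma norm_cis_diff_le: "cmod (cis a - cis b) \<le> \<bar>a - b\<bar>"
proof -
  have "cis a - cis b = cis b * (cis (a - b) - 1)" by (simp add: algebra_simps cis_mult)
  hence "cmod (cis a - cis b) = dist (exp (\<i> * of_real (a - b))) 1" by (simp add: norm_mult dist_norm cis_conv_exp)
  also have "\<dots> = 2 * \<bar>sin ((a - b) / 2)\<bar>" using dist_exp_i_1[of "a - b"] by (simp add: dist_norm)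
  also have "\<dots> \<le> 2 * \<bar>(a - b) / 2\<bar>" using abs_sin_x_le_abs_x[of "(a-b)/2"] by simp
  finally show ?thesis by simp
qed

definition sector_pts :: "complex set \<Rightarrow> real \<Rightarrow> real \<Rightarrow> real \<Rightarrow> complex set" where
  "sector_pts \<Lambda> R \<theta> \<theta>' = {z \<in> \<Lambda>. cmod z < R \<and> (\<exists>t. \<theta> < t \<and> t \<le> \<theta>' \<and> is_Arg z t)}"

lemma is_Arg_interval_exists: "\<exists>t. 0 < t \<and> t \<le> 2 * pi \<and> is_Arg z t"
proof (cases "Arg2pi z = 0")
  case True
  have "is_Arg z (Arg2pi z)" using Arg2pi by blast
  hence "is_Arg z (2 * pi)" unfolding True is_Arg_def cis_conv_exp[symmetric] by simp
  thus ?thesis by (intro exI[of _ "2*pi"]) auto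
next
  case False
  thus ?thesis using Arg2pi[of z] by (intro exI[of _ "Arg2pi z"]) auto
qed

lemma is_Arg_unique:
  assumes "z \<noteq> 0" "is_Arg z s" "is_Arg z t" "0 < s" "s \<le> 2 * pi" "0 < t" "t \<le> 2 * pi"
  shows "s = t"
proof -
  have "exp (\<i> * of_real s) = exp (\<i> * of_real t)" using assms(1-3)
  proof -
    have "of_real (cmod z) * exp (\<i> * of_real s) = of_real (cmod z) * exp (\<i> * of_real t)"
      using assms(2,3) unfolding is_Arg_def by (rule subst)
    thus ?thesis using assms(1) by simp
  qed
  then obtain n :: int where n: "s = t + 2 * pi * n" unfolding exp_eq
    by (auto simp: complex_eq_iff algebra_simps)
  have "\<bar>2 * pi * real_of_int n\<bar> < 2 * pi" using n assms by auto
  hence "\<bar>real_of_int n\<bar> < 1" by (simp add: abs_mult)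
  hence "n = 0" by linarith
  thus ?thesis using n by simp
qed

text \<open>Only countably many pairs of angles are exceptional, so a partition avoiding all of them exists.\<close>

lemma angular_partition:
  fixes m :: nat
  assumes A: "has_angular_density \<Lambda>" and m: "m \<ge> 2"
  obtains \<theta> :: "nat \<Rightarrow> real" where "\<theta> 0 = 0" "\<theta> m = 2 * pi"
     "\<And>i. i < m \<Longrightarrow> \<theta> i < \<theta> (Suc i)" "\<And>i. i < m \<Longrightarrow> \<theta> (Suc i) - \<theta> i \<le> 4 * pi / m"
     "\<And>i. i < m \<Longrightarrow> \<exists>d. ((\<lambda>R. real (card (sector_pts \<Lambda> R (\<theta> i) (\<theta> (Suc i)))) / R\<^sup>2) \<longlongrightarrow> d) at_top"
proof -
  define Ex where "Ex = {(\<theta>, \<theta>'). 0 \<le> \<theta> \<and> \<theta> < \<theta>' \<and> \<theta>' \<le> 2 * pi \<and>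
       \<not> (\<exists>d::real. ((\<lambda>r. real (sector_count \<Lambda> r \<theta> \<theta>') / (pi * r\<^sup>2)) \<longlongrightarrow> d) at_top)}"
  have Ex: "countable Ex" using A by (simp add: has_angular_density_def Ex_def)
  \<comment> \<open>An angle is discarded if it occurs as an endpoint of any exceptional pair.
    Replacing each grid point by an admissible angle at most half a step below it keeps the points
    in order and the intervals short.\<close>
  define bad where "bad = fst ` Ex \<union> snd ` Ex"
  have bad: "countable bad" unfolding bad_def using Ex by auto
  define w where "w = pi / real m"
  have m0: "real m > 0" using m by simp
  have w: "w > 0" "2 * w * real m = 2 * pi" "4 * pi / m = 4 * w" using m0 by (auto simp: w_def)
  define x where "x i = 2 * w * real i" for i
  have x: "x 0 = 0" "x m = 2 * pi" "x (Suc i) = x i + 2 * w" for i using w by (auto simp: x_def algebra_simps)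
  have xmono: "x i \<le> x j" if "i \<le> j" for i j using that w(1) by (auto simp: x_def)
  have ex: "\<exists>t. t \<in> {x i - w <..< x i} - bad" for i
  proof -
    have "uncountable {x i - w <..< x i}" using w(1) by (subst uncountable_open_interval) auto
    hence "uncountable ({x i - w <..< x i} - bad)" using bad by (rule uncountable_minus_countable)
    hence "{x i - w <..< x i} - bad \<noteq> {}" by (rule contrapos_nn) (simp only: countable_empty)
    thus ?thesis by blast
  qed
  define t where "t i = (SOME y. y \<in> {x i - w <..< x i} - bad)" for i
  have "t i \<in> {x i - w <..< x i} - bad" for i
    unfolding t_def by (rule someI_ex[OF ex])
  hence t: "x i - w < t i" "t i < x i" "t i \<notin> bad" for i by auto
  define \<theta> where "\<theta> i = (if i = 0 then 0 else if i = m then 2 * pi else t i)" for i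
  have lo: "x i - w < \<theta> i" for i using t(1)[of i] x w(1) by (auto simp: \<theta>_def)
  have hi: "\<theta> i \<le> x i" for i using t(2)[of i] x by (auto simp: \<theta>_def)
  have mono: "\<theta> i < \<theta> (Suc i)" for i using hi[of i] lo[of "Suc i"] x(3)[of i] w(1) by linarith
  show ?thesis
  proof (rule that[of \<theta>])
    show "\<theta> 0 = 0" "\<theta> m = 2 * pi" using m by (auto simp: \<theta>_def)
    show "\<theta> i < \<theta> (Suc i)" for i by (rule mono)
    show "\<theta> (Suc i) - \<theta> i \<le> 4 * pi / m" for i
      using lo[of i] hi[of "Suc i"] x(3)[of i] w by linarith
    show "\<exists>d. ((\<lambda>R. real (card (sector_pts \<Lambda> R (\<theta> i) (\<theta> (Suc i)))) / R\<^sup>2) \<longlongrightarrow> d) at_top" if i: "i < m" for i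
    proof -
      \<comment> \<open>The endpoints 0 and \<open>2 * pi\<close> are prescribed and may be bad.
        Since \<open>m \<ge> 2\<close>, every interval has another endpoint, and membership in
        \<open>Ex\<close> would make both of them bad.\<close>
      have "(\<theta> i, \<theta> (Suc i)) \<notin> Ex"
      proof
        assume "(\<theta> i, \<theta> (Suc i)) \<in> Ex"
        hence b: "\<theta> i \<in> bad" "\<theta> (Suc i) \<in> bad" unfolding bad_def by force+
        show False
        proof (cases "i = 0")
          case True
          hence "\<theta> (Suc i) = t (Suc i)" using m by (auto simp: \<theta>_def)
          thus ?thesis using b t by auto
        next
          case False
          hence "\<theta> i = t i" using i by (auto simp: \<theta>_def)
          thus ?thesis using b t by auto
        qed
      qed
      moreover have "0 \<le> \<theta> i"
      proof (cases "i = 0")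
        case False
        hence "x 1 \<le> x i" by (intro xmono) auto
        thus ?thesis using lo[of i] x(1) x(3)[of 0] w(1) by simp
      qed (auto simp: \<theta>_def)
      moreover have "\<theta> (Suc i) \<le> 2 * pi" using hi[of "Suc i"] xmono[of "Suc i" m] i x(2) by simp
      ultimately obtain d where "((\<lambda>r. real (sector_count \<Lambda> r (\<theta> i) (\<theta> (Suc i))) / (pi * r\<^sup>2)) \<longlongrightarrow> d) at_top"
        using mono[of i] unfolding Ex_def by auto
      hence "((\<lambda>r. pi * (real (sector_count \<Lambda> r (\<theta> i) (\<theta> (Suc i))) / (pi * r\<^sup>2))) \<longlongrightarrow> pi * d) at_top" by (intro tendsto_intros)
      thus ?thesis unfolding sector_count_def sector_pts_def by auto
    qed
  qed
qed

lemma partition_interval: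
  fixes \<theta> :: "nat \<Rightarrow> real"
  assumes "\<theta> 0 < t" "t \<le> \<theta> m"
  shows "\<exists>i<m. \<theta> i < t \<and> t \<le> \<theta> (Suc i)"
  using assms(2)
proof (induction m)
  case 0 thus ?case using assms(1) by simp
next
  case (Suc m)
  thus ?case by (cases "t \<le> \<theta> m") (auto simp: less_Suc_eq)
qed

text \<open>On each sector the direction is frozen at the lower angle. The resulting
  \<open>v\<close> is a fixed linear combination of sector counts and converges, while each point
  contributes an error of at most \<open>k\<close> times the width of its sector.\<close>

lemma angular_sum_approx:
  fixes m :: nat
  assumes A: "has_angular_density \<Lambda>" and m: "m \<ge> 2"
  shows "\<exists>v L. (v \<longlongrightarrow> L) at_top \<and> (\<forall>R>0. cmod ((\<Sum>z\<in>pts_below (\<Lambda> - {0}) R. cnj (sgn z) ^ k) / of_real (R\<^sup>2) - v R)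
           \<le> (real k * (4 * pi / m)) * (real (card (pts_below (\<Lambda> - {0}) R)) / R\<^sup>2) + m / R\<^sup>2)"
proof -
  obtain \<theta> where \<theta>: "\<theta> 0 = 0" "\<theta> m = 2 * pi" "\<And>i. i < m \<Longrightarrow> \<theta> i < \<theta> (Suc i)" "\<And>i. i < m \<Longrightarrow> \<theta> (Suc i) - \<theta> i \<le> 4 * pi / m"
     "\<And>i. i < m \<Longrightarrow> \<exists>d. ((\<lambda>R. real (card (sector_pts \<Lambda> R (\<theta> i) (\<theta> (Suc i)))) / R\<^sup>2) \<longlongrightarrow> d) at_top"
    using angular_partition[OF A m] by blast
  have mono: "\<theta> i \<le> \<theta> j" if "i \<le> j" "j \<le> m" for i j
    using that(1,2)
  proof (induction j rule: dec_induct)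
    case (step n) thus ?case using \<theta>(3)[of n] by auto
  qed auto
  obtain d where d: "\<And>i. i < m \<Longrightarrow> ((\<lambda>R. real (card (sector_pts \<Lambda> R (\<theta> i) (\<theta> (Suc i)))) / R\<^sup>2) \<longlongrightarrow> d i) at_top"
    using \<theta>(5) by metis
  define S where "S R i = sector_pts \<Lambda> R (\<theta> i) (\<theta> (Suc i))" for R i
  define c where "c i = cis (- real k * \<theta> i)" for i
  define v where "v R = (\<Sum>i<m. c i * of_real (real (card (S R i)) / R\<^sup>2))" for R
  have fin: "finite {z\<in>\<Lambda>. cmod z < R}" for R using A by (simp add: has_angular_density_def)
  have finS: "finite (S R i)" for R i unfolding S_def sector_pts_def by (rule finite_subset[OF _ fin[of R]]) auto
  have bnds: "0 \<le> \<theta> i" "\<theta> (Suc i) \<le> 2 * pi" if "i < m" for i using mono[of 0 i] mono[of "Suc i" m] that \<theta> by auto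
  have "(v \<longlongrightarrow> (\<Sum>i<m. c i * of_real (d i))) at_top" unfolding v_def S_def by (intro tendsto_intros d) auto
  moreover have "cmod ((\<Sum>z\<in>pts_below (\<Lambda> - {0}) R. cnj (sgn z) ^ k) / of_real (R\<^sup>2) - v R)
           \<le> (real k * (4 * pi / m)) * (real (card (pts_below (\<Lambda> - {0}) R)) / R\<^sup>2) + m / R\<^sup>2" if R: "R > 0" for R
  proof -
    have un: "pts_below (\<Lambda> - {0}) R = (\<Union>i<m. S R i - {0})"
    proof (intro equalityI subsetI)
      fix z assume z: "z \<in> pts_below (\<Lambda> - {0}) R"
      obtain t where t: "0 < t" "t \<le> 2 * pi" "is_Arg z t" using is_Arg_interval_exists by blast
      obtain i where "i < m" "\<theta> i < t" "t \<le> \<theta> (Suc i)" using partition_interval[of \<theta> t m] t \<theta> by auto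
      thus "z \<in> (\<Union>i<m. S R i - {0})" using z t unfolding S_def sector_pts_def pts_below_def by auto
    qed (auto simp: S_def sector_pts_def pts_below_def)
    have disj: "(S R i - {0}) \<inter> (S R j - {0}) = {}" if "i < m" "j < m" "i < j" for i j
    proof -
      have False if z: "z \<in> S R i" "z \<in> S R j" "z \<noteq> 0" for z
      proof -
        obtain s t where s: "\<theta> i < s" "s \<le> \<theta> (Suc i)" "is_Arg z s" and t: "\<theta> j < t" "t \<le> \<theta> (Suc j)" "is_Arg z t"
          using z unfolding S_def sector_pts_def by auto
        have "s = t" using s t bnds[OF \<open>i < m\<close>] bnds[OF \<open>j < m\<close>] z by (intro is_Arg_unique[of z]) auto
        moreover have "\<theta> (Suc i) \<le> \<theta> j" using \<open>i < j\<close> \<open>j < m\<close> by (intro mono) auto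
        ultimately show False using s t by linarith
      qed
      thus ?thesis by blast
    qed
    have disj': "\<forall>i\<in>{..<m}. \<forall>j\<in>{..<m}. i \<noteq> j \<longrightarrow> (S R i - {0}) \<inter> (S R j - {0}) = {}"
    proof (intro ballI impI)
      fix i j assume "i \<in> {..<m}" "j \<in> {..<m}" "i \<noteq> j"
      thus "(S R i - {0}) \<inter> (S R j - {0}) = {}" using disj[of i j] disj[of j i] by (cases "i < j") auto
    qed
    have sumU: "(\<Sum>z\<in>pts_below (\<Lambda> - {0}) R. f z) = (\<Sum>i<m. \<Sum>z\<in>S R i - {0}. f z)" for f :: "complex \<Rightarrow> complex"
      unfolding un by (rule sum.UNION_disjoint) (use finS disj' in auto)
    have cardU: "card (pts_below (\<Lambda> - {0}) R) = (\<Sum>i<m. card (S R i - {0}))"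
      unfolding un by (rule card_UN_disjoint) (use finS disj' in auto)
    have piece: "cmod ((\<Sum>z\<in>S R i - {0}. cnj (sgn z) ^ k) - c i * of_real (real (card (S R i)))) \<le> real k * (4 * pi / m) * real (card (S R i - {0})) + 1" if i: "i < m" for i
    proof -
      have pt: "cmod (cnj (sgn z) ^ k - c i) \<le> real k * (4 * pi / m)" if z: "z \<in> S R i - {0}" for z
      proof -
        obtain t where t: "\<theta> i < t" "t \<le> \<theta> (Suc i)" "is_Arg z t" using z unfolding S_def sector_pts_def by auto
        have "z = of_real (cmod z) * cis t" using t(3) unfolding is_Arg_def cis_conv_exp .
        hence "sgn z = cis t"
        proof -
          have "cmod z \<noteq> 0" using z by auto
          hence "z / of_real (cmod z) = cis t" using \<open>z = of_real (cmod z) * cis t\<close>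
            by (metis nonzero_mult_div_cancel_left of_real_eq_0_iff)
          thus ?thesis by (simp add: sgn_eq)
        qed
        moreover have "cis (- t) ^ k = cis (real k * (- t))" by (rule Complex.DeMoivre)
        ultimately have sg: "cnj (sgn z) ^ k = cis (- real k * t)" by (simp add: cis_cnj)
        have "cmod (cnj (sgn z) ^ k - c i) \<le> \<bar>- real k * t - - real k * \<theta> i\<bar>"
          unfolding c_def sg by (rule norm_cis_diff_le)
        also have "\<dots> = real k * (t - \<theta> i)" using t by (simp add: abs_mult flip: right_diff_distrib)
        also have "\<dots> \<le> real k * (4 * pi / m)" using t \<theta>(4)[OF i] by (intro mult_left_mono) auto
        finally show ?thesis .
      qed
      \<comment> \<open>Every angle is an argument of the origin, so the origin may be counted in
        all sectors. This is the 1 per sector and thus the term \<open>m / R^2\<close>.\<close>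
      have "card (S R i) = card (S R i - {0}) + (if 0 \<in> S R i then 1 else 0)"
        using card.remove[OF finS[of R i], of 0] by auto
      hence ci: "c i * of_real (real (card (S R i))) = (\<Sum>z\<in>S R i - {0}. c i) + (if 0 \<in> S R i then c i else 0)" by (simp add: algebra_simps)
      have "(\<Sum>z\<in>S R i - {0}. cnj (sgn z) ^ k) - c i * of_real (real (card (S R i))) = (\<Sum>z\<in>S R i - {0}. cnj (sgn z) ^ k - c i) - (if 0 \<in> S R i then c i else 0)"
        unfolding ci sum_subtractf by simp
      also have "cmod \<dots> \<le> cmod (\<Sum>z\<in>S R i - {0}. cnj (sgn z) ^ k - c i) + cmod (if 0 \<in> S R i then c i else 0)" by (rule norm_triangle_ineq4)
      also have "\<dots> \<le> real (card (S R i - {0})) * (real k * (4 * pi / m)) + 1"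
        using pt by (intro add_mono sum_norm_bound) (auto simp: c_def)
      finally show ?thesis by (simp add: mult_ac)
    qed
    have vR: "v R = (\<Sum>i<m. c i * of_real (real (card (S R i)))) / of_real (R\<^sup>2)" unfolding v_def sum_divide_distrib by simp
    have "cmod ((\<Sum>z\<in>pts_below (\<Lambda> - {0}) R. cnj (sgn z) ^ k) - (\<Sum>i<m. c i * of_real (real (card (S R i)))))
       \<le> (\<Sum>i<m. real k * (4 * pi / m) * real (card (S R i - {0})) + 1)"
      unfolding sumU sum_subtractf[symmetric] using piece by (intro order_trans[OF norm_sum] sum_mono) auto
    also have "\<dots> = real k * (4 * pi / m) * real (card (pts_below (\<Lambda> - {0}) R)) + m"
      unfolding cardU by (simp add: sum.distrib sum_distrib_left)
    finally have "cmod ((\<Sum>z\<in>pts_below (\<Lambda> - {0}) R. cnj (sgn z) ^ k) - (\<Sum>i<m. c i * of_real (real (card (S R i))))) / R\<^sup>2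
       \<le> (real k * (4 * pi / m) * real (card (pts_below (\<Lambda> - {0}) R)) + m) / R\<^sup>2" by (intro divide_right_mono) auto
    thus ?thesis unfolding vR diff_divide_distrib[symmetric] by (simp add: norm_divide norm_power add_divide_distrib)
  qed
  ultimately show ?thesis by blast
qed

text \<open>The pair of angles 0 and \<open>2 * pi\<close> may itself be exceptional, so the limit
  that defines the density has to be derived. The case \<open>k = 0\<close> with two sectors
  provides it, since freezing the direction then costs nothing and only the origin is
  miscounted.\<close>

lemma angular_density_limits:
  assumes A: "has_angular_density \<Lambda>"
  shows "((\<lambda>R. real (card (pts_below (\<Lambda> - {0}) R)) / R\<^sup>2) \<longlongrightarrow> pi * density_of \<Lambda>) at_top"
    and "\<exists>\<tau>. ((\<lambda>R. (\<Sum>z\<in>pts_below (\<Lambda> - {0}) R. cnj (sgn z) ^ k) / of_real (R\<^sup>2)) \<longlongrightarrow> \<tau>) at_top"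
proof -
  have lim0: "((\<lambda>R. c / R\<^sup>2) \<longlongrightarrow> 0) at_top" for c :: real by real_asymp
  have fin: "finite {z\<in>\<Lambda>. cmod z < R}" for R using A by (simp add: has_angular_density_def)
  obtain v L where vL: "(v \<longlongrightarrow> L) at_top" "\<And>R. R > 0 \<Longrightarrow> cmod ((\<Sum>z\<in>pts_below (\<Lambda> - {0}) R. cnj (sgn z) ^ 0) / of_real (R\<^sup>2) - v R) \<le> 2 / R\<^sup>2"
    using angular_sum_approx[OF A, of 2 0] by auto
  have "((\<lambda>R. (\<Sum>z\<in>pts_below (\<Lambda> - {0}) R. cnj (sgn z) ^ 0) / of_real (R\<^sup>2) - v R) \<longlongrightarrow> 0) at_top"
    by (rule Lim_null_comparison[OF _ lim0[of 2]]) (use eventually_gt_at_top[of 0] in eventually_elim, use vL in auto)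
  from tendsto_add[OF this vL(1)] have "((\<lambda>R. of_real (real (card (pts_below (\<Lambda> - {0}) R)) / R\<^sup>2)) \<longlongrightarrow> L) at_top" by simp
  from tendsto_Re[OF this] have N: "((\<lambda>R. real (card (pts_below (\<Lambda> - {0}) R)) / R\<^sup>2) \<longlongrightarrow> Re L) at_top" by simp
  have sc: "real (sector_count \<Lambda> R 0 (2 * pi)) = real (card (pts_below (\<Lambda> - {0}) R)) + (if 0 \<in> \<Lambda> then 1 else 0)" if "R > 0" for R
  proof -
    have "{z \<in> \<Lambda>. cmod z < R \<and> (\<exists>t. 0 < t \<and> t \<le> 2 * pi \<and> is_Arg z t)} = {z \<in> \<Lambda>. cmod z < R}" using is_Arg_interval_exists by auto
    moreover have "{z \<in> \<Lambda>. cmod z < R} = pts_below (\<Lambda> - {0}) R \<union> (if 0 \<in> \<Lambda> then {0} else {})" using that by (auto simp: pts_below_def)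
    moreover have "finite (pts_below (\<Lambda> - {0}) R)" by (rule finite_subset[OF _ fin[of R]]) (auto simp: pts_below_def)
    ultimately show ?thesis unfolding sector_count_def by (auto simp: pts_below_def)
  qed
  have "((\<lambda>R. (real (card (pts_below (\<Lambda> - {0}) R)) / R\<^sup>2 + (if 0 \<in> \<Lambda> then 1 else 0) / R\<^sup>2) / pi) \<longlongrightarrow> (Re L + 0) / pi) at_top"
    by (intro tendsto_divide tendsto_add N lim0 tendsto_const) auto
  moreover have "eventually (\<lambda>R. (real (card (pts_below (\<Lambda> - {0}) R)) / R\<^sup>2 + (if 0 \<in> \<Lambda> then 1 else 0) / R\<^sup>2) / pi = real (sector_count \<Lambda> R 0 (2 * pi)) / (pi * R\<^sup>2)) at_top"
    using eventually_gt_at_top[of 0]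
  proof eventually_elim
    case (elim R)
    show ?case unfolding sc[OF elim] by (simp add: add_divide_distrib mult.commute)
  qed
  ultimately have "((\<lambda>R. real (sector_count \<Lambda> R 0 (2 * pi)) / (pi * R\<^sup>2)) \<longlongrightarrow> (Re L + 0) / pi) at_top" by (rule Lim_transform_eventually)
  hence "density_of \<Lambda> = (Re L + 0) / pi" unfolding density_of_def angular_density_def by (intro tendsto_Lim) auto
  hence reL: "Re L = pi * density_of \<Lambda>" by simp
  thus "((\<lambda>R. real (card (pts_below (\<Lambda> - {0}) R)) / R\<^sup>2) \<longlongrightarrow> pi * density_of \<Lambda>) at_top" using N by simp
  show "\<exists>\<tau>. ((\<lambda>R. (\<Sum>z\<in>pts_below (\<Lambda> - {0}) R. cnj (sgn z) ^ k) / of_real (R\<^sup>2)) \<longlongrightarrow> \<tau>) at_top"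
  proof (rule convergent_at_top_approx)
    fix e :: real assume e: "e > 0"
    have "((\<lambda>m. real k * (4 * pi / real m) * (Re L + 1)) \<longlongrightarrow> 0) sequentially"
    proof -
      have "((\<lambda>m. (real k * (4 * pi) * (Re L + 1)) / real m) \<longlongrightarrow> 0) sequentially" by (rule lim_const_over_n)
      thus ?thesis by (simp add: mult_ac)
    qed
    hence "eventually (\<lambda>m. real k * (4 * pi / real m) * (Re L + 1) < e/2) sequentially" using e by (intro order_tendstoD) auto
    hence "eventually (\<lambda>m. m \<ge> 2 \<and> real k * (4 * pi / real m) * (Re L + 1) < e/2) sequentially" using eventually_ge_at_top[of 2] by eventually_elim auto
    then obtain m where m: "m \<ge> 2" "real k * (4 * pi / real m) * (Re L + 1) < e/2" by (auto simp: eventually_sequentially)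
    obtain v L' where v: "(v \<longlongrightarrow> L') at_top" "\<And>R. R > 0 \<Longrightarrow> cmod ((\<Sum>z\<in>pts_below (\<Lambda> - {0}) R. cnj (sgn z) ^ k) / of_real (R\<^sup>2) - v R)
           \<le> (real k * (4 * pi / m)) * (real (card (pts_below (\<Lambda> - {0}) R)) / R\<^sup>2) + m / R\<^sup>2"
      using angular_sum_approx[OF A m(1), of k] by auto
    have "eventually (\<lambda>R. real (card (pts_below (\<Lambda> - {0}) R)) / R\<^sup>2 < Re L + 1) at_top" using N by (rule order_tendstoD) simp
    moreover have "eventually (\<lambda>R. m / R\<^sup>2 < e/2) at_top" using lim0[of m] e by (intro order_tendstoD) auto
    ultimately have "eventually (\<lambda>R. dist ((\<Sum>z\<in>pts_below (\<Lambda> - {0}) R. cnj (sgn z) ^ k) / of_real (R\<^sup>2)) (v R) \<le> e) at_top"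
      using eventually_gt_at_top[of 0]
    proof eventually_elim
      case (elim R)
      have "(real k * (4 * pi / m)) * (real (card (pts_below (\<Lambda> - {0}) R)) / R\<^sup>2) \<le> (real k * (4 * pi / m)) * (Re L + 1)"
        using elim by (intro mult_left_mono) auto
      thus ?case unfolding dist_norm using v(2)[OF elim(3)] m(2) elim(2) by linarith
    qed
    thus "\<exists>v L. (v \<longlongrightarrow> L) at_top \<and> eventually (\<lambda>R. dist ((\<Sum>z\<in>pts_below (\<Lambda> - {0}) R. cnj (sgn z) ^ k) / of_real (R\<^sup>2)) (v R) \<le> e) at_top"
      using v(1) by blast
  qed
qed

section \<open>Extremal directions\<close>

lemma sin_ge_chord:
  fixes x :: real assumes "0 \<le> x" "x \<le> pi/2" shows "2 / pi * x \<le> sin x"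
proof -
  have "concave_on {0..pi} sin"
    unfolding concave_on_def
  proof (rule f''_ge0_imp_convex[where f' = "\<lambda>x. - cos x" and f'' = sin])
    fix x :: real assume "x \<in> {0..pi}"
    thus "sin x \<ge> 0" by (auto intro: sin_ge_zero)
  qed (auto intro!: derivative_eq_intros)
  from concave_onD[OF this, of "2 / pi * x" 0 "pi/2"] show ?thesis using assms by (auto simp: field_simps)
qed

text \<open>Between neighbouring points of \<open>E\<close>, at distance \<open>l \<le> \<pi>/2\<close>, the bounds from both ends give
  an increment of \<open>A\<close> of at least \<open>\<pi>/2 \<sqdot> sin l \<ge> l\<close>.\<close>

lemma increment_between_maxima:
  fixes a A :: "real \<Rightarrow> real"
  assumes A: "\<And>x. (A has_real_derivative a x) (at x)"
    and E: "\<And>u. 0 < \<bar>u\<bar> \<Longrightarrow> \<bar>u\<bar> \<le> pi/4 \<Longrightarrow> a (\<theta> + u) \<ge> pi/2 * cos (2 * u)"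
       "\<And>u. 0 < \<bar>u\<bar> \<Longrightarrow> \<bar>u\<bar> \<le> pi/4 \<Longrightarrow> a (\<theta>' + u) \<ge> pi/2 * cos (2 * u)"
    and t: "\<theta> < \<theta>'" "\<theta>' \<le> \<theta> + pi/2"
  shows "A \<theta>' - A \<theta> \<ge> \<theta>' - \<theta>"
proof -
  define l where "l = (\<theta>' - \<theta>) / 2"
  have l: "0 < l" "l \<le> pi/4" using t by (auto simp: l_def)
  have der: "((\<lambda>u. A (x + u) - pi/4 * sin (2 * u)) has_real_derivative (a (x + u) - pi/2 * cos (2 * u))) (at u)" for x u
  proof -
    have "((\<lambda>u. A (x + u)) has_real_derivative a (x + u) * 1) (at u)"
      by (rule DERIV_chain2[OF A]) (auto intro!: derivative_eq_intros)
    thus ?thesis by (auto intro!: derivative_eq_intros)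
  qed
  \<comment> \<open>The bound on \<open>a\<close> holds for \<open>u \<noteq> 0\<close> only;
    nonnegativity of the derivative on the open interval is enough for a continuous
    function.\<close>
  have "A (\<theta> + 0) - pi/4 * sin (2 * 0) \<le> A (\<theta> + l) - pi/4 * sin (2 * l)"
  proof (rule DERIV_nonneg_imp_increasing_open[where f = "\<lambda>u. A (\<theta> + u) - pi/4 * sin (2 * u)", OF less_imp_le[OF l(1)]])
    show "\<exists>y. ((\<lambda>u. A (\<theta> + u) - pi/4 * sin (2 * u)) has_real_derivative y) (at u) \<and> 0 \<le> y" if "0 < u" "u < l" for u
      using der[of \<theta> u] E(1)[of u] that l by (intro exI[of _ "a (\<theta> + u) - pi/2 * cos (2 * u)"]) auto
    show "continuous_on {0..l} (\<lambda>u. A (\<theta> + u) - pi/4 * sin (2 * u))"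
      using der by (intro DERIV_continuous_on) (auto intro: has_field_derivative_at_within)
  qed
  moreover have "A (\<theta>' + - l) - pi/4 * sin (2 * - l) \<le> A (\<theta>' + 0) - pi/4 * sin (2 * 0)"
  proof (rule DERIV_nonneg_imp_increasing_open[where f = "\<lambda>u. A (\<theta>' + u) - pi/4 * sin (2 * u)"])
    show "- l \<le> 0" using l by simp
    show "\<exists>y. ((\<lambda>u. A (\<theta>' + u) - pi/4 * sin (2 * u)) has_real_derivative y) (at u) \<and> 0 \<le> y" if "- l < u" "u < 0" for u
      using der[of \<theta>' u] E(2)[of u] that l by (intro exI[of _ "a (\<theta>' + u) - pi/2 * cos (2 * u)"]) auto
    show "continuous_on {- l..0} (\<lambda>u. A (\<theta>' + u) - pi/4 * sin (2 * u))"
      using der by (intro DERIV_continuous_on) (auto intro: has_field_derivative_at_within)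
  qed
  moreover have "\<theta> + l = \<theta>' + - l" by (simp add: l_def field_simps)
  ultimately have "A \<theta>' - A \<theta> \<ge> pi/2 * sin (2 * l)" by simp
  moreover have "pi/2 * sin (2 * l) \<ge> pi/2 * (2 / pi * (2 * l))" using sin_ge_chord[of "2 * l"] l by (intro mult_left_mono) auto
  ultimately show ?thesis by (simp add: l_def)
qed

text \<open>Averaging is replaced by growth over the whole line: \<open>A x - x\<close> stays above
  its initial value on an unbounded part of \<open>E\<close>, which a linear bound of slope
  \<open>m < 1\<close> would forbid. A supremum is used in place of an enumeration of the chain
  because successive gaps have no positive lower bound; closedness of \<open>E\<close> lets the
  chain continue past a point of accumulation.\<close>

lemma mean_ge_one_of_chain:
  fixes a A :: "real \<Rightarrow> real"
  assumes A: "\<And>x. (A has_real_derivative a x) (at x)"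
    and cl: "closed E" and ne: "E \<noteq> {}"
    and E: "\<And>\<theta> u. \<theta> \<in> E \<Longrightarrow> 0 < \<bar>u\<bar> \<Longrightarrow> \<bar>u\<bar> \<le> pi/4 \<Longrightarrow> a (\<theta> + u) \<ge> pi/2 * cos (2 * u)"
    and nxt: "\<And>\<theta>. \<theta> \<in> E \<Longrightarrow> \<exists>\<theta>'\<in>E. \<theta> < \<theta>' \<and> \<theta>' \<le> \<theta> + pi/2"
    and mean: "\<And>x. A x \<le> m * x + K"
  shows "m \<ge> 1"
proof -
  obtain \<theta>0 where \<theta>0: "\<theta>0 \<in> E" using ne by blast
  define S where "S = {x \<in> E. x \<ge> \<theta>0 \<and> A x - x \<ge> A \<theta>0 - \<theta>0}"
  have S: "\<theta>0 \<in> S" using \<theta>0 by (simp add: S_def)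
  have contA: "continuous_on UNIV A" using A by (intro DERIV_continuous_on) (auto intro: has_field_derivative_at_within)
  have "closed ({x. x \<ge> \<theta>0} \<inter> {x. A x - x \<ge> A \<theta>0 - \<theta>0})"
    by (intro closed_Int closed_Collect_le continuous_intros contA)
  hence "closed (E \<inter> ({x. x \<ge> \<theta>0} \<inter> {x. A x - x \<ge> A \<theta>0 - \<theta>0}))" by (rule closed_Int[OF cl])
  moreover have "S = E \<inter> ({x. x \<ge> \<theta>0} \<inter> {x. A x - x \<ge> A \<theta>0 - \<theta>0})" by (auto simp: S_def)
  ultimately have clS: "closed S" by simp
  have unb: "\<not> bdd_above S"
  proof
    assume bd: "bdd_above S"
    have sup: "Sup S \<in> S" using clS S bd by (intro closed_contains_Sup) auto
    then obtain \<theta>' where \<theta>': "\<theta>' \<in> E" "Sup S < \<theta>'" "\<theta>' \<le> Sup S + pi/2" using nxt[of "Sup S"] by (auto simp: S_def)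
    have "A \<theta>' - A (Sup S) \<ge> \<theta>' - Sup S"
      using sup \<theta>' by (intro increment_between_maxima[OF A E E]) (auto simp: S_def)
    hence "\<theta>' \<in> S" using sup \<theta>' by (auto simp: S_def)
    hence "\<theta>' \<le> Sup S" using bd by (intro cSup_upper)
    thus False using \<theta>' by simp
  qed
  show ?thesis
  proof (rule ccontr)
    assume "\<not> m \<ge> 1"
    hence m: "1 - m > 0" by simp
    define x0 where "x0 = (K - (A \<theta>0 - \<theta>0)) / (1 - m) + 1"
    obtain x where x: "x \<in> S" "x > x0" using unb unfolding bdd_above_def by (meson not_le)
    have "A \<theta>0 - \<theta>0 \<le> m * x + K - x" using x(1) mean[of x] by (auto simp: S_def)
    hence "(1 - m) * x \<le> K - (A \<theta>0 - \<theta>0)" by (simp add: algebra_simps)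
    moreover have "(1 - m) * x > (1 - m) * x0" using x m by (intro mult_strict_left_mono)
    moreover have "(1 - m) * x0 = K - (A \<theta>0 - \<theta>0) + (1 - m)" using m by (simp add: x0_def distrib_left)
    ultimately show False using m by linarith
  qed
qed

text \<open>The bound is required in a neighbourhood of the direction, with the same
  \<open>e\<close> as width and as gain. This makes subextremality an open condition and allows
  compactness to produce a uniform bound on intervals.\<close>

definition subextremal_angle :: "(complex \<Rightarrow> complex) \<Rightarrow> real \<Rightarrow> bool" where
  "subextremal_angle f \<theta> \<longleftrightarrow> (\<exists>e>0. \<exists>C\<ge>0. \<forall>r\<ge>0. \<forall>\<theta>'. \<bar>\<theta>' - \<theta>\<bar> < e \<longrightarrow> cmod (f (rcis r \<theta>')) \<le> C * exp ((pi/2 - e) * r\<^sup>2))"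

lemma subextremal_angleI:
  assumes "e > 0" "C \<ge> 0" "\<And>r \<theta>'. r \<ge> 0 \<Longrightarrow> \<bar>\<theta>' - \<theta>\<bar> < e \<Longrightarrow> cmod (f (rcis r \<theta>')) \<le> C * exp ((pi/2 - e) * r\<^sup>2)"
  shows "subextremal_angle f \<theta>"
  unfolding subextremal_angle_def using assms by blast

definition subextremal_between :: "(complex \<Rightarrow> complex) \<Rightarrow> real \<Rightarrow> real \<Rightarrow> bool" where
  "subextremal_between f \<alpha> \<beta> \<longleftrightarrow> (\<exists>e>0. \<exists>C\<ge>0. \<forall>r\<ge>0. \<forall>\<theta>. \<alpha> \<le> \<theta> \<longrightarrow> \<theta> \<le> \<beta> \<longrightarrow> cmod (f (rcis r \<theta>)) \<le> C * exp ((pi/2 - e) * r\<^sup>2))"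

lemma subextremal_betweenI:
  assumes "e > 0" "C \<ge> 0" "\<And>r \<theta>. r \<ge> 0 \<Longrightarrow> \<alpha> \<le> \<theta> \<Longrightarrow> \<theta> \<le> \<beta> \<Longrightarrow> cmod (f (rcis r \<theta>)) \<le> C * exp ((pi/2 - e) * r\<^sup>2)"
  shows "subextremal_between f \<alpha> \<beta>"
  unfolding subextremal_between_def using assms by blast

lemma rcis_minus: "rcis r (- \<theta>) = cnj (rcis r \<theta>)"
  by (simp add: complex_eq_iff)

lemma subextremal_angle_near:
  assumes "subextremal_angle f \<theta>"
  shows "\<exists>e>0. \<forall>\<theta>'. \<bar>\<theta>' - \<theta>\<bar> < e \<longrightarrow> subextremal_angle f \<theta>'"
proof -
  obtain e C where e: "e > 0" "C \<ge> 0" "\<And>r \<theta>'. r \<ge> 0 \<Longrightarrow> \<bar>\<theta>' - \<theta>\<bar> < e \<Longrightarrow> cmod (f (rcis r \<theta>')) \<le> C * exp ((pi/2 - e) * r\<^sup>2)"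
    using assms unfolding subextremal_angle_def by blast
  have "subextremal_angle f \<theta>'" if "\<bar>\<theta>' - \<theta>\<bar> < e/2" for \<theta>'
  proof (rule subextremal_angleI[of "e/2" C])
    fix r \<theta>'' assume r: "(r::real) \<ge> 0" and t: "\<bar>\<theta>'' - \<theta>'\<bar> < e/2"
    have "\<bar>\<theta>'' - \<theta>\<bar> < e" using t that by linarith
    hence "cmod (f (rcis r \<theta>'')) \<le> C * exp ((pi/2 - e) * r\<^sup>2)" using r by (intro e(3))
    also have "\<dots> \<le> C * exp ((pi/2 - e/2) * r\<^sup>2)" using e by (intro mult_left_mono iffD2[OF exp_le_cancel_iff] mult_right_mono) auto
    finally show "cmod (f (rcis r \<theta>'')) \<le> C * exp ((pi/2 - e/2) * r\<^sup>2)" .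
  qed (use e in auto)
  thus ?thesis using e(1) by (intro exI[of _ "e/2"]) auto
qed

text \<open>Compactness by bisection: gluing two intervals costs the larger constant and the smaller
  gain.\<close>

lemma subextremal_interval:
  assumes "\<alpha> \<le> \<beta>" and good: "\<And>\<theta>. \<alpha> \<le> \<theta> \<Longrightarrow> \<theta> \<le> \<beta> \<Longrightarrow> subextremal_angle f \<theta>"
  shows "subextremal_between f \<alpha> \<beta>"
  using assms(1)
proof (induction \<alpha> \<beta> rule: Bolzano)
  case (trans a b c)
  obtain e C where 1: "e > 0" "C \<ge> 0" "\<And>r \<theta>. r \<ge> 0 \<Longrightarrow> a \<le> \<theta> \<Longrightarrow> \<theta> \<le> b \<Longrightarrow> cmod (f (rcis r \<theta>)) \<le> C * exp ((pi/2 - e) * r\<^sup>2)"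
    using trans(1) unfolding subextremal_between_def by blast
  obtain e' C' where 2: "e' > 0" "C' \<ge> 0" "\<And>r \<theta>. r \<ge> 0 \<Longrightarrow> b \<le> \<theta> \<Longrightarrow> \<theta> \<le> c \<Longrightarrow> cmod (f (rcis r \<theta>)) \<le> C' * exp ((pi/2 - e') * r\<^sup>2)"
    using trans(2) unfolding subextremal_between_def by blast
  have le: "X * exp ((pi/2 - d) * r\<^sup>2) \<le> max C C' * exp ((pi/2 - min e e') * r\<^sup>2)" if "0 \<le> X" "X \<le> max C C'" "min e e' \<le> d" for X d r
    using that by (intro mult_mono iffD2[OF exp_le_cancel_iff] mult_right_mono) auto
  show ?case
  proof (rule subextremal_betweenI[of "min e e'" "max C C'"])
    fix r \<theta> assume r: "(r::real) \<ge> 0" and t: "a \<le> \<theta>" "\<theta> \<le> c"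
    show "cmod (f (rcis r \<theta>)) \<le> max C C' * exp ((pi/2 - min e e') * r\<^sup>2)"
      using 1(3)[OF r t(1)] 2(3)[OF r _ t(2)] le[of C e r] le[of C' e' r] 1 2 by (cases "\<theta> \<le> b") (auto intro: order_trans)
  qed (use 1 2 in auto)
next
  case (local x)
  obtain e C where e: "e > 0" "C \<ge> 0" "\<And>r \<theta>'. r \<ge> 0 \<Longrightarrow> \<bar>\<theta>' - x\<bar> < e \<Longrightarrow> cmod (f (rcis r \<theta>')) \<le> C * exp ((pi/2 - e) * r\<^sup>2)"
    using good[OF local] unfolding subextremal_angle_def by blast
  show ?case
  proof (rule exI[of _ e], intro conjI allI impI)
    fix a b assume "a \<le> x \<and> x \<le> b \<and> b - a < e"
    thus "subextremal_between f a b" using e by (intro subextremal_betweenI[of e C] e(3)) auto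
  qed fact
qed

text \<open>A bound for \<open>f\<close> on the ray \<open>\<theta>\<^sub>0 + u\<close> that is smaller than \<open>\<pi>/2 \<sqdot> cos 2u\<close> makes the sinusoid
  through \<open>(\<theta>\<^sub>0 - s, \<pi>/2)\<close> and \<open>(\<theta>\<^sub>0 + u, a)\<close> smaller than \<open>\<pi>/2\<close> at \<open>\<theta>\<^sub>0\<close> for small \<open>s\<close>.\<close>

lemma extremal_angle_lower_bound_pos:
  assumes f: "f holomorphic_on UNIV" and B: "\<And>z. cmod (f z) \<le> C * exp (pi/2 * (cmod z)\<^sup>2)"
    and bad: "\<not> subextremal_angle f \<theta>0" and u: "0 < u" "u \<le> pi/4"
    and ray: "\<And>r. r \<ge> 0 \<Longrightarrow> cmod (f (rcis r (\<theta>0 + u))) \<le> D * exp (a * r\<^sup>2)"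
  shows "pi/2 * cos (2 * u) \<le> a"
proof (rule ccontr)
  assume "\<not> pi/2 * cos (2 * u) \<le> a"
  hence a: "a < pi/2 * cos (2 * u)" by simp
  \<comment> \<open>Up to a positive factor, \<open>F s\<close> is the value at
    \<open>\<theta>0\<close> of that sinusoid minus \<open>pi/2\<close>. It vanishes at
    \<open>s = 0\<close>, where its derivative \<open>2 * a - pi * cos (2 * u)\<close> is negative
    by assumption.\<close>
  define F where "F s = pi/2 * sin (2 * u) + a * sin (2 * s) - pi/2 * sin (2 * (u + s))" for s
  have "(F has_real_derivative (2 * a - pi * cos (2 * u))) (at 0)" unfolding F_def
    by (auto intro!: derivative_eq_intros)
  hence "\<exists>d>0. \<forall>h>0. h < d \<longrightarrow> F (0 + h) < F 0" using a by (intro DERIV_neg_dec_right) auto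
  then obtain d where d: "d > 0" "\<And>h. 0 < h \<Longrightarrow> h < d \<Longrightarrow> F h < 0" by (auto simp: F_def)
  \<comment> \<open>As \<open>u \<le> pi/4\<close>, staying below \<open>pi/12\<close> keeps the
    opening \<open>u + s\<close> below the \<open>pi/3\<close> of
    \<open>sector_bound\<close>.\<close>
  define s where "s = min (d/2) (pi/24)"
  have s: "s > 0" "s < d" "s < pi/12" using d pi_gt_zero unfolding s_def by linarith+
  define C1 where "C1 = max C D"
  have C0: "C \<ge> 0" using B[of 0] norm_ge_zero[of "f 0"] by (simp del: norm_ge_zero)
  let ?\<alpha> = "\<theta>0 - s" and ?\<beta> = "\<theta>0 + u"
  define S where "S = sinusoid ?\<alpha> (pi/2) ?\<beta> a"
  have sn: "sin (2 * (?\<beta> - ?\<alpha>)) > 0" using u s by (intro sin_gt_zero) auto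
  have "S \<theta>0 < pi/2"
  proof -
    have "S \<theta>0 = (pi/2 * sin (2 * u) + a * sin (2 * s)) / sin (2 * (?\<beta> - ?\<alpha>))" unfolding S_def sinusoid_def by simp
    moreover have "pi/2 * sin (2 * u) + a * sin (2 * s) < pi/2 * sin (2 * (?\<beta> - ?\<alpha>))" using d(2)[OF s(1,2)] by (simp add: F_def add.commute)
    ultimately show ?thesis using sn by (simp add: divide_less_eq)
  qed
  moreover have "isCont S \<theta>0" unfolding S_def sinusoid_def[abs_def] using sn by (intro continuous_intros) auto
  ultimately obtain e where e: "e > 0" "\<And>\<theta>'. \<bar>\<theta>' - \<theta>0\<bar> < e \<Longrightarrow> S \<theta>' < pi/2 - (pi/2 - S \<theta>0) / 2"
  proof -
    assume *: "isCont S \<theta>0" "S \<theta>0 < pi/2" and th: "\<And>e. \<lbrakk>0 < e; \<And>\<theta>'. \<bar>\<theta>' - \<theta>0\<bar> < e \<Longrightarrow> S \<theta>' < pi / 2 - (pi / 2 - S \<theta>0) / 2\<rbrakk> \<Longrightarrow> thesis"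
    have "S \<theta>0 < pi/2 - (pi/2 - S \<theta>0) / 2" using *(2) by (simp add: field_simps)
    hence "eventually (\<lambda>x. S x < pi/2 - (pi/2 - S \<theta>0) / 2) (nhds \<theta>0)"
      using *(1) unfolding isCont_def tendsto_at_iff_tendsto_nhds by (intro order_tendstoD)
    thus thesis unfolding eventually_nhds_metric using th by (auto simp: dist_real_def)
  qed
  define m where "m = (pi/2 - S \<theta>0) / 2"
  have m: "m > 0" using \<open>S \<theta>0 < pi/2\<close> by (simp add: m_def)
  define e' where "e' = min e (min (min s u) m)"
  have e': "e' > 0" "e' \<le> e" "e' \<le> s" "e' \<le> u" "e' \<le> m" using e(1) s u m by (auto simp: e'_def)
  have le: "X * exp w \<le> C1 * exp w" if "X = C \<or> X = D" for X w using that by (intro mult_right_mono) (auto simp: C1_def)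
  have "subextremal_angle f \<theta>0"
  proof (rule subextremal_angleI[of e' C1])
    fix r \<theta> assume r: "(r::real) \<ge> 0" and t: "\<bar>\<theta> - \<theta>0\<bar> < e'"
    have "cmod (f (rcis r \<theta>)) \<le> C1 * exp (sinusoid ?\<alpha> (pi/2) ?\<beta> a \<theta> * r\<^sup>2)"
    proof (rule sector_bound[OF f])
      show "cmod (f z) \<le> C1 * exp (pi/2 * (cmod z)\<^sup>2)" for z using B[of z] le[of C] by (meson order_trans)
      show "cmod (f (rcis r (\<theta>0 - s))) \<le> C1 * exp (pi/2 * r\<^sup>2)" if "r \<ge> 0" for r
        using order_trans[OF B le[of C], of "rcis r (\<theta>0 - s)"] that by simp
      show "cmod (f (rcis r (\<theta>0 + u))) \<le> C1 * exp (a * r\<^sup>2)" if "r \<ge> 0" for r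
        using order_trans[OF ray[OF that] le[of D]] by simp
    qed (use u s t e' r in auto)
    also have "\<dots> \<le> C1 * exp ((pi/2 - e') * r\<^sup>2)"
    proof (intro mult_left_mono iffD2[OF exp_le_cancel_iff] mult_right_mono)
      have "S \<theta> < pi/2 - (pi/2 - S \<theta>0) / 2" using t e' by (intro e(2)) auto
      thus "sinusoid (\<theta>0 - s) (pi / 2) (\<theta>0 + u) a \<theta> \<le> pi/2 - e'" using e' unfolding S_def[symmetric] m_def by linarith
    qed (use C0 in \<open>auto simp: C1_def\<close>)
    finally show "cmod (f (rcis r \<theta>)) \<le> C1 * exp ((pi/2 - e') * r\<^sup>2)" .
  qed (use e' C0 in \<open>auto simp: C1_def\<close>)
  thus False using bad by simp
qed

lemma holomorphic_cnj_comp_cnj: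
  assumes f: "f holomorphic_on UNIV"
  shows "(cnj \<circ> f \<circ> cnj) holomorphic_on UNIV"
proof -
  have "((cnj \<circ> f \<circ> cnj) has_field_derivative cnj (deriv f (cnj z))) (at z)" for z
  proof -
    have 1: "(f has_derivative (\<lambda>h. deriv f (cnj z) * h)) (at (cnj z))"
      using holomorphic_derivI[OF f, of "cnj z"] by (simp add: has_field_derivative_def)
    have 2: "(cnj has_derivative cnj) (at x)" for x
      by (rule bounded_linear_imp_has_derivative[OF bounded_linear_cnj])
    have "(cnj \<circ> f \<circ> cnj has_derivative cnj \<circ> (\<lambda>h. deriv f (cnj z) * h) \<circ> cnj) (at z)"
      by (intro diff_chain_at 1 2)
    thus ?thesis by (simp add: has_field_derivative_def o_def)
  qed
  thus ?thesis by (auto simp: holomorphic_on_open)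
qed

lemma extremal_angle_lower_bound:
  assumes f: "f holomorphic_on UNIV" and B: "\<And>z. cmod (f z) \<le> C * exp (pi/2 * (cmod z)\<^sup>2)"
    and bad: "\<not> subextremal_angle f \<theta>0" and u: "0 < \<bar>u\<bar>" "\<bar>u\<bar> \<le> pi/4"
    and ray: "\<And>r. r \<ge> 0 \<Longrightarrow> cmod (f (rcis r (\<theta>0 + u))) \<le> D * exp (a * r\<^sup>2)"
  shows "pi/2 * cos (2 * u) \<le> a"
proof (cases "u > 0")
  case True
  thus ?thesis using u by (intro extremal_angle_lower_bound_pos[OF f B bad _ _ ray]) auto
next
  case False
  \<comment> \<open>Conjugation before and after keeps the function holomorphic and reflects the
    angles, which reverses the sign of \<open>u\<close>.\<close>
  let ?f = "cnj \<circ> f \<circ> cnj"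
  have mir: "cmod (?f (rcis r \<theta>)) = cmod (f (rcis r (- \<theta>)))" for r \<theta> by (simp add: rcis_minus)
  have "pi/2 * cos (2 * - u) \<le> a"
  proof (rule extremal_angle_lower_bound_pos[of ?f C "- \<theta>0" "- u" D a])
    show "?f holomorphic_on UNIV" using f by (rule holomorphic_cnj_comp_cnj)
    show "cmod (?f z) \<le> C * exp (pi/2 * (cmod z)\<^sup>2)" for z using B[of "cnj z"] by simp
    show "\<not> subextremal_angle ?f (- \<theta>0)"
    proof
      assume "subextremal_angle ?f (- \<theta>0)"
      then obtain e K where e: "e > 0" "K \<ge> 0" "\<And>r \<theta>'. r \<ge> 0 \<Longrightarrow> \<bar>\<theta>' - - \<theta>0\<bar> < e \<Longrightarrow> cmod (f (rcis r (- \<theta>'))) \<le> K * exp ((pi/2 - e) * r\<^sup>2)"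
        unfolding subextremal_angle_def mir by blast
      have "cmod (f (rcis r \<theta>')) \<le> K * exp ((pi/2 - e) * r\<^sup>2)" if "r \<ge> 0" "\<bar>\<theta>' - \<theta>0\<bar> < e" for r \<theta>'
        using e(3)[of r "- \<theta>'"] that by simp
      hence "subextremal_angle f \<theta>0" using e(1,2) by (intro subextremal_angleI[of e K])
      thus False using bad by simp
    qed
    show "cmod (?f (rcis r (- \<theta>0 + - u))) \<le> D * exp (a * r\<^sup>2)" if "r \<ge> 0" for r
      using ray[OF that] unfolding mir by (simp add: add.commute)
  qed (use False u in auto)
  thus ?thesis by simp
qed

text \<open>\<open>f\<close> is small on the interval and the multiplier \<open>H\<close> off it, so
  the product falls short of the extremal growth by order 4 everywhere. The factor
  \<open>z - p\<close> spends one order and completes the zeros to all of \<open>\<Lambda>\<close>;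
  uniqueness then annihilates a product that does not vanish at 0.\<close>

lemma no_long_subextremal_interval:
  assumes compl: "L2_complete (gabor (\<lambda>t. complex_of_real (exp (- pi * t\<^sup>2)))) A"
    and f: "f holomorphic_on UNIV" and B: "\<And>z. cmod (f z) \<le> C * exp (pi/2 * (cmod z)\<^sup>2)"
    and zero: "\<And>z. z \<in> to_complex ` A - {p} \<Longrightarrow> f z = 0" and f0: "f 0 \<noteq> 0"
    and ab: "\<alpha> + pi/2 < \<beta>"
  shows "\<not> subextremal_between f \<alpha> \<beta>"
proof
  assume "subextremal_between f \<alpha> \<beta>"
  then obtain e D where e: "e > 0" "D \<ge> 0" "\<And>r \<theta>. r \<ge> 0 \<Longrightarrow> \<alpha> \<le> \<theta> \<Longrightarrow> \<theta> \<le> \<beta> \<Longrightarrow> cmod (f (rcis r \<theta>)) \<le> D * exp ((pi/2 - e) * r\<^sup>2)"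
    unfolding subextremal_between_def by blast
  have e2: "e/2 > 0" using e by simp
  obtain H E where H: "H holomorphic_on UNIV" "H 0 \<noteq> 0" "\<And>z. cmod (H z) \<le> E * exp (e/2 * (cmod z)\<^sup>2)"
    "\<And>r \<theta>. r \<ge> 0 \<Longrightarrow> \<beta> \<le> \<theta> \<Longrightarrow> \<theta> \<le> \<alpha> + 2 * pi \<Longrightarrow> cmod (H (rcis r \<theta>)) \<le> E / (1 + r)^4"
    by (rule sector_multiplier[OF ab e2]) (rule that)
  \<comment> \<open>The gain \<open>e\<close> is shared: one half pays for the growth of
    \<open>H\<close>, the other for the factor \<open>(1 + r)^4\<close>.\<close>
  obtain K where K: "\<And>x. x \<ge> 0 \<Longrightarrow> (1 + x)^4 \<le> K * exp (e/2 * x\<^sup>2)" using power_le_exp_square[OF e2, of 4] by auto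
  have C0: "C \<ge> 0" using B[of 0] norm_ge_zero[of "f 0"] by (simp del: norm_ge_zero)
  have E0: "E \<ge> 0" using H(3)[of 0] norm_ge_zero[of "H 0"] by (simp del: norm_ge_zero)
  have K0: "K \<ge> 1" using K[of 0] by simp
  define M where "M = D * E * K + C * E"
  have fH: "cmod (f z * H z) \<le> M * exp (pi/2 * (cmod z)\<^sup>2) / (1 + cmod z)^4" for z
  proof -
    define r where "r = cmod z"
    have r: "r \<ge> 0" by (simp add: r_def)
    obtain \<theta> where \<theta>: "\<alpha> \<le> \<theta>" "\<theta> \<le> \<alpha> + 2 * pi" "z = rcis r \<theta>"
    proof -
      define n where "n = \<lfloor>(Arg z - \<alpha>) / (2 * pi)\<rfloor>"
      define \<theta> where "\<theta> = Arg z - 2 * pi * of_int n"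
      have "of_int n \<le> (Arg z - \<alpha>) / (2 * pi)" "(Arg z - \<alpha>) / (2 * pi) \<le> of_int n + 1" unfolding n_def by linarith+
      hence "\<alpha> \<le> \<theta>" "\<theta> \<le> \<alpha> + 2 * pi" unfolding \<theta>_def by (auto simp: field_simps)
      moreover have "z = rcis r \<theta>"
      proof -
        have "cis \<theta> = cis (Arg z) * cis (- (2 * pi * of_int n))" unfolding \<theta>_def by (simp add: cis_mult)
        also have "cis (- (2 * pi * of_int n)) = 1" using cis_multiple_2pi[of "- of_int n"] by simp
        finally have "cis \<theta> = cis (Arg z)" by simp
        thus ?thesis using rcis_cmod_Arg[of z] unfolding r_def rcis_def by simp
      qed
      ultimately show thesis using that by blast
    qed
    have pos: "(1 + r)^4 > 0" using r by (intro zero_less_power) auto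
    have "cmod (f z * H z) \<le> M * exp (pi/2 * r\<^sup>2) / (1 + r)^4"
    proof (cases "\<theta> \<le> \<beta>")
      case True
      have "cmod (f z * H z) \<le> (D * exp ((pi/2 - e) * r\<^sup>2)) * (E * exp (e/2 * r\<^sup>2))"
        unfolding norm_mult using e(3)[OF r \<theta>(1) True] H(3)[of z] e(2) unfolding \<theta>(3)[symmetric] r_def[symmetric] by (intro mult_mono) auto
      also have "\<dots> = D * E * exp ((pi/2 - e/2) * r\<^sup>2)" by (simp add: mult_exp_exp algebra_simps)
      finally have "cmod (f z * H z) * (1 + r)^4 \<le> (D * E * exp ((pi/2 - e/2) * r\<^sup>2)) * (K * exp (e/2 * r\<^sup>2))"
        using K[OF r] e(2) E0 r by (intro mult_mono) auto
      also have "\<dots> = D * E * K * exp (pi/2 * r\<^sup>2)" by (simp add: mult_exp_exp algebra_simps)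
      also have "\<dots> \<le> M * exp (pi/2 * r\<^sup>2)" using C0 E0 unfolding M_def by (intro mult_right_mono) auto
      finally show ?thesis using pos by (simp add: le_divide_eq)
    next
      case False
      have "cmod (f z * H z) \<le> (C * exp (pi/2 * r\<^sup>2)) * (E / (1 + r)^4)"
        unfolding norm_mult using B[of z] H(4)[OF r _ \<theta>(2)] False C0 unfolding \<theta>(3)[symmetric] r_def[symmetric] by (intro mult_mono) auto
      also have "\<dots> = C * E * exp (pi/2 * r\<^sup>2) / (1 + r)^4" by simp
      also have "\<dots> \<le> M * exp (pi/2 * r\<^sup>2) / (1 + r)^4"
        using pos e(2) E0 K0 unfolding M_def by (intro divide_right_mono mult_right_mono) auto
      finally show ?thesis .
    qed
    thus ?thesis unfolding r_def .
  qed
  have M0: "M \<ge> 0" using e(2) E0 C0 K0 by (simp add: M_def)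
  have one: "1 + cmod z > 0" for z :: complex by (simp add: add_pos_nonneg)
  have Z: "(z - p) * (f z * H z) = 0" for z
  proof (rule complete_uniqueness[OF compl, where F = "\<lambda>z. (z - p) * (f z * H z)"])
    show "(\<lambda>z. (z - p) * (f z * H z)) holomorphic_on UNIV" using f H(1) by (intro holomorphic_intros)
    show "cmod ((z - p) * (f z * H z)) \<le> ((1 + cmod p) * M) * exp (pi/2 * (cmod z)\<^sup>2) / (1 + cmod z)^3" for z
    proof -
      have "cmod (z - p) \<le> cmod z + cmod p" by (rule norm_triangle_ineq4)
      also have "\<dots> \<le> (1 + cmod p) * (1 + cmod z)" by (simp add: algebra_simps)
      finally have "cmod ((z - p) * (f z * H z)) \<le> ((1 + cmod p) * (1 + cmod z)) * (M * exp (pi/2 * (cmod z)\<^sup>2) / (1 + cmod z)^4)"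
        unfolding norm_mult[of "z - p"] using fH[of z] by (intro mult_mono) auto
      also have "\<dots> = ((1 + cmod p) * M) * exp (pi/2 * (cmod z)\<^sup>2) / (1 + cmod z)^3"
      proof -
        have "(1 + cmod z)^4 = (1 + cmod z) * (1 + cmod z)^3" by (simp add: numeral_eq_Suc)
        thus ?thesis using one[of z] by simp
      qed
      finally show ?thesis .
    qed
    show "(to_complex q - p) * (f (to_complex q) * H (to_complex q)) = 0" if "q \<in> A" for q
      using zero[of "to_complex q"] that by (cases "to_complex q = p") auto
  qed
  \<comment> \<open>The identity \<open>Z\<close> gives \<open>f z * H z = 0\<close> only for
    \<open>z \<noteq> p\<close>; continuity covers the case \<open>p = 0\<close>.\<close>
  have "isCont (\<lambda>z. f z * H z) 0"
    using holomorphic_on_imp_continuous_on[OF f] holomorphic_on_imp_continuous_on[OF H(1)]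
    by (intro continuous_intros) (auto simp: continuous_on_eq_continuous_at)
  hence "((\<lambda>z. f z * H z) \<longlongrightarrow> f 0 * H 0) (at 0)" by (rule isContD)
  moreover have "eventually (\<lambda>z. f z * H z = 0) (at 0)"
  proof (cases "p = 0")
    case True
    thus ?thesis using Z by (auto simp: eventually_at_filter intro!: always_eventually)
  next
    case False
    hence "eventually (\<lambda>z. z \<noteq> p) (at 0)" by (intro eventually_neq_at_within)
    thus ?thesis by eventually_elim (use Z in auto)
  qed
  hence "((\<lambda>z. f z * H z) \<longlongrightarrow> 0) (at 0)" by (rule tendsto_eventually)
  ultimately have "f 0 * H 0 = 0" by (rule tendsto_unique[OF at_neq_bot])
  thus False using f0 H(2) by simp
qed

text \<open>The gap hypothesis excludes only intervals strictly longer than \<open>pi/2\<close>. The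
  limiting distance \<open>pi/2\<close> itself is reached because subextremality at
  \<open>\<theta> + pi/2\<close> would extend to a neighbourhood and thus produce a longer
  interval.\<close>

lemma extremal_angles_chain:
  assumes gap: "\<And>\<alpha> \<beta>. \<alpha> + pi/2 < \<beta> \<Longrightarrow> \<not> subextremal_between f \<alpha> \<beta>"
  defines "E \<equiv> {\<theta>. \<not> subextremal_angle f \<theta>}"
  shows "closed E" "E \<noteq> {}" "\<And>\<theta>. \<theta> \<in> E \<Longrightarrow> \<exists>\<theta>'\<in>E. \<theta> < \<theta>' \<and> \<theta>' \<le> \<theta> + pi/2"
proof -
  have "open (- E)" unfolding open_dist
    using subextremal_angle_near[of f] by (auto simp: E_def dist_real_def)
  thus "closed E" by (simp add: closed_def)
  have gap': "\<exists>\<theta>\<in>E. \<alpha> \<le> \<theta> \<and> \<theta> \<le> \<beta>" if "\<alpha> + pi/2 < \<beta>" for \<alpha> \<beta>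
  proof (rule ccontr)
    assume "\<not> (\<exists>\<theta>\<in>E. \<alpha> \<le> \<theta> \<and> \<theta> \<le> \<beta>)"
    moreover have "\<alpha> \<le> \<beta>" using that pi_gt_zero by linarith
    ultimately have "subextremal_between f \<alpha> \<beta>" by (intro subextremal_interval) (auto simp: E_def)
    thus False using gap[OF that] by simp
  qed
  have "\<exists>\<theta>\<in>E. 0 \<le> \<theta> \<and> \<theta> \<le> pi" by (rule gap') (use pi_gt_zero in linarith)
  thus "E \<noteq> {}" by blast
  fix \<theta> assume "\<theta> \<in> E"
  show "\<exists>\<theta>'\<in>E. \<theta> < \<theta>' \<and> \<theta>' \<le> \<theta> + pi/2"
  proof (rule ccontr)
    assume n: "\<not> (\<exists>\<theta>'\<in>E. \<theta> < \<theta>' \<and> \<theta>' \<le> \<theta> + pi/2)"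
    have "\<theta> + pi/2 \<notin> E"
    proof
      assume "\<theta> + pi/2 \<in> E"
      hence "\<exists>\<theta>'\<in>E. \<theta> < \<theta>' \<and> \<theta>' \<le> \<theta> + pi/2" by (intro bexI[of _ "\<theta> + pi/2"]) auto
      thus False using n by simp
    qed
    hence "subextremal_angle f (\<theta> + pi/2)" by (simp add: E_def)
    then obtain e where e: "e > 0" "\<And>\<theta>'. \<bar>\<theta>' - (\<theta> + pi/2)\<bar> < e \<Longrightarrow> subextremal_angle f \<theta>'" using subextremal_angle_near by blast
    \<comment> \<open>This interval has length \<open>pi/2 + e/4\<close>, begins beyond
      \<open>\<theta>\<close>, and ends inside the neighbourhood of \<open>\<theta> + pi/2\<close>
      that is free of extremal directions.\<close>
    obtain \<theta>' where t: "\<theta>' \<in> E" "\<theta> + e/4 \<le> \<theta>'" "\<theta>' \<le> \<theta> + pi/2 + e/2" using gap'[of "\<theta> + e/4" "\<theta> + pi/2 + e/2"] e(1) by auto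
    have "\<theta>' > \<theta> + pi/2" using n t e(1) by force
    hence "\<bar>\<theta>' - (\<theta> + pi/2)\<bar> < e" using t e(1) by linarith
    thus False using e(2)[of \<theta>'] t(1) by (simp add: E_def)
  qed
qed

text \<open>The series has no constant term, so integrating along the circle gives again a power
  series in \<open>rcis q x\<close>, hence a bounded function. This expresses that the oscillating
  part of the majorant has mean zero.\<close>

lemma circle_series_antiderivative:
  fixes \<xi> :: "nat \<Rightarrow> complex"
  assumes K: "\<And>n. cmod (\<xi> n) \<le> K" and q: "0 < q" "q < 1"
  obtains J B where "\<And>x. ((\<lambda>x. Re (J x)) has_real_derivative Re (\<Sum>n. \<xi> n * rcis q x ^ Suc n)) (at x)" "\<And>x. Re (J x) \<le> B"
proof -
  \<comment> \<open>Differentiating \<open>z^n\<close> along the circle produces the factor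
    \<open>\<i> * n\<close>, which these coefficients divide out.\<close>
  define c where "c n = (case n of 0 \<Rightarrow> 0 | Suc m \<Rightarrow> \<xi> m / (\<i> * of_nat (Suc m)))" for n
  have K0: "K \<ge> 0" using K[of 0] norm_ge_zero[of "\<xi> 0"] by linarith
  have cK: "cmod (c n) \<le> K" for n
  proof (cases n)
    case (Suc m)
    have "cmod (\<xi> m) / real (Suc m) \<le> K / 1" using K[of m] K0 by (intro frac_le) auto
    moreover have "cmod (\<xi> m / (\<i> * of_nat (Suc m))) = cmod (\<xi> m) / real (Suc m)"
      by (simp only: norm_divide norm_mult norm_ii norm_of_nat mult_1)
    ultimately show ?thesis using Suc by (simp add: c_def)
  qed (use K0 in \<open>simp add: c_def\<close>)
  have sm: "summable (\<lambda>n. c n * z ^ n)" if z: "cmod z < 1" for z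
  proof (rule summable_comparison_test)
    show "summable (\<lambda>n. K * cmod z ^ n)" using z by (intro summable_mult summable_geometric) auto
    show "\<exists>N. \<forall>n\<ge>N. cmod (c n * z ^ n) \<le> K * cmod z ^ n"
      unfolding norm_mult norm_power using cK by (intro exI[of _ 0] allI impI mult_right_mono) auto
  qed
  define G where "G z = (\<Sum>n. c n * z ^ n)" for z
  have dG: "(G has_field_derivative (\<Sum>n. diffs c n * z ^ n)) (at z)" if "cmod z < 1" for z
    unfolding G_def[abs_def] using termdiffs_strong'[OF sm that] by simp
  have dc: "diffs c n = \<xi> n / \<i>" for n
    using of_nat_neq_0[of n, where 'a=complex] by (simp add: diffs_def c_def del: of_nat_Suc)
  have smx: "summable (\<lambda>n. \<xi> n * z ^ n)" if z: "cmod z < 1" for z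
  proof (rule summable_comparison_test)
    show "summable (\<lambda>n. K * cmod z ^ n)" using z by (intro summable_mult summable_geometric) auto
    show "\<exists>N. \<forall>n\<ge>N. cmod (\<xi> n * z ^ n) \<le> K * cmod z ^ n"
      unfolding norm_mult norm_power using K by (intro exI[of _ 0] allI impI mult_right_mono) auto
  qed
  show ?thesis
  proof (rule that[of "\<lambda>x. G (rcis q x)" "\<Sum>n. K * q ^ n"])
    fix x
    have nq: "cmod (rcis q x) < 1" "cmod (rcis q x) = q" using q by auto
    have "((\<lambda>x. rcis q x) has_vector_derivative \<i> * rcis q x) (at x)"
      unfolding rcis_def cis_conv_exp by (auto intro!: derivative_eq_intros simp: scaleR_conv_of_real)
    hence "((\<lambda>x. G (rcis q x)) has_vector_derivative (\<i> * rcis q x * (\<Sum>n. diffs c n * rcis q x ^ n))) (at x)"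
      using field_vector_diff_chain_at[where f = "rcis q", OF _ dG[OF nq(1)]] by (simp add: o_def)
    hence "((\<lambda>x. Re (G (rcis q x))) has_vector_derivative Re (\<i> * rcis q x * (\<Sum>n. diffs c n * rcis q x ^ n))) (at x)"
      by (rule bounded_linear.has_vector_derivative[OF bounded_linear_Re])
    moreover have "\<i> * rcis q x * (\<Sum>n. diffs c n * rcis q x ^ n) = (\<Sum>n. \<xi> n * rcis q x ^ Suc n)"
    proof -
      have "(\<Sum>n. \<xi> n * rcis q x ^ Suc n) = (\<Sum>n. (\<i> * rcis q x) * (diffs c n * rcis q x ^ n))"
      proof (intro suminf_cong)
        fix n
        have "(\<i> * rcis q x) * (\<xi> n / \<i> * rcis q x ^ n) = (\<i> * \<xi> n / \<i>) * rcis q x ^ Suc n"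
          by (simp only: power_Suc times_divide_eq_left times_divide_eq_right mult_ac)
        also have "\<i> * \<xi> n / \<i> = \<xi> n" by (rule nonzero_mult_div_cancel_left) simp
        finally show "\<xi> n * rcis q x ^ Suc n = (\<i> * rcis q x) * (diffs c n * rcis q x ^ n)" unfolding dc by simp
      qed
      also have "\<dots> = (\<i> * rcis q x) * (\<Sum>n. diffs c n * rcis q x ^ n)"
        using summable_mult[OF smx[OF nq(1)], of "1/\<i>"] by (intro suminf_mult) (simp add: dc mult_ac)
      finally show ?thesis by simp
    qed
    ultimately show "((\<lambda>x. Re (G (rcis q x))) has_real_derivative Re (\<Sum>n. \<xi> n * rcis q x ^ Suc n)) (at x)"
      by (simp add: has_real_derivative_iff_has_vector_derivative)
    have "Re (G (rcis q x)) \<le> cmod (G (rcis q x))" by (rule complex_Re_le_cmod)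
    also have "\<dots> \<le> (\<Sum>n. K * q ^ n)" unfolding G_def
    proof (rule order_trans[OF summable_norm])
      have le: "cmod (c n * rcis q x ^ n) \<le> K * q ^ n" for n
        unfolding norm_mult norm_power nq(2) using cK q by (intro mult_right_mono) auto
      have sK: "summable (\<lambda>n. K * q ^ n)" using q by (intro summable_mult summable_geometric) auto
      show s: "summable (\<lambda>n. cmod (c n * rcis q x ^ n))"
        by (rule summable_comparison_test[OF _ sK]) (use le in auto)
      show "(\<Sum>n. cmod (c n * rcis q x ^ n)) \<le> (\<Sum>n. K * q ^ n)" by (rule suminf_le[OF le s sK])
    qed
    finally show "Re (G (rcis q x)) \<le> (\<Sum>n. K * q ^ n)" .
  qed
qed

text \<open>The logarithmic majorant in the disc of radius \<open>R\<close>, divided by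
  \<open>R^2\<close>, has convergent Taylor coefficients under the common bound \<open>K\<close>;
  its constant term tends to \<open>\<delta>/2\<close> in real part. On the circle of radius
  \<open>q * R\<close> the geometric factor \<open>q^n\<close> makes the convergence uniform in the
  angle, and expressing \<open>R\<close> by \<open>r = q * R\<close> yields the divisor
  \<open>q^2\<close>.\<close>

lemma (in quadratic_counting) entire_majorant:
  assumes f: "f holomorphic_on UNIV" and B: "\<And>z. cmod (f z) \<le> C * exp (pi/2 * (cmod z)\<^sup>2)"
    and Z: "\<And>z. f z = 0 \<longleftrightarrow> z \<in> Z" and simple: "\<And>z. z \<in> Z \<Longrightarrow> deriv f z \<noteq> 0"
    and T: "\<And>k. k \<ge> 1 \<Longrightarrow> \<exists>\<tau>. ((\<lambda>R. (\<Sum>z\<in>pts_below Z R. cnj (sgn z) ^ k) / of_real (R\<^sup>2)) \<longlongrightarrow> \<tau>) at_top"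
    and two: "\<exists>L. ((\<lambda>R. \<Sum>z\<in>pts_below Z R. 1 / z\<^sup>2) \<longlongrightarrow> L) at_top"
  shows "\<delta> \<le> pi"
    and "\<exists>\<xi> K. (\<forall>n. cmod (\<xi> n) \<le> K) \<and> (\<forall>q \<epsilon>. 0 < q \<longrightarrow> q < 1 \<longrightarrow> 0 < \<epsilon> \<longrightarrow>
      (\<exists>D. \<forall>r\<ge>0. \<forall>\<theta>. cmod (f (rcis r \<theta>)) \<le> D * exp ((\<delta>/2 + Re (\<Sum>n. \<xi> n * rcis q \<theta> ^ Suc n) + \<epsilon>) / q\<^sup>2 * r\<^sup>2)))"
proof -
  have f0: "f 0 \<noteq> 0" using Z zero_notin by auto
  have C0: "C > 0" using order_less_le_trans[OF iffD2[OF zero_less_norm_iff f0] B[of 0]] by simp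
  define b0 b1 where "b0 = ln (cmod (f 0))" and "b1 = ln C"
  define W where "W R = (\<Sum>a\<in>pts_below Z R. ln (R / cmod a))" for R
  obtain c where c: "\<And>R B. R > 0 \<Longrightarrow> (\<And>z. cmod z = R \<Longrightarrow> cmod (f z) \<le> exp B) \<Longrightarrow>
    \<exists>g. g holomorphic_on ball 0 R \<and> (\<forall>z\<in>ball 0 R. cmod (f z) \<le> exp (Re (g z)) \<and> Re (g z) \<le> B) \<and>
      Re (g 0) = b0 + W R \<and>
      (\<forall>k\<ge>1. (deriv ^^ k) g 0 / fact k = c k + (\<Sum>a\<in>pts_below Z R. 1 / a^k - (cnj a / of_real (R\<^sup>2))^k) / of_nat k)"
  proof (rule disc_log_majorant[OF f Z simple finite_pts_below[unfolded pts_below_def] zero_notin])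
    fix c assume H: "\<And>R B. R > 0 \<Longrightarrow> (\<And>z. cmod z = R \<Longrightarrow> cmod (f z) \<le> exp B) \<Longrightarrow>
      \<exists>g. g holomorphic_on ball 0 R \<and> (\<forall>z\<in>ball 0 R. cmod (f z) \<le> exp (Re (g z)) \<and> Re (g z) \<le> B) \<and>
      Re (g 0) = ln (cmod (f 0)) + (\<Sum>a\<in>{z\<in>Z. cmod z < R}. ln (R / cmod a)) \<and>
      (\<forall>k\<ge>1. (deriv ^^ k) g 0 / fact k = c k + (\<Sum>a\<in>{z\<in>Z. cmod z < R}. 1 / a^k - (cnj a / of_real (R\<^sup>2))^k) / of_nat k)"
    show thesis by (rule that[of c]) (unfold b0_def W_def pts_below_def, rule H)
  qed
  define \<gamma> where "\<gamma> k R = c k + (\<Sum>a\<in>pts_below Z R. 1 / a^k - (cnj a / of_real (R\<^sup>2))^k) / of_nat k" for k R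
  have ex: "\<exists>g. g holomorphic_on ball 0 R \<and> (\<forall>z\<in>ball 0 R. cmod (f z) \<le> exp (Re (g z)) \<and> Re (g z) \<le> pi/2 * R\<^sup>2 + b1) \<and>
      Re (g 0) = b0 + W R \<and> (\<forall>k\<ge>1. (deriv ^^ k) g 0 / fact k = \<gamma> k R)" if "R > 0" for R
    unfolding \<gamma>_def
  proof (rule c[OF that])
    fix z assume "cmod z = R"
    thus "cmod (f z) \<le> exp (pi/2 * R\<^sup>2 + b1)" using B[of z] C0 by (simp add: b1_def exp_add mult.commute)
  qed
  define g where "g R = (SOME g. g holomorphic_on ball 0 R \<and> (\<forall>z\<in>ball 0 R. cmod (f z) \<le> exp (Re (g z)) \<and> Re (g z) \<le> pi/2 * R\<^sup>2 + b1) \<and>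
      Re (g 0) = b0 + W R \<and> (\<forall>k\<ge>1. (deriv ^^ k) g 0 / fact k = \<gamma> k R))" for R
  have g: "g R holomorphic_on ball 0 R" "\<And>z. z \<in> ball 0 R \<Longrightarrow> cmod (f z) \<le> exp (Re (g R z))"
     "\<And>z. z \<in> ball 0 R \<Longrightarrow> Re (g R z) \<le> pi/2 * R\<^sup>2 + b1" "Re (g R 0) = b0 + W R"
     "\<And>k. k \<ge> 1 \<Longrightarrow> (deriv ^^ k) (g R) 0 / fact k = \<gamma> k R" if "R > 0" for R
  proof -
    note G = someI_ex[OF ex[OF that], folded g_def]
    show "g R holomorphic_on ball 0 R" "Re (g R 0) = b0 + W R" using G by simp_all
    show "cmod (f z) \<le> exp (Re (g R z))" "Re (g R z) \<le> pi/2 * R\<^sup>2 + b1" if "z \<in> ball 0 R" for z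
      using G that by (elim conjE, auto)+
    show "(deriv ^^ k) (g R) 0 / fact k = \<gamma> k R" if "k \<ge> 1" for k using G that by (elim conjE) blast
  qed
  have Wnn: "W R \<ge> 0" if "R > 0" for R
    unfolding W_def
  proof (intro sum_nonneg ln_ge_zero)
    fix a assume "a \<in> pts_below Z R"
    hence "cmod a > 0" "cmod a < R" using zero_notin by (auto simp: pts_below_def)
    thus "1 \<le> R / cmod a" by simp
  qed
  have Wle: "W R \<le> pi/2 * R\<^sup>2 + (b1 - b0)" if "R > 0" for R
    using g(3)[OF that, of 0] g(4)[OF that] that by simp
  define b where "b = \<bar>b1 - b0\<bar>"
  have R2: "b \<le> b * R\<^sup>2" if "R \<ge> 1" for R
    using that by (simp add: b_def mult_le_cancel_left1 one_le_power)
  have Wlim: "((\<lambda>R. W R / R\<^sup>2) \<longlongrightarrow> \<delta> / 2) at_top"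
    unfolding W_def
  proof (rule log_sum_limit)
    show "eventually (\<lambda>R. (\<Sum>a\<in>pts_below Z R. ln (R / cmod a)) / R\<^sup>2 \<le> pi/2 + b) at_top"
      using eventually_ge_at_top[of 1]
    proof eventually_elim
      case (elim R)
      have "W R \<le> pi/2 * R\<^sup>2 + b * R\<^sup>2" using Wle[of R] R2[OF elim] elim by (simp add: b_def)
      thus ?case using elim unfolding W_def by (simp add: divide_le_eq algebra_simps)
    qed
  qed
  have lim0: "((\<lambda>R. x / R\<^sup>2) \<longlongrightarrow> 0) at_top" for x :: real by real_asymp
  \<comment> \<open>Jensen's formula in the form of \<open>Wle\<close>: the majorant at the origin
    is at most its bound on the circle, and dividing by \<open>R^2\<close> leaves the growth rate
    \<open>pi/2\<close>.\<close>
  have "\<delta> / 2 \<le> pi/2 + 0"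
  proof (rule tendsto_le[OF _ _ Wlim])
    show "((\<lambda>R. pi/2 + (b1 - b0) / R\<^sup>2) \<longlongrightarrow> pi/2 + 0) at_top" by (intro tendsto_intros lim0)
    show "eventually (\<lambda>R. W R / R\<^sup>2 \<le> pi/2 + (b1 - b0) / R\<^sup>2) at_top"
      using eventually_gt_at_top[of 0]
    proof eventually_elim
      case (elim R)
      have "W R / R\<^sup>2 \<le> (pi/2 * R\<^sup>2 + (b1 - b0)) / R\<^sup>2" using Wle[OF elim] by (intro divide_right_mono) auto
      also have "\<dots> = pi/2 + (b1 - b0) / R\<^sup>2" using elim by (simp add: add_divide_distrib)
      finally show ?case .
    qed
  qed auto
  thus "\<delta> \<le> pi" by simp
  \<comment> \<open>The coefficient bound is \<open>2 * (B - Re (g R 0))\<close> with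
    \<open>B = pi/2 * R^2 + b1\<close> and \<open>Re (g R 0) \<ge> b0\<close>; for
    \<open>R \<ge> 1\<close> the constants are absorbed into \<open>R^2\<close>.\<close>
  define K where "K = pi + 2 * b"
  have K0: "K \<ge> 0" by (simp add: K_def b_def add_nonneg_nonneg)
  have coeff: "cmod (\<gamma> k R) * R ^ k \<le> K * R\<^sup>2" if k: "k \<ge> 1" and R: "R \<ge> 1" for k R
  proof -
    have R0: "R > 0" using R by simp
    have "cmod (\<gamma> k R) * R ^ k \<le> 2 * (pi/2 * R\<^sup>2 + b1 - Re (g R 0))"
      unfolding g(5)[OF R0 k, symmetric] using g(1,3)[OF R0] by (intro taylor_coeff_bound_Re R0 k) auto
    also have "2 * (pi/2 * R\<^sup>2 + b1 - Re (g R 0)) = pi * R\<^sup>2 + 2 * (b1 - b0) - 2 * W R" unfolding g(4)[OF R0] by (simp add: algebra_simps)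
    also have "\<dots> \<le> pi * R\<^sup>2 + 2 * b"
    proof -
      have "b1 - b0 \<le> b" by (simp add: b_def)
      thus ?thesis using Wnn[OF R0] by simp
    qed
    also have "\<dots> \<le> K * R\<^sup>2" using R2[OF R] by (simp add: K_def algebra_simps)
    finally show ?thesis .
  qed
  define x where "x n R = \<gamma> (Suc n) R * of_real (R ^ Suc n / R\<^sup>2)" for n R
  have xK: "cmod (x n R) \<le> K" if "R \<ge> 1" for n R
    using coeff[of "Suc n" R] that unfolding x_def norm_mult norm_of_real by (simp add: divide_le_eq abs_mult)
  have "\<exists>L. (x n \<longlongrightarrow> L) at_top" for n
    unfolding x_def[abs_def]
  proof (rule exE[OF T[of "Suc n"]])
    fix \<tau> assume "((\<lambda>R. (\<Sum>z\<in>pts_below Z R. cnj (sgn z) ^ Suc n) / of_real (R\<^sup>2)) \<longlongrightarrow> \<tau>) at_top"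
    thus "\<exists>L. ((\<lambda>R. \<gamma> (Suc n) R * of_real (R ^ Suc n / R\<^sup>2)) \<longlongrightarrow> L) at_top"
    proof (rule taylor_coeff_convergent[rotated])
      show "eventually (\<lambda>R. cmod (\<gamma> (Suc n) R) * R ^ Suc n \<le> K * R\<^sup>2) at_top"
        using eventually_ge_at_top[of 1] by eventually_elim (rule coeff, auto)
    qed (use two in \<open>auto simp: \<gamma>_def\<close>)
  qed auto
  then obtain \<xi> where \<xi>: "\<And>n. (x n \<longlongrightarrow> \<xi> n) at_top" by metis
  have \<xi>K: "cmod (\<xi> n) \<le> K" for n
  proof (rule tendsto_upperbound[OF tendsto_norm[OF \<xi>]])
    show "eventually (\<lambda>R. cmod (x n R) \<le> K) at_top"
      using eventually_ge_at_top[of 1] by eventually_elim (rule xK)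
  qed simp
  have major: "\<exists>D. \<forall>r\<ge>0. \<forall>\<theta>. cmod (f (rcis r \<theta>)) \<le> D * exp ((\<delta>/2 + Re (\<Sum>n. \<xi> n * rcis q \<theta> ^ Suc n) + \<epsilon>) / q\<^sup>2 * r\<^sup>2)"
    if q: "0 < q" "q < 1" and \<epsilon>: "\<epsilon> > 0" for q \<epsilon>
  proof -
    have sq: "summable (\<lambda>n. M * q ^ Suc n)" for M
      using q by (intro summable_mult summable_ignore_initial_segment[of _ 1, simplified] summable_geometric) auto
    \<comment> \<open>Tannery's theorem, with the geometric majorant
      \<open>2 * K * q ^ Suc n\<close>; absolute values make the conclusion independent of the
      angle.\<close>
    have tann: "eventually (\<lambda>R. summable (\<lambda>n. norm (cmod (x n R - \<xi> n) * q ^ Suc n))) at_top \<and> summable (\<lambda>n. norm (0::real)) \<and>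
        ((\<lambda>R. \<Sum>n. cmod (x n R - \<xi> n) * q ^ Suc n) \<longlongrightarrow> (\<Sum>n. 0)) at_top"
    proof (rule tannerys_theorem)
      show "((\<lambda>R. cmod (x n R - \<xi> n) * q ^ Suc n) \<longlongrightarrow> 0) at_top" for n
      proof -
        have "((\<lambda>R. cmod (x n R - \<xi> n) * q ^ Suc n) \<longlongrightarrow> cmod (\<xi> n - \<xi> n) * q ^ Suc n) at_top" by (intro tendsto_intros \<xi>)
        thus ?thesis by simp
      qed
      show "eventually (\<lambda>(n, R). norm (cmod (x n R - \<xi> n) * q ^ Suc n) \<le> (2 * K) * q ^ Suc n) (at_top \<times>\<^sub>F at_top)"
        unfolding eventually_prod_filter
      proof (intro exI conjI allI impI)
        show "eventually (\<lambda>_. True) (at_top :: nat filter)" by simp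
        show "eventually (\<lambda>R. R \<ge> (1::real)) at_top" by (rule eventually_ge_at_top)
        fix n :: nat and R :: real assume "R \<ge> 1"
        hence "cmod (x n R - \<xi> n) \<le> 2 * K" using xK[of R n] \<xi>K[of n] norm_triangle_ineq4[of "x n R" "\<xi> n"] by linarith
        thus "case (n, R) of (n, R) \<Rightarrow> norm (cmod (x n R - \<xi> n) * q ^ Suc n) \<le> (2 * K) * q ^ Suc n"
          using q by (simp add: abs_mult mult_right_mono del: power_Suc)
      qed
      show "summable (\<lambda>n. (2 * K) * q ^ Suc n)" by (rule sq)
    qed auto
    define d where "d R = (\<Sum>n. cmod (x n R - \<xi> n) * q ^ Suc n)" for R
    have "(d \<longlongrightarrow> 0) at_top" using tann unfolding d_def by simp
    hence E1: "eventually (\<lambda>R. d R < \<epsilon>/2) at_top" using \<epsilon> by (intro order_tendstoD) auto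
    have "((\<lambda>R. b0 / R\<^sup>2 + W R / R\<^sup>2) \<longlongrightarrow> 0 + \<delta>/2) at_top" by (intro tendsto_intros Wlim lim0)
    hence E2: "eventually (\<lambda>R. b0 / R\<^sup>2 + W R / R\<^sup>2 < \<delta>/2 + \<epsilon>/2) at_top" using \<epsilon> by (intro order_tendstoD) auto
    have "eventually (\<lambda>R. d R < \<epsilon>/2 \<and> b0 / R\<^sup>2 + W R / R\<^sup>2 < \<delta>/2 + \<epsilon>/2 \<and> summable (\<lambda>n. norm (cmod (x n R - \<xi> n) * q ^ Suc n)) \<and> R \<ge> 1) at_top"
      by (intro eventually_conj E1 E2 tann[THEN conjunct1] eventually_ge_at_top)
    then obtain R0 where R0: "\<And>R. R \<ge> R0 \<Longrightarrow> d R < \<epsilon>/2 \<and> b0 / R\<^sup>2 + W R / R\<^sup>2 < \<delta>/2 + \<epsilon>/2 \<and> summable (\<lambda>n. norm (cmod (x n R - \<xi> n) * q ^ Suc n)) \<and> R \<ge> 1"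
      unfolding eventually_at_top_linorder by blast
    have R01: "R0 \<ge> 1" using R0[of R0] by simp
    define S where "S \<theta> = (\<Sum>n. \<xi> n * rcis q \<theta> ^ Suc n)" for \<theta>
    have smS: "summable (\<lambda>n. cmod (\<xi> n * rcis q \<theta> ^ Suc n))" "cmod (\<xi> n * rcis q \<theta> ^ Suc n) \<le> K * q ^ Suc n" for \<theta> n
    proof -
      show le: "cmod (\<xi> n * rcis q \<theta> ^ Suc n) \<le> K * q ^ Suc n" for n
        unfolding norm_mult norm_power using \<xi>K[of n] q by (auto intro!: mult_right_mono simp del: power_Suc)
      show "summable (\<lambda>n. cmod (\<xi> n * rcis q \<theta> ^ Suc n))"
        by (rule summable_comparison_test[OF _ sq[of K]]) (use le in \<open>auto simp del: power_Suc\<close>)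
    qed
    define Sb where "Sb = (\<Sum>n. K * q ^ Suc n)"
    have Sb: "Re (S \<theta>) \<ge> - Sb" for \<theta>
    proof -
      have "cmod (S \<theta>) \<le> Sb" unfolding S_def Sb_def
        by (intro order_trans[OF summable_norm[OF smS(1)]] suminf_le smS sq)
      thus ?thesis using abs_Re_le_cmod[of "S \<theta>"] by linarith
    qed
    have Sb0: "Sb \<ge> 0" unfolding Sb_def using K0 q by (intro suminf_nonneg sq) auto
    have far: "cmod (f (rcis (q * R) \<theta>)) \<le> exp ((\<delta>/2 + Re (S \<theta>) + \<epsilon>) * R\<^sup>2)" if R: "R \<ge> R0" for R \<theta>
    proof -
      note RR = R0[OF R]
      hence Rp: "R > 0" by simp
      define z where "z = rcis (q * R) \<theta>"
      have nz: "cmod z = q * R" using q Rp by (simp add: z_def)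
      hence zb: "z \<in> ball 0 R" using q Rp by simp
      have "(\<lambda>n. (deriv ^^ n) (g R) 0 / fact n * (z - 0) ^ n) sums g R z"
        using g(1)[OF Rp] zb by (rule holomorphic_power_series)
      hence "(\<lambda>n. (deriv ^^ Suc n) (g R) 0 / fact (Suc n) * z ^ Suc n) sums (g R z - g R 0)"
        by (subst sums_Suc_iff) simp
      moreover have "(deriv ^^ Suc n) (g R) 0 / fact (Suc n) * z ^ Suc n = of_real (R\<^sup>2) * (x n R * rcis q \<theta> ^ Suc n)" for n
      proof -
        have "z = of_real R * rcis q \<theta>" by (simp add: z_def rcis_def mult_ac)
        hence "z ^ Suc n = of_real (R ^ Suc n) * rcis q \<theta> ^ Suc n" by (simp only: power_mult_distrib of_real_power)
        moreover have "(deriv ^^ Suc n) (g R) 0 / fact (Suc n) = \<gamma> (Suc n) R" by (rule g(5)[OF Rp]) simp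
        moreover have "of_real (R ^ Suc n) = of_real (R\<^sup>2) * complex_of_real (R ^ Suc n / R\<^sup>2)"
          unfolding of_real_mult[symmetric] using Rp by simp
        ultimately show ?thesis unfolding x_def by (simp only: mult_ac)
      qed
      ultimately have s1: "(\<lambda>n. of_real (R\<^sup>2) * (x n R * rcis q \<theta> ^ Suc n)) sums (g R z - g R 0)" by (simp only:)
      have s2: "(\<lambda>n. \<xi> n * rcis q \<theta> ^ Suc n) sums S \<theta>" unfolding S_def
        by (rule summable_sums[OF summable_norm_cancel[OF smS(1)]])
      have "(\<lambda>n. of_real (R\<^sup>2) * (x n R * rcis q \<theta> ^ Suc n) - of_real (R\<^sup>2) * (\<xi> n * rcis q \<theta> ^ Suc n)) sums (g R z - g R 0 - of_real (R\<^sup>2) * S \<theta>)"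
        by (intro sums_diff s1 sums_mult s2)
      hence s3: "(\<lambda>n. of_real (R\<^sup>2) * ((x n R - \<xi> n) * rcis q \<theta> ^ Suc n)) sums (g R z - g R 0 - of_real (R\<^sup>2) * S \<theta>)"
        by (simp only: right_diff_distrib left_diff_distrib)
      have nt: "cmod (of_real (R\<^sup>2) * ((x n R - \<xi> n) * rcis q \<theta> ^ Suc n)) = R\<^sup>2 * (cmod (x n R - \<xi> n) * q ^ Suc n)" for n
        unfolding norm_mult norm_power norm_of_real using q by (simp del: power_Suc)
      have smd: "summable (\<lambda>n. cmod (x n R - \<xi> n) * q ^ Suc n)"
        by (rule summable_norm_cancel) (rule RR[THEN conjunct2, THEN conjunct2, THEN conjunct1])
      have "cmod (g R z - g R 0 - of_real (R\<^sup>2) * S \<theta>) \<le> (\<Sum>n. R\<^sup>2 * (cmod (x n R - \<xi> n) * q ^ Suc n))"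
        unfolding sums_unique[OF s3] nt[symmetric]
        by (rule summable_norm) (use summable_mult[OF smd, of "R\<^sup>2"] in \<open>simp only: nt\<close>)
      also have "\<dots> = R\<^sup>2 * d R" unfolding d_def by (rule suminf_mult[OF smd])
      also have "\<dots> \<le> R\<^sup>2 * (\<epsilon>/2)" using RR by (intro mult_left_mono) auto
      finally have "Re (g R z - g R 0 - of_real (R\<^sup>2) * S \<theta>) \<le> R\<^sup>2 * (\<epsilon>/2)"
        using complex_Re_le_cmod[of "g R z - g R 0 - of_real (R\<^sup>2) * S \<theta>"] by linarith
      hence "Re (g R z) \<le> Re (g R 0) + R\<^sup>2 * Re (S \<theta>) + R\<^sup>2 * (\<epsilon>/2)" by (simp del: of_real_power)
      also have "Re (g R 0) \<le> R\<^sup>2 * (\<delta>/2 + \<epsilon>/2)"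
      proof -
        have "(b0 + W R) / R\<^sup>2 \<le> \<delta>/2 + \<epsilon>/2" using RR by (simp add: add_divide_distrib)
        hence "b0 + W R \<le> (\<delta>/2 + \<epsilon>/2) * R\<^sup>2" using Rp by (simp add: divide_le_eq)
        thus ?thesis unfolding g(4)[OF Rp] by (simp add: mult.commute)
      qed
      finally have "Re (g R z) \<le> (\<delta>/2 + Re (S \<theta>) + \<epsilon>) * R\<^sup>2" by (simp add: algebra_simps)
      hence "exp (Re (g R z)) \<le> exp ((\<delta>/2 + Re (S \<theta>) + \<epsilon>) * R\<^sup>2)" by simp
      thus ?thesis using g(2)[OF Rp zb] unfolding z_def by linarith
    qed
    \<comment> \<open>The asymptotic estimate starts at \<open>r = q * R0\<close>. Below that radius
      \<open>f\<close> is bounded, while the exponent may be negative, but at least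
      \<open>- Sb * R0^2\<close>; the last factor of \<open>D\<close> compensates for this.\<close>
    define D where "D = max 1 (C * exp (pi/2 * (q * R0)\<^sup>2) * exp (Sb * R0\<^sup>2))"
    have "cmod (f (rcis r \<theta>)) \<le> D * exp ((\<delta>/2 + Re (S \<theta>) + \<epsilon>) / q\<^sup>2 * r\<^sup>2)" if r: "r \<ge> 0" for r \<theta>
    proof (cases "r \<ge> q * R0")
      case True
      hence "r / q \<ge> R0" using q by (simp add: le_divide_eq mult.commute)
      from far[OF this, of \<theta>] have "cmod (f (rcis r \<theta>)) \<le> 1 * exp ((\<delta>/2 + Re (S \<theta>) + \<epsilon>) / q\<^sup>2 * r\<^sup>2)"
        using q by (simp add: power_divide)
      also have "\<dots> \<le> D * exp ((\<delta>/2 + Re (S \<theta>) + \<epsilon>) / q\<^sup>2 * r\<^sup>2)" by (intro mult_right_mono) (auto simp: D_def)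
      finally show ?thesis .
    next
      case False
      hence r2: "r\<^sup>2 \<le> (q * R0)\<^sup>2" using r by (intro power_mono) auto
      have "cmod (f (rcis r \<theta>)) \<le> C * exp (pi/2 * r\<^sup>2)" using B[of "rcis r \<theta>"] r by simp
      also have "\<dots> \<le> C * exp (pi/2 * (q * R0)\<^sup>2)" using r2 C0 by (intro mult_left_mono) auto
      also have "\<dots> = (C * exp (pi/2 * (q * R0)\<^sup>2) * exp (Sb * R0\<^sup>2)) * exp (- (Sb * R0\<^sup>2))" by (simp add: exp_minus)
      also have "\<dots> \<le> D * exp ((\<delta>/2 + Re (S \<theta>) + \<epsilon>) / q\<^sup>2 * r\<^sup>2)"
      proof (intro mult_mono)
        have "Sb / q\<^sup>2 * r\<^sup>2 \<le> Sb / q\<^sup>2 * (q * R0)\<^sup>2" using r2 Sb0 by (intro mult_left_mono) auto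
        also have "\<dots> = Sb * R0\<^sup>2" using q by (simp add: power_mult_distrib)
        finally have "- (Sb * R0\<^sup>2) \<le> (- Sb) / q\<^sup>2 * r\<^sup>2" by simp
        also have "\<dots> \<le> (\<delta>/2 + Re (S \<theta>) + \<epsilon>) / q\<^sup>2 * r\<^sup>2"
          using Sb[of \<theta>] \<delta>_nonneg \<epsilon> by (intro mult_right_mono divide_right_mono) auto
        finally show "exp (- (Sb * R0\<^sup>2)) \<le> exp ((\<delta>/2 + Re (S \<theta>) + \<epsilon>) / q\<^sup>2 * r\<^sup>2)" by simp
      qed (use C0 in \<open>auto simp: D_def\<close>)
      finally show ?thesis .
    qed
    thus ?thesis unfolding S_def by blast
  qed
  show "\<exists>\<xi> K. (\<forall>n. cmod (\<xi> n) \<le> K) \<and> (\<forall>q \<epsilon>. 0 < q \<longrightarrow> q < 1 \<longrightarrow> 0 < \<epsilon> \<longrightarrow>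
      (\<exists>D. \<forall>r\<ge>0. \<forall>\<theta>. cmod (f (rcis r \<theta>)) \<le> D * exp ((\<delta>/2 + Re (\<Sum>n. \<xi> n * rcis q \<theta> ^ Suc n) + \<epsilon>) / q\<^sup>2 * r\<^sup>2)))"
    using \<xi>K major by blast
qed

theorem theorem2:
  fixes g :: "real \<Rightarrow> complex" and \<Lambda> :: "(real \<times> real) set"
  assumes "g = (\<lambda>t. complex_of_real (exp (- pi * t\<^sup>2)))"
    and "regularly_distributed (to_complex ` \<Lambda>)"
    and "L2_complete (gabor g) \<Lambda>"
    and "L2_minimal (gabor g) \<Lambda>"
  shows "2 / pi \<le> density_of (to_complex ` \<Lambda>) \<and> density_of (to_complex ` \<Lambda>) \<le> 1"
proof -
  note compl = assms(3)[unfolded assms(1)] and minim = assms(4)[unfolded assms(1)]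
  define \<L> where "\<L> = to_complex ` \<Lambda>"
  have ang: "has_angular_density \<L>" and two: "\<exists>L. ((\<lambda>r. \<Sum>z\<in>{z \<in> \<L>. 0 < cmod z \<and> cmod z < r}. 1 / z\<^sup>2) \<longlongrightarrow> L) at_top"
    using assms(2) by (auto simp: regularly_distributed_def \<L>_def)
  obtain f C p where f: "p \<in> \<L>" "f holomorphic_on UNIV" "\<And>z. cmod (f z) \<le> C * exp (pi/2 * (cmod z)\<^sup>2)"
    "\<And>z. f z = 0 \<longleftrightarrow> z \<in> \<L> - {p}" "\<And>z. z \<in> \<L> - {p} \<Longrightarrow> deriv f z \<noteq> 0" "0 \<notin> \<L> - {p}"
    by (rule generating_function[OF compl minim, folded \<L>_def]) (rule that)
  define Z where "Z = \<L> - {p}"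
  define \<delta> where "\<delta> = pi * density_of \<L>"
  have fin: "finite (pts_below \<L> R)" for R using ang by (simp add: has_angular_density_def pts_below_def)
  have finZ: "finite (pts_below Z R)" for R by (rule finite_subset[OF _ fin[of R]]) (auto simp: pts_below_def Z_def)
  \<comment> \<open>Either \<open>p = 0\<close> and both sets agree, or the origin is not in the set
    and exactly the term at \<open>p\<close> is missing from \<open>Z\<close>. A single term affects
    none of the limits below except by a constant in the sum of \<open>1 / z^2\<close>.\<close>
  have shift: "(\<Sum>z\<in>pts_below (\<L> - {0}) R. h z) = (\<Sum>z\<in>pts_below Z R. h z) + (if p = 0 then 0 else h p)"
    if "R > cmod p" for R and h :: "complex \<Rightarrow> complex"
  proof (cases "p = 0")
    case True
    thus ?thesis by (simp add: Z_def)
  next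
    case False
    hence "pts_below (\<L> - {0}) R = insert p (pts_below Z R)" using f(1,6) that by (auto simp: pts_below_def Z_def)
    moreover have "p \<notin> pts_below Z R" by (simp add: pts_below_def Z_def)
    ultimately show ?thesis using False finZ by simp
  qed
  have lim0: "((\<lambda>R::real. x / of_real (R\<^sup>2)) \<longlongrightarrow> 0) at_top" for x :: complex
  proof (rule Lim_null_comparison)
    show "((\<lambda>R. cmod x / R\<^sup>2) \<longlongrightarrow> 0) at_top" by real_asymp
    show "eventually (\<lambda>R::real. cmod (x / of_real (R\<^sup>2)) \<le> cmod x / R\<^sup>2) at_top" by (simp add: norm_divide norm_power)
  qed
  have transfer: "((\<lambda>R. (\<Sum>z\<in>pts_below Z R. h z) / of_real (R\<^sup>2)) \<longlongrightarrow> \<tau>) at_top"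
    if "((\<lambda>R. (\<Sum>z\<in>pts_below (\<L> - {0}) R. h z) / of_real (R\<^sup>2)) \<longlongrightarrow> \<tau>) at_top" for h :: "complex \<Rightarrow> complex" and \<tau>
  proof -
    have "((\<lambda>R. (\<Sum>z\<in>pts_below (\<L> - {0}) R. h z) / of_real (R\<^sup>2) - (if p = 0 then 0 else h p) / of_real (R\<^sup>2)) \<longlongrightarrow> \<tau> - 0) at_top"
      by (intro tendsto_diff that lim0)
    moreover have "eventually (\<lambda>R. (\<Sum>z\<in>pts_below (\<L> - {0}) R. h z) / of_real (R\<^sup>2) - (if p = 0 then 0 else h p) / of_real (R\<^sup>2)
        = (\<Sum>z\<in>pts_below Z R. h z) / of_real (R\<^sup>2)) at_top"
      using eventually_gt_at_top[of "cmod p"]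
    proof eventually_elim
      case (elim R)
      show ?case unfolding shift[OF elim] by (simp add: diff_divide_distrib[symmetric])
    qed
    ultimately have "((\<lambda>R. (\<Sum>z\<in>pts_below Z R. h z) / of_real (R\<^sup>2)) \<longlongrightarrow> \<tau> - 0) at_top" by (rule Lim_transform_eventually)
    thus ?thesis by simp
  qed
  interpret quadratic_counting Z \<delta>
  proof
    show "finite (pts_below Z R)" for R by (rule finZ)
    show "0 \<notin> Z" using f(6) by (simp add: Z_def)
    have "((\<lambda>R. complex_of_real (real (card (pts_below (\<L> - {0}) R)) / R\<^sup>2)) \<longlongrightarrow> of_real \<delta>) at_top"
      unfolding \<delta>_def by (intro tendsto_of_real angular_density_limits(1) ang)
    hence "((\<lambda>R. (\<Sum>z\<in>pts_below Z R. 1) / of_real (R\<^sup>2)) \<longlongrightarrow> complex_of_real \<delta>) at_top" by (intro transfer) simp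
    from tendsto_Re[OF this] show "((\<lambda>R. real (card (pts_below Z R)) / R\<^sup>2) \<longlongrightarrow> \<delta>) at_top" by simp
  qed
  have T: "\<exists>\<tau>. ((\<lambda>R. (\<Sum>z\<in>pts_below Z R. cnj (sgn z) ^ k) / of_real (R\<^sup>2)) \<longlongrightarrow> \<tau>) at_top" for k
    by (rule exE[OF angular_density_limits(2)[OF ang, of k]], rule exI, rule transfer)
  have two': "\<exists>L. ((\<lambda>R. \<Sum>z\<in>pts_below Z R. 1 / z\<^sup>2) \<longlongrightarrow> L) at_top"
  proof -
    have "{z \<in> \<L>. 0 < cmod z \<and> cmod z < r} = pts_below (\<L> - {0}) r" for r by (auto simp: pts_below_def)
    then obtain L where "((\<lambda>r. \<Sum>z\<in>pts_below (\<L> - {0}) r. 1 / z\<^sup>2) \<longlongrightarrow> L) at_top" using two by auto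
    hence "((\<lambda>r. (\<Sum>z\<in>pts_below (\<L> - {0}) r. 1 / z\<^sup>2) - (if p = 0 then 0 else 1 / p\<^sup>2)) \<longlongrightarrow> L - (if p = 0 then 0 else 1 / p\<^sup>2)) at_top"
      by (intro tendsto_diff tendsto_const)
    moreover have "eventually (\<lambda>r. (\<Sum>z\<in>pts_below (\<L> - {0}) r. 1 / z\<^sup>2) - (if p = 0 then 0 else 1 / p\<^sup>2) = (\<Sum>z\<in>pts_below Z r. 1 / z\<^sup>2)) at_top"
      using eventually_gt_at_top[of "cmod p"]
    proof eventually_elim
      case (elim R)
      show ?case unfolding shift[OF elim] by simp
    qed
    ultimately show ?thesis by (intro exI, rule Lim_transform_eventually)
  qed
  note major = entire_majorant[OF f(2,3) f(4,5)[folded Z_def] T two']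
  have upper: "density_of \<L> \<le> 1" using major(1) by (simp add: \<delta>_def)
  obtain \<xi> K where \<xi>: "\<And>n. cmod (\<xi> n) \<le> K" "\<And>q \<epsilon>. 0 < q \<Longrightarrow> q < 1 \<Longrightarrow> 0 < \<epsilon> \<Longrightarrow>
      \<exists>D. \<forall>r\<ge>0. \<forall>\<theta>. cmod (f (rcis r \<theta>)) \<le> D * exp ((\<delta>/2 + Re (\<Sum>n. \<xi> n * rcis q \<theta> ^ Suc n) + \<epsilon>) / q\<^sup>2 * r\<^sup>2)"
    using major(2) by blast
  have f0: "f 0 \<noteq> 0" using f(4,6) by auto
  have gap: "\<not> subextremal_between f \<alpha> \<beta>" if "\<alpha> + pi/2 < \<beta>" for \<alpha> \<beta>
    using f(4) by (intro no_long_subextremal_interval[OF compl f(2,3) _ f0 that, of p]) (auto simp: \<L>_def)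
  \<comment> \<open>The chain argument, applied to the antiderivative of the majorant: its slope is
    the mean \<open>(\<delta>/2 + \<epsilon>) / q^2\<close>, its periodic part is bounded, so the
    slope is at least 1.\<close>
  have mean: "q\<^sup>2 \<le> \<delta>/2 + \<epsilon>" if q: "0 < q" "q < 1" and \<epsilon>: "\<epsilon> > 0" for q \<epsilon>
  proof -
    define S where "S \<theta> = (\<Sum>n. \<xi> n * rcis q \<theta> ^ Suc n)" for \<theta>
    obtain D where D: "\<And>r \<theta>. r \<ge> 0 \<Longrightarrow> cmod (f (rcis r \<theta>)) \<le> D * exp ((\<delta>/2 + Re (S \<theta>) + \<epsilon>) / q\<^sup>2 * r\<^sup>2)"
      using \<xi>(2)[OF q \<epsilon>] unfolding S_def by blast
    obtain J B where J: "\<And>x. ((\<lambda>x. Re (J x)) has_real_derivative Re (S x)) (at x)" "\<And>x. Re (J x) \<le> B"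
      by (rule circle_series_antiderivative[where \<xi> = \<xi>, OF \<xi>(1) q, folded S_def]) (rule that)
    define m where "m = (\<delta>/2 + \<epsilon>) / q\<^sup>2"
    have "m \<ge> 1"
    proof (rule mean_ge_one_of_chain[where E = "{\<theta>. \<not> subextremal_angle f \<theta>}"])
      show "((\<lambda>x. m * x + Re (J x) / q\<^sup>2) has_real_derivative (\<delta>/2 + Re (S x) + \<epsilon>) / q\<^sup>2) (at x)" for x
      proof -
        have "((\<lambda>x. m * x + Re (J x) / q\<^sup>2) has_real_derivative (m + Re (S x) / q\<^sup>2)) (at x)"
          by (rule DERIV_add[OF DERIV_cmult_Id DERIV_cdivide[OF J(1)]])
        thus ?thesis by (simp add: m_def add_divide_distrib algebra_simps)
      qed
      show "closed {\<theta>. \<not> subextremal_angle f \<theta>}" "{\<theta>. \<not> subextremal_angle f \<theta>} \<noteq> {}"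
        using extremal_angles_chain(1,2)[OF gap] by auto
      show "\<exists>\<theta>'\<in>{\<theta>. \<not> subextremal_angle f \<theta>}. \<theta> < \<theta>' \<and> \<theta>' \<le> \<theta> + pi/2" if "\<theta> \<in> {\<theta>. \<not> subextremal_angle f \<theta>}" for \<theta>
        using extremal_angles_chain(3)[OF gap that] .
      show "(\<delta>/2 + Re (S (\<theta> + u)) + \<epsilon>) / q\<^sup>2 \<ge> pi/2 * cos (2 * u)" if "\<theta> \<in> {\<theta>. \<not> subextremal_angle f \<theta>}" "0 < \<bar>u\<bar>" "\<bar>u\<bar> \<le> pi/4" for \<theta> u
        using that by (intro extremal_angle_lower_bound[OF f(2,3) _ _ _ D]) auto
      show "m * x + Re (J x) / q\<^sup>2 \<le> m * x + B / q\<^sup>2" for x using J(2)[of x] by (simp add: divide_right_mono)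
    qed
    thus ?thesis using q by (simp add: m_def le_divide_eq)
  qed
  have "\<delta> \<ge> 2"
  proof (rule ccontr)
    assume "\<not> \<delta> \<ge> 2"
    hence d: "\<delta>/2 < 1" by simp
    \<comment> \<open>Both losses, \<open>1 - q^2\<close> and \<open>\<epsilon>\<close>, are set
      equal to \<open>s\<close>; together they use up half of the deficit
      \<open>1 - \<delta>/2\<close>.\<close>
    define s where "s = (1 - \<delta>/2) / 4"
    have s: "s > 0" "s < 1" using d \<delta>_nonneg by (auto simp: s_def)
    have "(sqrt (1 - s))\<^sup>2 \<le> \<delta>/2 + s" using s by (intro mean) auto
    hence "1 - s \<le> \<delta>/2 + s" using s by simp
    moreover have "4 * s = 1 - \<delta>/2" by (simp add: s_def)
    ultimately show False using d by linarith
  qed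
  hence "2 / pi \<le> density_of \<L>" by (simp add: \<delta>_def divide_le_eq mult.commute)
  thus ?thesis using upper unfolding \<L>_def by simp
qed

end
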